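(* Let $P$ be a set of prime numbers, $G$ a pro-$P$ group, $\Omega\cong\mathbb Z_P=\prod_{p\in P}\mathbb Z_p$ with a fixed topological generator $\omega$, and $d:G\to\Omega$ a surjective continuous homomorphism. Let $\mathfrak E$ be a $G$-spectrum and let $(C,v)$ be a Fesenko--Neukirch datum on $\mathfrak E$. Then for each $(H,U)\in\mathfrak E_{\mathrm b}$ the assignment $$\widetilde\Upsilon_{(H,U)}:\mathrm{Frob}_H\to C(H)/\mathrm{ind}^C_{H,U}C(U),\qquad h\mapsto\mathrm{ind}^C_{H,\Sigma_{h,H|U}}(\pi_h)^{P'(d_H(h))}\bmod\mathrm{ind}^C_{H,U}C(U),$$ where $\pi_h\in C(\Sigma_{h,H|U})$ is a prime element, is a semigroup morphism which is independent of the choice of the prime elements.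
   Context: ${}^gH=gHg^{-1}$, $H^g=g^{-1}Hg$; $\langle h\rangle_{\mathrm c}$ is the closure of $\langle h\rangle$. RIC-functors. A RIC-domain $\mathfrak D$ consists of a non-empty set $\mathfrak D_{\mathrm b}$ with a left action $(g,x)\mapsto{}^gx$ of a group $G$ and, for each $x\in\mathfrak D_{\mathrm b}$, subsets $\mathfrak D_{\mathrm r}(x),\mathfrak D_{\mathrm i}(x)\subseteq\mathfrak D_{\mathrm b}$ such that for $\star\in\{\mathrm r,\mathrm i\}$: $x\in\mathfrak D_\star(x)$; $y\in\mathfrak D_\star(x)$ implies $\mathfrak D_\star(y)\subseteq\mathfrak D_\star(x)$; ${}^g\mathfrak D_\star(x)=\mathfrak D_\star({}^gx)$. A RIC-functor $\Phi:\mathfrak D\to\mathcal C$ consists of objects $\Phi(x)$ and morphisms $\mathrm{res}_{y,x}:\Phi(x)\to\Phi(y)$ ($y\in\mathfrak D_{\mathrm r}(x)$), $\mathrm{ind}_{x,y}:\Phi(y)\to\Phi(x)$ ($y\in\mathfrak D_{\mathrm i}(x)$), $\mathrm{con}_{g,x}:\Phi(x)\to\Phi({}^gx)$ such that $\mathrm{res}_{x,x}=\mathrm{ind}_{x,x}=\mathrm{con}_{1,x}=\mathrm{id}$; $\mathrm{res}_{z,y}\mathrm{res}_{y,x}=\mathrm{res}_{z,x}$, $\mathrm{ind}_{x,y}\mathrm{ind}_{y,z}=\mathrm{ind}_{x,z}$, $\mathrm{con}_{g',{}^gx}\mathrm{con}_{g,x}=\mathrm{con}_{g'g,x}$; $\mathrm{con}_{g,y}\mathrm{res}_{y,x}=\mathrm{res}_{{}^gy,{}^gx}\mathrm{con}_{g,x}$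 and $\mathrm{con}_{g,x}\mathrm{ind}_{x,y}=\mathrm{ind}_{{}^gx,{}^gy}\mathrm{con}_{g,y}$. Morphisms are families $(\varphi_x)$ commuting with res, ind, con; the category is $\mathsf{Fct}(\mathfrak D,\mathcal C)$. Subgroup systems and Mackey functors. A $G$-subgroup system is a RIC-domain $\mathfrak S$ where $\mathfrak S_{\mathrm b}$ is a set of subgroups of $G$ with the conjugation action and $I\le H$ for $I\in\mathfrak S_\star(H)$; $\mathfrak S'\le\mathfrak S$ means $\mathfrak S'_{\mathrm b}\subseteq\mathfrak S_{\mathrm b}$, $\mathfrak S'_\star(H)\subseteq\mathfrak S_\star(H)$. It is arithmetic if $\mathfrak S_{\mathrm r}(H)$ and $\mathfrak S_{\mathrm i}(H)$ contain all open subgroups of $H$ for each $H\in\mathfrak S_{\mathrm b}$. It is a $G$-Mackey system if for $I\in\mathfrak S_{\mathrm r}(H)$, $J\in\mathfrak S_{\mathrm i}(H)$ the set $I\backslash H/J$ is finite, $I\cap J\in\mathfrak S_{\mathrm r}(J)$ and $I\cap J\in\mathfrak S_{\mathrm i}(I)$. A cohomological Mackey functor $C:\mathfrak M\to\mathsf{Ab}$ on a Mackey system is a RIC-functor with $\mathrm{con}_{h,H}=\mathrm{id}$ for $h\in H$, $\mathrm{res}_{I,H}\mathrm{ind}_{H,J}=\sum_{h}\mathrm{ind}_{I,I\cap{}^hJ}\,\mathrm{con}_{h,I^h\cap J}\,\mathrm{res}_{I^h\cap J,J}$ ($h$ over representatives of $I\backslash H/J$), and $\mathrm{ind}_{H,I}\mathrm{res}_{I,H}=[H:I]\,\mathrm{id}$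 for $I\in\mathfrak M_{\mathrm r}(H)\cap\mathfrak M_{\mathrm i}(H)$. Groups $C(H)$ are written multiplicatively. Ramification. For closed subgroups $K\le H$ of $G$: $I_H=H\cap\ker d$, $f_{H|K}=[d(H):d(K)]$, $f_H=f_{G|H}$, $e_{H|K}=[I_H:I_K]$. $H$ is inertially finite if closed with $f_H<\infty$; then $d(H)=f_H\Omega$ and $d_H=\frac1{f_H}d|_H:H\to\Omega$ is surjective with kernel $I_H$. For a closed subgroup $H$, $\mathcal E^{\mathrm{ur}}(H)$ is the set of open normal subgroups $U$ of $H$ with $I_H\le U$; for $H$ inertially finite and $U\in\mathcal E^{\mathrm{ur}}(H)$ the Frobenius element $\varphi_{H|U}\in H/U$ is the image of any $h\in H$ with $d_H(h)=\omega$. A $G$-subgroup system is inertially finite if all members are inertially finite closed subgroups and $[H:I]<\infty$ for $I\in\mathfrak S_{\mathrm r}(H)$. Frobenius groups. $\Omega^+=\{n\omega:n\in\mathbb N_{>0}\}$; for $x\in\Omega^+$, $\mathrm{mult}(x)$ is the unique $n\in\mathbb N_{>0}$ with $x=n\omega$. For $n=\prod_pp^{n(p)}$ put $P(n)=\prod_{p\in P}p^{n(p)}$, $P'(n)=\prod_{p\notin P}p^{n(p)}$. For $H$ inertially finite, $\mathrm{Frob}_H=\{h\in H:d_H(h)\in\Omega^+\}$, a sub-semigroup of $H$; for $h\in\mathrm{Frob}_H$ write $P(d_H(h))=P(\mathrm{mult}(d_H(h)))$ and $P'(d_H(h))=P'(\mathrm{mult}(d_H(h)))$. For $(H,U)\in\mathfrak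 E_{\mathrm b}$ and $h\in\mathrm{Frob}_H$, $\Sigma_{h,H|U}=\langle h\rangle_{\mathrm c}\cdot I_U$; when $U$ is open in $H$ this is the Frobenius group for $h$ relative to $U$, i.e. the unique open subgroup $\Sigma$ of $H$ with $h\in\Sigma$, $f_{H|\Sigma}=P(d_H(h))$ and $I_\Sigma=I_U$. Spectra. A two-dimensional $G$-subgroup system is a RIC-domain $\mathfrak E$ with $\mathfrak E_{\mathrm b}$ a set of pairs $(H,U)$ ($H$ closed subgroup of $G$, $U$ closed normal subgroup of $H$) with componentwise conjugation and $I\le H$, $V\le U$ for $(I,V)\in\mathfrak E_\star(H,U)$. $\mathfrak E^\flat_{\mathrm b}$ is the set of first components of $\mathfrak E_{\mathrm b}$, $\mathrm{Ext}(\mathfrak E,H)=\{U:(H,U)\in\mathfrak E_{\mathrm b}\}$, $\mathfrak E^\flat_\star(H)$ the set of first components of $\bigcup_U\mathfrak E_\star(H,U)$. $\mathfrak E$ is a $G$-spectrum if $\mathfrak E^\flat$ is a $G$-subgroup system, $(I,V)\in\mathfrak E_{\mathrm r}(H,U)$ implies $V=U$, and $[H:I]<\infty$ for $I\in\mathfrak E^\flat_{\mathrm r}(H)$. A Mackey cover of $\mathfrak E$ is a $G$-Mackey system $\mathfrak M$ with $\mathfrak E^\flat\le\mathfrak M$, $\mathrm{Ext}(\mathfrak E,H)\subseteq\mathfrak M_{\mathrm i}(H)$, and $V\in\mathfrak M_{\mathrm i}(U)$ whenever $(I,V)\in\mathfrak E_{\mathrm i}(H,U)$. Valuations. For inertially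 finite $\mathfrak M$ let $\boldsymbol\Omega_d\in\mathsf{Fct}(\mathfrak M,\mathsf{Ab})$ be: $\boldsymbol\Omega_d(H)=\Omega$, con $=\mathrm{id}$, $\mathrm{res}_{K,H}$ = multiplication by $e_{H|K}$, $\mathrm{ind}_{H,K}$ = multiplication by $f_{H|K}$. $\mathrm{Val}_d^{\Omega,\omega}(C)$ is the set of morphisms $v:C\to\boldsymbol\Omega_d$ with $\omega\in\mathrm{im}(v_H)$ for all $H\in\mathfrak M_{\mathrm b}$. A prime element of $C(H)$ is $\pi\in C(H)$ with $v_H(\pi)=\omega$. Fesenko--Neukirch datum on $\mathfrak E$: a pair $(C,v)$ with $C:\mathfrak M\to\mathsf{Ab}$ a cohomological Mackey functor on an arithmetic and inertially finite Mackey cover $\mathfrak M$ of $\mathfrak E$ and $v\in\mathrm{Val}_d^{\Omega,\omega}(C)$ such that (1) for each $(H,U)\in\mathfrak E_{\mathrm b}$ with $U\in\mathcal E^{\mathrm{ur}}(H)$: $\mathrm{im}(v_H)/[H:U]\,\mathrm{im}(v_U)$ has order $[H:U]$ and is generated by the image of $\omega$; $\mathrm{ind}^C_{H,U}:\ker(v_U)\to\ker(v_H)$ is surjective; $|C(H)/\mathrm{ind}^C_{H,U}C(U)|\le[H:U]$; (2) for each open subgroup $U$ of a group $H\in\mathfrak E^\flat_{\mathrm b}$ and each $V\in\mathcal E^{\mathrm{ur}}(U)$ the sequence $1\to\ker(v_U)\xrightarrow{\mathrm{res}_{V,U}}\ker(v_V)\xrightarrow{\mathrm{con}_{\varphi-1,V}}\ker(v_V)\xrightarrow{\mathrm{ind}_{U,V}}\ker(v_U)\to1$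 is exact, where $\varphi=\varphi_{U|V}$ and $\mathrm{con}_{\varphi-1,V}(x)=\mathrm{con}_{\tilde\varphi,V}(x)x^{-1}$ for any representative $\tilde\varphi\in U$ of $\varphi$.
   Formalization: Proved for those (H,U) in E_b with U open in H; for non-open U the group Σ_{h,H|U} need not lie in the Mackey system, and even if it does the independence of the prime elements can fail. *)

theory Defs
  imports
    "HOL-Analysis.Analysis"
    "HOL-Algebra.Group_Action"
    "HOL-Algebra.FiniteProduct"
    "HOL-Algebra.Product_Groups"
    "HOL-Algebra.Exact_Sequence"
    "HOL-Computational_Algebra.Primes"
begin

section \<open>Indices of subgroups\<close>

definition cosets_in :: "'g monoid \<Rightarrow> 'g set \<Rightarrow> 'g set \<Rightarrow> 'g set set"
  where "cosets_in G H K = rcosets\<^bsub>G\<lparr>carrier := H\<rparr>\<^esub> K"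

definition finite_index :: "'g monoid \<Rightarrow> 'g set \<Rightarrow> 'g set \<Rightarrow> bool"
  where "finite_index G H K \<longleftrightarrow> finite (cosets_in G H K)"

text \<open>The index \<open>[H:K]\<close>. It is 0 when it is infinite, so it is meaningful only together with
  \<^const>\<open>finite_index\<close>.\<close>

definition index :: "'g monoid \<Rightarrow> 'g set \<Rightarrow> 'g set \<Rightarrow> nat"
  where "index G H K = card (cosets_in G H K)"

definition conj_set :: "'g monoid \<Rightarrow> 'g \<Rightarrow> 'g set \<Rightarrow> 'g set"
  where "conj_set G g H = g <#\<^bsub>G\<^esub> H #>\<^bsub>G\<^esub> (inv\<^bsub>G\<^esub> g)"

definition double_coset :: "'g monoid \<Rightarrow> 'g set \<Rightarrow> 'g set \<Rightarrow> 'g \<Rightarrow> 'g set"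
  where "double_coset G I J h = (I #>\<^bsub>G\<^esub> h) <#>\<^bsub>G\<^esub> J"

definition double_cosets :: "'g monoid \<Rightarrow> 'g set \<Rightarrow> 'g set \<Rightarrow> 'g set \<Rightarrow> 'g set set"
  where "double_cosets G I H J = double_coset G I J ` H"

definition double_coset_reps :: "'g monoid \<Rightarrow> 'g set \<Rightarrow> 'g set \<Rightarrow> 'g set \<Rightarrow> 'g set \<Rightarrow> bool"
  where "double_coset_reps G I H J R \<longleftrightarrow>
    R \<subseteq> H \<and> bij_betw (double_coset G I J) R (double_cosets G I H J)"

section \<open>Topological groups\<close>

definition topological_group :: "'g monoid \<Rightarrow> 'g topology \<Rightarrow> bool"
  where "topological_group G T \<longleftrightarrow>
    group G \<and> topspace T = carrier G \<and>
    continuous_map (prod_topology T T) T (\<lambda>(x, y). x \<otimes>\<^bsub>G\<^esub> y) \<and>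
    continuous_map T T (\<lambda>x. inv\<^bsub>G\<^esub> x)"

definition profinite_group :: "'g monoid \<Rightarrow> 'g topology \<Rightarrow> bool"
  where "profinite_group G T \<longleftrightarrow>
    topological_group G T \<and> compact_space T \<and> Hausdorff_space T \<and>
    (\<forall>x\<in>topspace T. connected_component_of_set T x = {x})"

definition pro_P_group :: "nat set \<Rightarrow> 'g monoid \<Rightarrow> 'g topology \<Rightarrow> bool"
  where "pro_P_group P G T \<longleftrightarrow>
    profinite_group G T \<and>
    (\<forall>N. N \<lhd> G \<and> openin T N \<longrightarrow> (\<forall>p. prime p \<and> p dvd order (G Mod N) \<longrightarrow> p \<in> P))"

definition closed_subgroup :: "'g monoid \<Rightarrow> 'g topology \<Rightarrow> 'g set \<Rightarrow> bool"
  where "closed_subgroup G T H \<longleftrightarrow> subgroup H G \<and> closedin T H"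

definition open_subgroup_of :: "'g monoid \<Rightarrow> 'g topology \<Rightarrow> 'g set \<Rightarrow> 'g set \<Rightarrow> bool"
  where "open_subgroup_of G T U H \<longleftrightarrow>
    subgroup U (G\<lparr>carrier := H\<rparr>) \<and> openin (subtopology T H) U"

definition closed_generated :: "'g monoid \<Rightarrow> 'g topology \<Rightarrow> 'g \<Rightarrow> 'g set"
  where "closed_generated G T h = T closure_of (generate G {h})"

text \<open>The additive group of p-adic integers is the inverse limit of the groups
  \<open>\<int>/p\<^sup>n\<int>\<close>: an element is a compatible sequence of residues \<open>x n \<in> {0..<p\<^sup>n}\<close>.
  All groups, including additive ones, are written with the \<^typ>\<open>'a monoid\<close> record.\<close>

definition Zp_group :: "nat \<Rightarrow> (nat \<Rightarrow> int) monoid"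
  where "Zp_group p =
    \<lparr>carrier = {x. \<forall>n. 0 \<le> x n \<and> x n < int p ^ n \<and> x (Suc n) mod int p ^ n = x n},
     monoid.mult = (\<lambda>x y n. (x n + y n) mod int p ^ n),
     one = (\<lambda>_. 0)\<rparr>"

definition Zp_topology :: "nat \<Rightarrow> (nat \<Rightarrow> int) topology"
  where "Zp_topology p =
    subtopology (product_topology (\<lambda>_. discrete_topology UNIV) UNIV) (carrier (Zp_group p))"

definition ZP_group :: "nat set \<Rightarrow> (nat \<Rightarrow> nat \<Rightarrow> int) monoid"
  where "ZP_group P = product_group P Zp_group"

definition ZP_topology :: "nat set \<Rightarrow> (nat \<Rightarrow> nat \<Rightarrow> int) topology"
  where "ZP_topology P = product_topology Zp_topology P"

definition top_group_iso ::
    "'g monoid \<Rightarrow> 'g topology \<Rightarrow> 'h monoid \<Rightarrow> 'h topology \<Rightarrow> ('g \<Rightarrow> 'h) \<Rightarrow> bool"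
  where "top_group_iso G T H S f \<longleftrightarrow> f \<in> iso G H \<and> homeomorphic_map T S f"

section \<open>RIC-domains and RIC-functors into abelian groups\<close>

record 'x ric =
  Base :: "'x set"
  Res  :: "'x \<Rightarrow> 'x set"
  Ind  :: "'x \<Rightarrow> 'x set"

definition ric_family :: "'g monoid \<Rightarrow> ('g \<Rightarrow> 'x \<Rightarrow> 'x) \<Rightarrow> 'x set \<Rightarrow> ('x \<Rightarrow> 'x set) \<Rightarrow> bool"
  where "ric_family G act B S \<longleftrightarrow>
    (\<forall>x\<in>B. S x \<subseteq> B \<and> x \<in> S x \<and> (\<forall>y\<in>S x. S y \<subseteq> S x) \<and>
      (\<forall>g\<in>carrier G. act g ` S x = S (act g x)))"

definition ric_domain :: "'g monoid \<Rightarrow> ('g \<Rightarrow> 'x \<Rightarrow> 'x) \<Rightarrow> 'x ric \<Rightarrow> bool"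
  where "ric_domain G act D \<longleftrightarrow>
    Base D \<noteq> {} \<and>
    group_action G (Base D) (\<lambda>g. \<lambda>x\<in>Base D. act g x) \<and>
    ric_family G act (Base D) (Res D) \<and>
    ric_family G act (Base D) (Ind D)"

text \<open>For a functor \<open>F\<close>, \<open>res_map F y x\<close> is \<open>res\<^sub>y\<^sub>,\<^sub>x : F x \<rightarrow> F y\<close>, \<open>ind_map F x y\<close> is
  \<open>ind\<^sub>x\<^sub>,\<^sub>y : F y \<rightarrow> F x\<close> and \<open>con_map F g x\<close> is \<open>con\<^sub>g\<^sub>,\<^sub>x : F x \<rightarrow> F (\<^sup>gx)\<close>.
  That all the groups have elements in one type is no restriction, as the family of objects is
  indexed by a set. Morphisms are compared on carriers only.\<close>

record ('x, 'g, 'a) ric_functor =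
  Obj :: "'x \<Rightarrow> 'a monoid"
  res_map :: "'x \<Rightarrow> 'x \<Rightarrow> 'a \<Rightarrow> 'a"
  ind_map :: "'x \<Rightarrow> 'x \<Rightarrow> 'a \<Rightarrow> 'a"
  con_map :: "'g \<Rightarrow> 'x \<Rightarrow> 'a \<Rightarrow> 'a"

definition ric_functor_Ab ::
    "'g monoid \<Rightarrow> ('g \<Rightarrow> 'x \<Rightarrow> 'x) \<Rightarrow> 'x ric \<Rightarrow> ('x, 'g, 'a) ric_functor \<Rightarrow> bool"
  where "ric_functor_Ab G act D F \<longleftrightarrow>
    (\<forall>x\<in>Base D. comm_group (Obj F x)) \<and>
    (\<forall>x\<in>Base D. \<forall>y\<in>Res D x. res_map F y x \<in> hom (Obj F x) (Obj F y)) \<and>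
    (\<forall>x\<in>Base D. \<forall>y\<in>Ind D x. ind_map F x y \<in> hom (Obj F y) (Obj F x)) \<and>
    (\<forall>x\<in>Base D. \<forall>g\<in>carrier G. con_map F g x \<in> hom (Obj F x) (Obj F (act g x))) \<and>
    (\<forall>x\<in>Base D. \<forall>a\<in>carrier (Obj F x).
       res_map F x x a = a \<and> ind_map F x x a = a \<and> con_map F \<one>\<^bsub>G\<^esub> x a = a) \<and>
    (\<forall>x\<in>Base D. \<forall>y\<in>Res D x. \<forall>z\<in>Res D y. \<forall>a\<in>carrier (Obj F x).
       res_map F z y (res_map F y x a) = res_map F z x a) \<and>
    (\<forall>x\<in>Base D. \<forall>y\<in>Ind D x. \<forall>z\<in>Ind D y. \<forall>a\<in>carrier (Obj F z).
       ind_map F x y (ind_map F y z a) = ind_map F x z a) \<and>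
    (\<forall>x\<in>Base D. \<forall>g\<in>carrier G. \<forall>g'\<in>carrier G. \<forall>a\<in>carrier (Obj F x).
       con_map F g' (act g x) (con_map F g x a) = con_map F (g' \<otimes>\<^bsub>G\<^esub> g) x a) \<and>
    (\<forall>x\<in>Base D. \<forall>y\<in>Res D x. \<forall>g\<in>carrier G. \<forall>a\<in>carrier (Obj F x).
       con_map F g y (res_map F y x a) = res_map F (act g y) (act g x) (con_map F g x a)) \<and>
    (\<forall>x\<in>Base D. \<forall>y\<in>Ind D x. \<forall>g\<in>carrier G. \<forall>a\<in>carrier (Obj F y).
       con_map F g x (ind_map F x y a) = ind_map F (act g x) (act g y) (con_map F g y a))"

definition ric_morphism ::
    "'g monoid \<Rightarrow> ('g \<Rightarrow> 'x \<Rightarrow> 'x) \<Rightarrow> 'x ric \<Rightarrow> ('x, 'g, 'a) ric_functor \<Rightarrow>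
     ('x, 'g, 'b) ric_functor \<Rightarrow> ('x \<Rightarrow> 'a \<Rightarrow> 'b) \<Rightarrow> bool"
  where "ric_morphism G act D F F' \<phi> \<longleftrightarrow>
    (\<forall>x\<in>Base D. \<phi> x \<in> hom (Obj F x) (Obj F' x)) \<and>
    (\<forall>x\<in>Base D. \<forall>y\<in>Res D x. \<forall>a\<in>carrier (Obj F x).
       \<phi> y (res_map F y x a) = res_map F' y x (\<phi> x a)) \<and>
    (\<forall>x\<in>Base D. \<forall>y\<in>Ind D x. \<forall>a\<in>carrier (Obj F y).
       \<phi> x (ind_map F x y a) = ind_map F' x y (\<phi> y a)) \<and>
    (\<forall>x\<in>Base D. \<forall>g\<in>carrier G. \<forall>a\<in>carrier (Obj F x).
       \<phi> (act g x) (con_map F g x a) = con_map F' g x (\<phi> x a))"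

section \<open>Subgroup systems and Mackey functors\<close>

definition subgroup_system :: "'g monoid \<Rightarrow> 'g set ric \<Rightarrow> bool"
  where "subgroup_system G S \<longleftrightarrow>
    (\<forall>H\<in>Base S. subgroup H G) \<and>
    ric_domain G (conj_set G) S \<and>
    (\<forall>H\<in>Base S. \<forall>I\<in>Res S H \<union> Ind S H. I \<subseteq> H)"

definition subsystem :: "'x ric \<Rightarrow> 'x ric \<Rightarrow> bool"
  where "subsystem S' S \<longleftrightarrow>
    Base S' \<subseteq> Base S \<and> (\<forall>H\<in>Base S'. Res S' H \<subseteq> Res S H \<and> Ind S' H \<subseteq> Ind S H)"

definition arithmetic_system :: "'g monoid \<Rightarrow> 'g topology \<Rightarrow> 'g set ric \<Rightarrow> bool"
  where "arithmetic_system G T S \<longleftrightarrow>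
    (\<forall>H\<in>Base S. \<forall>U. open_subgroup_of G T U H \<longrightarrow> U \<in> Res S H \<and> U \<in> Ind S H)"

definition Mackey_system :: "'g monoid \<Rightarrow> 'g set ric \<Rightarrow> bool"
  where "Mackey_system G M \<longleftrightarrow>
    subgroup_system G M \<and>
    (\<forall>H\<in>Base M. \<forall>I\<in>Res M H. \<forall>J\<in>Ind M H.
       finite (double_cosets G I H J) \<and> I \<inter> J \<in> Res M J \<and> I \<inter> J \<in> Ind M I)"

definition cohomological_Mackey_functor ::
    "'g monoid \<Rightarrow> 'g set ric \<Rightarrow> ('g set, 'g, 'a) ric_functor \<Rightarrow> bool"
  where "cohomological_Mackey_functor G M C \<longleftrightarrow>
    Mackey_system G M \<and>
    ric_functor_Ab G (conj_set G) M C \<and>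
    (\<forall>H\<in>Base M. \<forall>h\<in>H. \<forall>a\<in>carrier (Obj C H). con_map C h H a = a) \<and>
    (\<forall>H\<in>Base M. \<forall>I\<in>Res M H. \<forall>J\<in>Ind M H. \<forall>R. double_coset_reps G I H J R \<longrightarrow>
       (\<forall>a\<in>carrier (Obj C J).
          res_map C I H (ind_map C H J a) =
          (\<Otimes>\<^bsub>Obj C I\<^esub>h\<in>R.
             (let K = conj_set G (inv\<^bsub>G\<^esub> h) I \<inter> J
              in ind_map C I (I \<inter> conj_set G h J) (con_map C h K (res_map C K J a)))))) \<and>
    (\<forall>H\<in>Base M. \<forall>I\<in>Res M H \<inter> Ind M H. \<forall>a\<in>carrier (Obj C H).
       ind_map C H I (res_map C I H a) = a [^]\<^bsub>Obj C H\<^esub> index G H I)"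

section \<open>Ramification theory\<close>

definition inertia :: "'g monoid \<Rightarrow> 'o monoid \<Rightarrow> ('g \<Rightarrow> 'o) \<Rightarrow> 'g set \<Rightarrow> 'g set"
  where "inertia G \<Omega> d H = H \<inter> kernel G \<Omega> d"

definition f_index :: "'o monoid \<Rightarrow> ('g \<Rightarrow> 'o) \<Rightarrow> 'g set \<Rightarrow> 'g set \<Rightarrow> nat"
  where "f_index \<Omega> d H K = index \<Omega> (d ` H) (d ` K)"

definition e_index :: "'g monoid \<Rightarrow> 'o monoid \<Rightarrow> ('g \<Rightarrow> 'o) \<Rightarrow> 'g set \<Rightarrow> 'g set \<Rightarrow> nat"
  where "e_index G \<Omega> d H K = index G (inertia G \<Omega> d H) (inertia G \<Omega> d K)"

definition inertially_finite ::
    "'g monoid \<Rightarrow> 'g topology \<Rightarrow> 'o monoid \<Rightarrow> ('g \<Rightarrow> 'o) \<Rightarrow> 'g set \<Rightarrow> bool"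
  where "inertially_finite G T \<Omega> d H \<longleftrightarrow>
    closed_subgroup G T H \<and> finite_index \<Omega> (d ` carrier G) (d ` H)"

text \<open>The normalised map \<open>d\<^sub>H = (1/f\<^sub>H) d|\<^sub>H\<close>: division by \<open>f\<^sub>H\<close> is unique in the
  torsion-free group \<open>\<Omega>\<close>.\<close>

definition d_norm :: "'g monoid \<Rightarrow> 'o monoid \<Rightarrow> ('g \<Rightarrow> 'o) \<Rightarrow> 'g set \<Rightarrow> 'g \<Rightarrow> 'o"
  where "d_norm G \<Omega> d H h =
    (THE x. x \<in> carrier \<Omega> \<and> x [^]\<^bsub>\<Omega>\<^esub> f_index \<Omega> d (carrier G) H = d h)"

definition E_ur ::
    "'g monoid \<Rightarrow> 'g topology \<Rightarrow> 'o monoid \<Rightarrow> ('g \<Rightarrow> 'o) \<Rightarrow> 'g set \<Rightarrow> 'g set set"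
  where "E_ur G T \<Omega> d H =
    {U. U \<lhd> G\<lparr>carrier := H\<rparr> \<and> open_subgroup_of G T U H \<and> inertia G \<Omega> d H \<subseteq> U}"

text \<open>The Frobenius element as an element (coset) of \<open>H/U\<close>.\<close>

definition frobenius_elt ::
    "'g monoid \<Rightarrow> 'o monoid \<Rightarrow> 'o \<Rightarrow> ('g \<Rightarrow> 'o) \<Rightarrow> 'g set \<Rightarrow> 'g set \<Rightarrow> 'g set"
  where "frobenius_elt G \<Omega> \<omega> d H U =
    (THE c. \<exists>h\<in>H. d_norm G \<Omega> d H h = \<omega> \<and> c = U #>\<^bsub>G\<^esub> h)"

definition inertially_finite_system ::
    "'g monoid \<Rightarrow> 'g topology \<Rightarrow> 'o monoid \<Rightarrow> ('g \<Rightarrow> 'o) \<Rightarrow> 'g set ric \<Rightarrow> bool"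
  where "inertially_finite_system G T \<Omega> d S \<longleftrightarrow>
    (\<forall>H\<in>Base S. inertially_finite G T \<Omega> d H \<and> (\<forall>I\<in>Res S H. finite_index G H I))"

section \<open>Frobenius groups\<close>

text \<open>For \<open>x\<close> in \<open>\<Omega>\<^sup>+\<close> the natural number \<open>omega_mult \<Omega> \<omega> x\<close> is the unique
  \<open>n > 0\<close> with \<open>x = n\<omega>\<close>, and \<open>P_part_compl P n\<close> is \<open>P'(n)\<close>.\<close>

definition Omega_pos :: "'o monoid \<Rightarrow> 'o \<Rightarrow> 'o set"
  where "Omega_pos \<Omega> \<omega> = {\<omega> [^]\<^bsub>\<Omega>\<^esub> n | n::nat. n > 0}"

definition omega_mult :: "'o monoid \<Rightarrow> 'o \<Rightarrow> 'o \<Rightarrow> nat"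
  where "omega_mult \<Omega> \<omega> x = (THE n. n > 0 \<and> x = \<omega> [^]\<^bsub>\<Omega>\<^esub> n)"

definition P_part_compl :: "nat set \<Rightarrow> nat \<Rightarrow> nat"
  where "P_part_compl P n = (\<Prod>p\<in>prime_factors n - P. p ^ multiplicity p n)"

definition Frob :: "'g monoid \<Rightarrow> 'o monoid \<Rightarrow> 'o \<Rightarrow> ('g \<Rightarrow> 'o) \<Rightarrow> 'g set \<Rightarrow> 'g set"
  where "Frob G \<Omega> \<omega> d H = {h \<in> H. d_norm G \<Omega> d H h \<in> Omega_pos \<Omega> \<omega>}"

text \<open>The group \<open>\<Sigma> = \<langle>h\<rangle>\<^sub>c \<cdot> I\<^sub>U\<close> attached to \<open>h\<close> and a pair \<open>(H, U)\<close>; it does not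
  depend on \<open>H\<close>. It is open in \<open>H\<close> when \<open>U\<close> is, and only then is it called the
  Frobenius group for \<open>h\<close> relative to \<open>U\<close>.\<close>

definition frobenius_group ::
    "'g monoid \<Rightarrow> 'g topology \<Rightarrow> 'o monoid \<Rightarrow> ('g \<Rightarrow> 'o) \<Rightarrow> 'g set \<Rightarrow> 'g \<Rightarrow> 'g set"
  where "frobenius_group G T \<Omega> d U h = closed_generated G T h <#>\<^bsub>G\<^esub> inertia G \<Omega> d U"

section \<open>Spectra\<close>

definition conj_pair :: "'g monoid \<Rightarrow> 'g \<Rightarrow> 'g set \<times> 'g set \<Rightarrow> 'g set \<times> 'g set"
  where "conj_pair G g = map_prod (conj_set G g) (conj_set G g)"

definition subgroup_system2 ::
    "'g monoid \<Rightarrow> 'g topology \<Rightarrow> ('g set \<times> 'g set) ric \<Rightarrow> bool"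
  where "subgroup_system2 G T E \<longleftrightarrow>
    (\<forall>(H, U)\<in>Base E. closed_subgroup G T H \<and> closed_subgroup G T U \<and>
       U \<lhd> G\<lparr>carrier := H\<rparr>) \<and>
    ric_domain G (conj_pair G) E \<and>
    (\<forall>(H, U)\<in>Base E. \<forall>(I, V)\<in>Res E (H, U) \<union> Ind E (H, U). I \<subseteq> H \<and> V \<subseteq> U)"

definition Ext :: "('g set \<times> 'g set) ric \<Rightarrow> 'g set \<Rightarrow> 'g set set"
  where "Ext E H = {U. (H, U) \<in> Base E}"

definition flat :: "('g set \<times> 'g set) ric \<Rightarrow> 'g set ric"
  where "flat E =
    \<lparr>Base = fst ` Base E,
     Res = (\<lambda>H. fst ` (\<Union>U\<in>Ext E H. Res E (H, U))),
     Ind = (\<lambda>H. fst ` (\<Union>U\<in>Ext E H. Ind E (H, U)))\<rparr>"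

definition spectrum :: "'g monoid \<Rightarrow> 'g topology \<Rightarrow> ('g set \<times> 'g set) ric \<Rightarrow> bool"
  where "spectrum G T E \<longleftrightarrow>
    subgroup_system2 G T E \<and>
    subgroup_system G (flat E) \<and>
    (\<forall>(H, U)\<in>Base E. \<forall>(I, V)\<in>Res E (H, U). V = U) \<and>
    (\<forall>H\<in>Base (flat E). \<forall>I\<in>Res (flat E) H. finite_index G H I)"

definition Mackey_cover :: "'g monoid \<Rightarrow> ('g set \<times> 'g set) ric \<Rightarrow> 'g set ric \<Rightarrow> bool"
  where "Mackey_cover G E M \<longleftrightarrow>
    Mackey_system G M \<and>
    subsystem (flat E) M \<and>
    (\<forall>H\<in>Base (flat E). Ext E H \<subseteq> Ind M H) \<and>
    (\<forall>(H, U)\<in>Base E. \<forall>(I, V)\<in>Ind E (H, U). V \<in> Ind M U)"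

section \<open>Valuations and Fesenko--Neukirch data\<close>

definition Omega_functor ::
    "'g monoid \<Rightarrow> 'o monoid \<Rightarrow> ('g \<Rightarrow> 'o) \<Rightarrow> ('g set, 'g, 'o) ric_functor"
  where "Omega_functor G \<Omega> d =
    \<lparr>Obj = (\<lambda>H. \<Omega>),
     res_map = (\<lambda>K H x. x [^]\<^bsub>\<Omega>\<^esub> e_index G \<Omega> d H K),
     ind_map = (\<lambda>H K x. x [^]\<^bsub>\<Omega>\<^esub> f_index \<Omega> d H K),
     con_map = (\<lambda>g H x. x)\<rparr>"

definition Val ::
    "'g monoid \<Rightarrow> 'o monoid \<Rightarrow> 'o \<Rightarrow> ('g \<Rightarrow> 'o) \<Rightarrow> 'g set ric \<Rightarrow>
     ('g set, 'g, 'a) ric_functor \<Rightarrow> ('g set \<Rightarrow> 'a \<Rightarrow> 'o) set"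
  where "Val G \<Omega> \<omega> d M C =
    {v. ric_morphism G (conj_set G) M C (Omega_functor G \<Omega> d) v \<and>
        (\<forall>H\<in>Base M. \<omega> \<in> v H ` carrier (Obj C H))}"

definition prime_element ::
    "('g set, 'g, 'a) ric_functor \<Rightarrow> ('g set \<Rightarrow> 'a \<Rightarrow> 'o) \<Rightarrow> 'o \<Rightarrow> 'g set \<Rightarrow> 'a \<Rightarrow> bool"
  where "prime_element C v \<omega> H \<pi> \<longleftrightarrow> \<pi> \<in> carrier (Obj C H) \<and> v H \<pi> = \<omega>"

definition units_val ::
    "'o monoid \<Rightarrow> ('g set, 'g, 'a) ric_functor \<Rightarrow> ('g set \<Rightarrow> 'a \<Rightarrow> 'o) \<Rightarrow> 'g set \<Rightarrow> 'a set"
  where "units_val \<Omega> C v H = kernel (Obj C H) \<Omega> (v H)"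

definition norm_group :: "('g set, 'g, 'a) ric_functor \<Rightarrow> 'g set \<Rightarrow> 'g set \<Rightarrow> 'a set"
  where "norm_group C H U = ind_map C H U ` carrier (Obj C U)"

definition norm_quotient :: "('g set, 'g, 'a) ric_functor \<Rightarrow> 'g set \<Rightarrow> 'g set \<Rightarrow> 'a set monoid"
  where "norm_quotient C H U = Obj C H Mod norm_group C H U"

definition FN_class_axiom_ur ::
    "'g monoid \<Rightarrow> 'o monoid \<Rightarrow> 'o \<Rightarrow> ('g set, 'g, 'a) ric_functor \<Rightarrow> ('g set \<Rightarrow> 'a \<Rightarrow> 'o) \<Rightarrow>
     'g set \<Rightarrow> 'g set \<Rightarrow> bool"
  where "FN_class_axiom_ur G \<Omega> \<omega> C v H U \<longleftrightarrow>
    (let n = index G H U;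
         imH = v H ` carrier (Obj C H);
         N = (\<lambda>x. x [^]\<^bsub>\<Omega>\<^esub> n) ` v U ` carrier (Obj C U);
         Q = \<Omega>\<lparr>carrier := imH\<rparr> Mod N
     in order Q = n \<and> generate Q {N #>\<^bsub>\<Omega>\<^esub> \<omega>} = carrier Q) \<and>
    ind_map C H U ` units_val \<Omega> C v U = units_val \<Omega> C v H \<and>
    finite (carrier (norm_quotient C H U)) \<and>
    order (norm_quotient C H U) \<le> index G H U"

text \<open>Exactness of
  \<open>1 \<rightarrow> ker v\<^sub>U \<rightarrow> ker v\<^sub>V \<rightarrow> ker v\<^sub>V \<rightarrow> ker v\<^sub>U \<rightarrow> 1\<close>
  with the maps \<open>res\<close>, \<open>con\<^sub>\<phi> - 1\<close>, \<open>ind\<close>. The lists of \<^const>\<open>exact_seq\<close>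
  run from the right-hand end of the sequence to the left.\<close>

definition FN_exact ::
    "'o monoid \<Rightarrow> ('g set, 'g, 'a) ric_functor \<Rightarrow> ('g set \<Rightarrow> 'a \<Rightarrow> 'o) \<Rightarrow>
     'g set \<Rightarrow> 'g set \<Rightarrow> 'g \<Rightarrow> bool"
  where "FN_exact \<Omega> C v U V \<phi> \<longleftrightarrow>
    (let kerU = (Obj C U)\<lparr>carrier := units_val \<Omega> C v U\<rparr>;
         kerV = (Obj C V)\<lparr>carrier := units_val \<Omega> C v V\<rparr>;
         triv = (Obj C U)\<lparr>carrier := {\<one>\<^bsub>Obj C U\<^esub>}\<rparr>
     in exact_seq
         ([triv, kerU, kerV, kerV, kerU, triv],
          [\<lambda>x. \<one>\<^bsub>Obj C U\<^esub>,
           ind_map C U V,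
           \<lambda>x. con_map C \<phi> V x \<otimes>\<^bsub>Obj C V\<^esub> inv\<^bsub>Obj C V\<^esub> x,
           res_map C V U,
           \<lambda>x. x]))"

definition FN_datum ::
    "'g monoid \<Rightarrow> 'g topology \<Rightarrow> 'o monoid \<Rightarrow> 'o \<Rightarrow> ('g \<Rightarrow> 'o) \<Rightarrow> ('g set \<times> 'g set) ric \<Rightarrow>
     'g set ric \<Rightarrow> ('g set, 'g, 'a) ric_functor \<Rightarrow> ('g set \<Rightarrow> 'a \<Rightarrow> 'o) \<Rightarrow> bool"
  where "FN_datum G T \<Omega> \<omega> d E M C v \<longleftrightarrow>
    Mackey_cover G E M \<and>
    arithmetic_system G T M \<and>
    inertially_finite_system G T \<Omega> d M \<and>
    cohomological_Mackey_functor G M C \<and>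
    v \<in> Val G \<Omega> \<omega> d M C \<and>
    (\<forall>(H, U)\<in>Base E. U \<in> E_ur G T \<Omega> d H \<longrightarrow> FN_class_axiom_ur G \<Omega> \<omega> C v H U) \<and>
    (\<forall>H\<in>Base (flat E). \<forall>U. open_subgroup_of G T U H \<longrightarrow>
       (\<forall>V\<in>E_ur G T \<Omega> d U. \<forall>\<phi>\<in>frobenius_elt G \<Omega> \<omega> d U V. FN_exact \<Omega> C v U V \<phi>))"

text \<open>The class of \<open>ind\<^sub>H\<^sub>,\<^sub>\<Sigma> (\<pi> h)\<close> raised to the \<open>P'(d\<^sub>H(h))\<close>-th power, where \<open>\<Sigma>\<close> is the
  Frobenius group of \<open>h\<close> and \<open>\<pi>\<close> is a choice of prime elements.\<close>

definition Upsilon ::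
    "nat set \<Rightarrow> 'g monoid \<Rightarrow> 'g topology \<Rightarrow> 'o monoid \<Rightarrow> 'o \<Rightarrow> ('g \<Rightarrow> 'o) \<Rightarrow>
     ('g set, 'g, 'a) ric_functor \<Rightarrow> 'g set \<Rightarrow> 'g set \<Rightarrow> ('g \<Rightarrow> 'a) \<Rightarrow> 'g \<Rightarrow> 'a set"
  where "Upsilon P G T \<Omega> \<omega> d C H U \<pi> h =
    norm_group C H U #>\<^bsub>Obj C H\<^esub>
      (ind_map C H (frobenius_group G T \<Omega> d U h) (\<pi> h)
         [^]\<^bsub>Obj C H\<^esub> P_part_compl P (omega_mult \<Omega> \<omega> (d_norm G \<Omega> d H h)))"

definition prime_choice ::
    "'g monoid \<Rightarrow> 'g topology \<Rightarrow> 'o monoid \<Rightarrow> 'o \<Rightarrow> ('g \<Rightarrow> 'o) \<Rightarrow> ('g set, 'g, 'a) ric_functor \<Rightarrow>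
     ('g set \<Rightarrow> 'a \<Rightarrow> 'o) \<Rightarrow> 'g set \<Rightarrow> 'g set \<Rightarrow> ('g \<Rightarrow> 'a) \<Rightarrow> bool"
  where "prime_choice G T \<Omega> \<omega> d C v H U \<pi> \<longleftrightarrow>
    (\<forall>h\<in>Frob G \<Omega> \<omega> d H. prime_element C v \<omega> (frobenius_group G T \<Omega> d U h) (\<pi> h))"

end

theory Submission
  imports Defs "HOL-Number_Theory.Cong" "HOL-Algebra.Multiplicative_Group"
begin

text \<open>This is Neukirch's argument for the multiplicativity of the reciprocity map. Let \<open>\<phi> \<in> H\<close>
  with \<open>d\<^sub>H(\<phi>) = \<omega>\<close>, let \<open>h\<^sub>3 = h\<^sub>1 h\<^sub>2\<close> with \<open>d\<^sub>H(h\<^sub>i) = n\<^sub>i \<omega>\<close>, and restrict the prime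
  elements \<open>\<pi>\<^sub>i\<close> to \<open>x\<^sub>i \<in> C(W)\<close> for an open normal subgroup \<open>W \<le> U\<close> of \<open>H\<close> with the inertia group
  of \<open>U\<close> that lies in all three Frobenius groups. Let \<open>Z = W I\<^sub>H\<close>. By the Mackey formula the norm of
  \<open>\<pi>\<^sub>i\<close> to \<open>H\<close>, to the power \<open>P'(n\<^sub>i)\<close>, restricts to \<open>ind\<^sub>Z\<^sub>,\<^sub>W (1 + \<phi> + \<dots> + \<phi>\<^bsup>n\<^sub>i-1\<^esup>) x\<^sub>i\<close> on \<open>Z\<close>,
  and restriction from \<open>H\<close> to the unramified \<open>Z\<close> is injective. The quotient of the norms is thus
  \<open>ind\<^sub>Z\<^sub>,\<^sub>W u\<close> for a unit \<open>u\<close> of \<open>C(W)\<close> such that \<open>(\<phi> - 1) u\<close> is a product of elements \<open>(\<tau> - 1) w\<close> with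
  \<open>\<tau> \<in> I\<^sub>H\<close> and units \<open>w\<close>. Lifting this relation along an unramified extension of \<open>W\<close> of degree
  \<open>[H:U]\<close> and using exactness shows that \<open>ind\<^sub>Z\<^sub>,\<^sub>W u\<close> is the restriction of a norm from \<open>U\<close>.\<close>

section \<open>Topological groups\<close>

text \<open>An inertially finite cover need not contain the kernel of \<open>d\<close>, so maximal
  unramified extensions are out of reach: \<open>Z j\<close> and \<open>W j\<close> are finite
  layers, and \<open>j\<close> only has to be divisible enough for the relation at hand. The power
  \<open>P'(n)\<close> appears because \<open>\<Omega>\<close> sees only the \<open>P\<close>-part
  of \<open>n\<close>: the Mackey formula yields a trace of length \<open>P(n)\<close>, whose
  argument is fixed by the \<open>P(n)\<close>-th power of \<open>\<phi>\<close>, and raising it to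
  \<open>P'(n)\<close> stretches it to length \<open>n\<close>. Only these full lengths add up under
  multiplication of Frobenius elements, which makes \<open>u\<close> a unit. The elements
  \<open>(\<tau> - 1) w\<close> are harmless because inertia lies in \<open>Z\<close> and acts
  trivially on \<open>C(Z)\<close>. After a correction by Hilbert 90 there remains an element of
  \<open>C(H)\<close> restricted to an unramified layer and normed down again. That is a power whose
  exponent is the degree of the layer; for degree \<open>[H:U]\<close> the same power arises by
  restriction to \<open>U\<close> and induction back, so it is a norm from \<open>U\<close>.\<close>

lemma (in group) mult_inv_cancel [simp]:
  assumes "x \<in> carrier G" "y \<in> carrier G"
  shows "x \<otimes> (inv x \<otimes> y) = y" "inv x \<otimes> (x \<otimes> y) = y"
  using assms by (simp_all add: m_assoc[symmetric])

locale top_group = group G for G :: "'a monoid" (structure) +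
  fixes T :: "'a topology"
  assumes topspace_T: "topspace T = carrier G"
    and continuous_mult: "continuous_map (prod_topology T T) T (\<lambda>(x, y). x \<otimes> y)"
    and continuous_inv: "continuous_map T T (\<lambda>x. inv x)"

lemma topological_group_iff: "topological_group G T \<longleftrightarrow> top_group G T"
  by (auto simp: topological_group_def top_group_def top_group_axioms_def)

context top_group
begin

lemma continuous_map_mult:
  assumes "continuous_map X T f" "continuous_map X T g"
  shows "continuous_map X T (\<lambda>x. f x \<otimes> g x)"
  using continuous_map_compose[OF continuous_map_pairedI[OF assms] continuous_mult]
  by (simp add: o_def)

lemma continuous_map_pow:
  assumes "continuous_map X T f"
  shows "continuous_map X T (\<lambda>x. f x [^] (n::nat))"
proof (induction n)
  case 0
  then show ?case using topspace_T by simp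
next
  case (Suc n)
  then show ?case using continuous_map_mult[OF Suc assms] by simp
qed

lemma continuous_translate:
  assumes "a \<in> carrier G" shows "continuous_map T T (\<lambda>x. a \<otimes> x)"
  using assms topspace_T by (intro continuous_map_mult) auto

lemma openin_translate_preimage:
  assumes "a \<in> carrier G" "openin T V"
  shows "openin T {x \<in> carrier G. a \<otimes> x \<in> V}"
  using openin_continuous_map_preimage[OF continuous_translate[OF assms(1)] assms(2)] topspace_T
  by simp

lemma closedin_translate_preimage:
  assumes "a \<in> carrier G" "closedin T V"
  shows "closedin T {x \<in> carrier G. a \<otimes> x \<in> V}"
  using closedin_continuous_map_preimage[OF continuous_translate[OF assms(1)] assms(2)] topspace_T
  by simp

text \<open>With each of its elements \<open>x\<close> the subgroup contains the open translate of
  \<open>V\<close> by \<open>x\<close>.\<close>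

lemma openin_subgroup_superset:
  assumes K: "subgroup K G" and V: "openin T V" "\<one> \<in> V" "V \<subseteq> K"
  shows "openin T K"
proof (subst openin_subopen, intro ballI)
  fix x assume x: "x \<in> K"
  then have xG: "x \<in> carrier G" using K subgroup.mem_carrier by fast
  let ?A = "{y \<in> carrier G. inv x \<otimes> y \<in> V}"
  have "?A \<subseteq> K"
  proof
    fix y assume "y \<in> ?A"
    then have y: "y \<in> carrier G" "inv x \<otimes> y \<in> K" using V by auto
    then have "x \<otimes> (inv x \<otimes> y) \<in> K" using K x by (simp add: subgroup.m_closed)
    then show "y \<in> K" using y xG by (simp add: m_assoc[symmetric])
  qed
  moreover have "x \<in> ?A" using xG V by simp
  ultimately show "\<exists>A. openin T A \<and> x \<in> A \<and> A \<subseteq> K"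
    using openin_translate_preimage[of "inv x" V] xG V(1) by blast
qed

lemma top_group_subgroup:
  assumes "subgroup H G"
  shows "top_group (G\<lparr>carrier := H\<rparr>) (subtopology T H)"
proof -
  have HG: "H \<subseteq> carrier G" using assms subgroup.subset by blast
  interpret H: group "G\<lparr>carrier := H\<rparr>" using assms subgroup_imp_group by blast
  have "continuous_map (prod_topology (subtopology T H) (subtopology T H)) (subtopology T H)
        (\<lambda>(x, y). x \<otimes> y)"
    unfolding subtopology_Times[symmetric] continuous_map_in_subtopology
    using assms by (auto intro!: continuous_map_from_subtopology continuous_mult
        simp: topspace_T subgroup.m_closed)
  moreover have "continuous_map (subtopology T H) (subtopology T H) (\<lambda>x. inv\<^bsub>G\<lparr>carrier := H\<rparr>\<^esub> x)"
    unfolding continuous_map_in_subtopology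
  proof
    show "continuous_map (subtopology T H) T (\<lambda>x. inv\<^bsub>G\<lparr>carrier := H\<rparr>\<^esub> x)"
      by (rule continuous_map_eq[OF continuous_map_from_subtopology[OF continuous_inv]])
        (use assms in \<open>auto simp: m_inv_consistent\<close>)
  qed (use assms in \<open>auto simp: m_inv_consistent subgroup.m_inv_closed\<close>)
  ultimately show ?thesis
    using HG by unfold_locales (auto simp: topspace_T)
qed

lemma openin_subgroup_of_superset:
  assumes "subgroup H G" and "subgroup K G" "K \<subseteq> H"
    and "openin (subtopology T H) V" "\<one> \<in> V" "V \<subseteq> K"
  shows "openin (subtopology T H) K"
proof -
  interpret H: top_group "G\<lparr>carrier := H\<rparr>" "subtopology T H"
    using assms(1) by (rule top_group_subgroup)
  show ?thesis
    using assms by (intro H.openin_subgroup_superset[of K V]) (auto intro: subgroup_incl)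
qed

text \<open>The closure of a product set is the product of the closures, so continuity of
  multiplication and inversion carries the group laws over.\<close>

lemma subgroup_closure_of:
  assumes "subgroup K G" shows "subgroup (T closure_of K) G"
proof
  show "T closure_of K \<subseteq> carrier G"
    using closure_of_subset_topspace topspace_T by metis
  show "\<one> \<in> T closure_of K"
    using assms closure_of_subset[of K T] subgroup.one_closed[OF assms] subgroup.subset[OF assms] topspace_T
    by auto
next
  fix x y assume "x \<in> T closure_of K" "y \<in> T closure_of K"
  then have "(x, y) \<in> prod_topology T T closure_of (K \<times> K)"
    by (simp add: closure_of_Times)
  then have "x \<otimes> y \<in> T closure_of ((\<lambda>(x, y). x \<otimes> y) ` (K \<times> K))"
    using continuous_map_image_closure_subset[OF continuous_mult, of "K \<times> K"] by force
  moreover have "(\<lambda>(x, y). x \<otimes> y) ` (K \<times> K) \<subseteq> K"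
    using assms by (auto simp: subgroup.m_closed)
  ultimately show "x \<otimes> y \<in> T closure_of K" using closure_of_mono by blast
next
  fix x assume "x \<in> T closure_of K"
  then have "inv x \<in> T closure_of ((\<lambda>x. inv x) ` K)"
    using continuous_map_image_closure_subset[OF continuous_inv, of K] by blast
  moreover have "(\<lambda>x. inv x) ` K \<subseteq> K"
    using assms by (auto simp: subgroup.m_inv_closed)
  ultimately show "inv x \<in> T closure_of K" using closure_of_mono by blast
qed

lemma subgroup_closed_generated:
  assumes "h \<in> carrier G" shows "subgroup (closed_generated G T h) G"
  unfolding closed_generated_def
  using assms by (intro subgroup_closure_of generate_is_subgroup) auto

lemma closedin_closed_generated: "closedin T (closed_generated G T h)"
  unfolding closed_generated_def by simp

lemma mem_closed_generated:
  assumes "h \<in> carrier G" shows "h \<in> closed_generated G T h"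
proof -
  have "generate G {h} \<subseteq> topspace T"
    using assms generate_incl[of "{h}"] by (simp add: topspace_T)
  then show ?thesis
    unfolding closed_generated_def using closure_of_subset[of "generate G {h}" T]
    by (meson generate.incl insertI1 subsetD)
qed

lemma closed_generated_minimal:
  assumes "subgroup K G" "closedin T K" "h \<in> K"
  shows "closed_generated G T h \<subseteq> K"
  unfolding closed_generated_def
  using assms by (intro closure_of_minimal generate_subgroup_incl) auto

text \<open>The normal subgroup consists of the \<open>x\<close> that leave the clopen set \<open>K\<close> invariant
  whenever they are inserted into a product; it is open because projections along the compact
  space \<open>G \<times> G\<close> are closed.\<close>

lemma normal_subgroup_in_clopen:
  assumes comp: "compact_space T" and K: "closedin T K" "openin T K" "\<one> \<in> K"
  shows "\<exists>N. N \<lhd> G \<and> openin T N \<and> N \<subseteq> K"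
proof -
  define N where "N = {x \<in> carrier G. \<forall>g\<in>carrier G. \<forall>h\<in>carrier G. g \<otimes> x \<otimes> h \<in> K \<longleftrightarrow> g \<otimes> h \<in> K}"
  have "N \<subseteq> K"
  proof
    fix x assume "x \<in> N"
    then have "x \<in> carrier G" "\<one> \<otimes> x \<otimes> \<one> \<in> K \<longleftrightarrow> \<one> \<otimes> \<one> \<in> K"
      unfolding N_def by blast+
    then show "x \<in> K" using K by simp
  qed
  moreover have sub: "subgroup N G"
  proof
    show "N \<subseteq> carrier G" "\<one> \<in> N" by (auto simp: N_def)
    fix x assume x: "x \<in> N"
    {
      fix y assume y: "y \<in> N"
      have "g \<otimes> (x \<otimes> y) \<otimes> h \<in> K \<longleftrightarrow> g \<otimes> h \<in> K" if "g \<in> carrier G" "h \<in> carrier G" for g h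
      proof -
        have "g \<otimes> (x \<otimes> y) \<otimes> h = g \<otimes> x \<otimes> (y \<otimes> h)"
          using that x y by (simp add: N_def m_assoc)
        also have "\<dots> \<in> K \<longleftrightarrow> g \<otimes> (y \<otimes> h) \<in> K"
          using that x y unfolding N_def by blast
        also have "g \<otimes> (y \<otimes> h) = g \<otimes> y \<otimes> h" using that y by (simp add: N_def m_assoc)
        also have "\<dots> \<in> K \<longleftrightarrow> g \<otimes> h \<in> K" using that y unfolding N_def by blast
        finally show ?thesis .
      qed
      then show "x \<otimes> y \<in> N" using x y unfolding N_def by blast
    }
    have "g \<otimes> inv x \<otimes> h \<in> K \<longleftrightarrow> g \<otimes> h \<in> K" if "g \<in> carrier G" "h \<in> carrier G" for g h
    proof -
      have xG: "x \<in> carrier G" using x by (simp add: N_def)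
      then have "(g \<otimes> inv x) \<otimes> x \<otimes> h \<in> K \<longleftrightarrow> (g \<otimes> inv x) \<otimes> h \<in> K"
        using that x unfolding N_def by blast
      moreover have "(g \<otimes> inv x) \<otimes> x \<otimes> h = g \<otimes> h"
        using that xG by (simp add: m_assoc)
      ultimately show ?thesis by simp
    qed
    then show "inv x \<in> N" using x unfolding N_def by simp
  qed
  moreover have "N \<lhd> G"
  proof (rule normal_invI[OF sub])
    fix a x assume a: "a \<in> carrier G" and x: "x \<in> N"
    have xG: "x \<in> carrier G" using x by (simp add: N_def)
    have "g \<otimes> (a \<otimes> x \<otimes> inv a) \<otimes> h \<in> K \<longleftrightarrow> g \<otimes> h \<in> K" if "g \<in> carrier G" "h \<in> carrier G" for g h
    proof -
      have "(g \<otimes> a) \<otimes> x \<otimes> (inv a \<otimes> h) \<in> K \<longleftrightarrow> (g \<otimes> a) \<otimes> (inv a \<otimes> h) \<in> K"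
        using that x a unfolding N_def by blast
      moreover have "(g \<otimes> a) \<otimes> x \<otimes> (inv a \<otimes> h) = g \<otimes> (a \<otimes> x \<otimes> inv a) \<otimes> h"
        using that xG a by (simp add: m_assoc)
      moreover have "(g \<otimes> a) \<otimes> (inv a \<otimes> h) = g \<otimes> h"
        using that a by (simp add: m_assoc)
      ultimately show ?thesis by simp
    qed
    then show "a \<otimes> x \<otimes> inv a \<in> N" using a xG unfolding N_def by simp
  qed
  moreover have "openin T N"
  proof -
    let ?Y = "prod_topology T T"
    let ?X = "prod_topology T ?Y"
    \<comment> \<open>A triple \<open>(x, g, h)\<close> lies in exactly one of \<open>A\<close> and
      \<open>B\<close> when inserting \<open>x\<close> changes membership in \<open>K\<close>. Both
      sets are clopen, so these bad triples project to a closed set, the complement of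
      \<open>N\<close>.\<close>
    define A where "A = {z \<in> topspace ?X. fst (snd z) \<otimes> fst z \<otimes> snd (snd z) \<in> K}"
    define B where "B = {z \<in> topspace ?X. fst (snd z) \<otimes> snd (snd z) \<in> K}"
    have c1: "continuous_map ?X T fst" and c2: "continuous_map ?X T (\<lambda>z. fst (snd z))"
      and c3: "continuous_map ?X T (\<lambda>z. snd (snd z))"
      using continuous_map_compose[OF continuous_map_snd continuous_map_fst, of T T T, unfolded o_def]
        continuous_map_compose[OF continuous_map_snd continuous_map_snd, of T T T, unfolded o_def]
      by (auto intro: continuous_map_fst)
    have cA: "continuous_map ?X T (\<lambda>z. fst (snd z) \<otimes> fst z \<otimes> snd (snd z))"
      by (intro continuous_map_mult c1 c2 c3)
    have cB: "continuous_map ?X T (\<lambda>z. fst (snd z) \<otimes> snd (snd z))"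
      by (intro continuous_map_mult c2 c3)
    have "openin ?X A" "closedin ?X A" "openin ?X B" "closedin ?X B"
      unfolding A_def B_def
      using K cA cB openin_continuous_map_preimage closedin_continuous_map_preimage by blast+
    then have "closedin ?X ((A - B) \<union> (B - A))"
      by (intro closedin_Un closedin_diff)
    moreover have "closed_map ?X T fst"
      by (rule closed_map_fst) (simp add: comp compact_space_prod_topology)
    ultimately have cl: "closedin T (fst ` ((A - B) \<union> (B - A)))"
      unfolding closed_map_def by blast
    have "N = carrier G - fst ` ((A - B) \<union> (B - A))"
    proof (intro equalityI subsetI)
      fix x assume "x \<in> N"
      then show "x \<in> carrier G - fst ` ((A - B) \<union> (B - A))"
        by (auto simp: N_def A_def B_def topspace_T)
    next
      fix x assume x: "x \<in> carrier G - fst ` ((A - B) \<union> (B - A))"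
      have "g \<otimes> x \<otimes> h \<in> K \<longleftrightarrow> g \<otimes> h \<in> K" if "g \<in> carrier G" "h \<in> carrier G" for g h
      proof -
        have "(x, g, h) \<notin> (A - B) \<union> (B - A)" using x by force
        then show ?thesis using x that by (auto simp: A_def B_def topspace_T)
      qed
      then show "x \<in> N" using x by (auto simp: N_def)
    qed
    then show ?thesis using cl topspace_T closedin_def by metis
  qed
  ultimately show ?thesis by blast
qed

end

text \<open>In a compact Hausdorff space a connected component, here the point
  \<open>\<one>\<close>, is separated from a disjoint closed set by a clopen set; the latter
  contains an open normal subgroup.\<close>

lemma profinite_normal_basis:
  assumes prof: "profinite_group G T" and V: "openin T V" "\<one>\<^bsub>G\<^esub> \<in> V"
  shows "\<exists>N. N \<lhd> G \<and> openin T N \<and> N \<subseteq> V"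
proof -
  interpret top_group G T
    using prof by (simp add: profinite_group_def topological_group_iff)
  have comp: "compact_space T" and haus: "Hausdorff_space T"
    and conn: "connected_component_of_set T \<one>\<^bsub>G\<^esub> = {\<one>\<^bsub>G\<^esub>}"
    using prof topspace_T by (auto simp: profinite_group_def)
  have "separated_between T {\<one>\<^bsub>G\<^esub>} (topspace T - V)"
  proof (rule separated_between_compact_connected_component)
    show "locally_compact_space T" using comp compact_imp_locally_compact_space by blast
    show "{\<one>\<^bsub>G\<^esub>} \<in> connected_components_of T"
      unfolding connected_components_of_def using conn topspace_T by (metis image_eqI one_closed)
    show "compactin T {\<one>\<^bsub>G\<^esub>}" using topspace_T by simp
    show "closedin T (topspace T - V)" using V by blast
    show "disjnt {\<one>\<^bsub>G\<^esub>} (topspace T - V)" using V by simp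
  qed (rule haus)
  then obtain K where "closedin T K" "openin T K" "{\<one>\<^bsub>G\<^esub>} \<subseteq> K" "topspace T - V \<subseteq> topspace T - K"
    unfolding separated_between by blast
  moreover from this have "K \<subseteq> V" using openin_subset by fast
  ultimately show ?thesis
    using normal_subgroup_in_clopen[OF comp, of K] by blast
qed

section \<open>The group of \<open>P\<close>-adic integers\<close>

lemma Zp_mem_iff:
  "x \<in> carrier (Zp_group p) \<longleftrightarrow>
    (\<forall>n. 0 \<le> x n \<and> x n < int p ^ n \<and> x (Suc n) mod int p ^ n = x n)"
  by (simp add: Zp_group_def)

lemma Zp_mult: "(x \<otimes>\<^bsub>Zp_group p\<^esub> y) n = (x n + y n) mod int p ^ n"
  by (simp add: Zp_group_def)

lemma Zp_one: "\<one>\<^bsub>Zp_group p\<^esub> = (\<lambda>_. 0)"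
  by (simp add: Zp_group_def)

lemma Zp_memI:
  assumes "p > 0" "\<And>n. f (Suc n) mod int p ^ n = f n mod int p ^ n"
  shows "(\<lambda>n. f n mod int p ^ n) \<in> carrier (Zp_group p)"
  unfolding Zp_mem_iff using assms by (auto simp: mod_mod_cancel)

lemma Zp_mod: "x \<in> carrier (Zp_group p) \<Longrightarrow> x n mod int p ^ n = x n"
  by (simp add: Zp_mem_iff)

lemma Zp_group_is_group:
  assumes "p > 0" shows "group (Zp_group p)"
proof (rule groupI)
  fix x y assume x: "x \<in> carrier (Zp_group p)" and y: "y \<in> carrier (Zp_group p)"
  have "(x (Suc n) + y (Suc n)) mod int p ^ n = (x n + y n) mod int p ^ n" for n
    using x y by (metis Zp_mem_iff mod_add_eq)
  then have "(\<lambda>n. (x n + y n) mod int p ^ n) \<in> carrier (Zp_group p)"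
    by (intro Zp_memI assms)
  then show "x \<otimes>\<^bsub>Zp_group p\<^esub> y \<in> carrier (Zp_group p)"
    by (simp add: Zp_group_def)
next
  show "\<one>\<^bsub>Zp_group p\<^esub> \<in> carrier (Zp_group p)"
    using assms by (simp add: Zp_one Zp_mem_iff)
next
  fix x y z
  show "x \<otimes>\<^bsub>Zp_group p\<^esub> y \<otimes>\<^bsub>Zp_group p\<^esub> z = x \<otimes>\<^bsub>Zp_group p\<^esub> (y \<otimes>\<^bsub>Zp_group p\<^esub> z)"
    by (rule ext) (simp add: Zp_mult mod_simps add.assoc)
next
  fix x assume x: "x \<in> carrier (Zp_group p)"
  then show "\<one>\<^bsub>Zp_group p\<^esub> \<otimes>\<^bsub>Zp_group p\<^esub> x = x"
    by (intro ext) (simp add: Zp_mult Zp_one Zp_mod)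
  let ?y = "\<lambda>n. (- x n) mod int p ^ n"
  have "(- x (Suc n)) mod int p ^ n = (- x n) mod int p ^ n" for n
    using x by (metis Zp_mem_iff mod_minus_eq)
  then have "?y \<in> carrier (Zp_group p)" by (intro Zp_memI assms)
  moreover have "?y \<otimes>\<^bsub>Zp_group p\<^esub> x = \<one>\<^bsub>Zp_group p\<^esub>"
    by (rule ext) (simp add: Zp_mult Zp_one mod_simps)
  ultimately show "\<exists>y\<in>carrier (Zp_group p). y \<otimes>\<^bsub>Zp_group p\<^esub> x = \<one>\<^bsub>Zp_group p\<^esub>" by blast
qed

lemma Zp_pow: "(x [^]\<^bsub>Zp_group p\<^esub> (n::nat)) k = (int n * x k) mod int p ^ k"
  by (induction n) (simp_all add: Zp_one Zp_mult mod_simps algebra_simps)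

lemma Zp_torsion_free:
  assumes p: "prime p" and q: "prime (q::nat)" and x: "x \<in> carrier (Zp_group p)"
    and 1: "x [^]\<^bsub>Zp_group p\<^esub> q = \<one>\<^bsub>Zp_group p\<^esub>"
  shows "x = \<one>\<^bsub>Zp_group p\<^esub>"
proof
  fix k
  have d: "int p ^ n dvd int q * x n" for n
    using fun_cong[OF 1, of n] by (simp add: Zp_pow Zp_one mod_eq_0_iff_dvd)
  have "int p ^ k dvd x k"
  proof (cases "p = q")
    case True
    \<comment> \<open>Cancelling \<open>p\<close> costs one power of \<open>p\<close>, so the
      argument starts from the coordinate above \<open>k\<close>.\<close>
    have "int p * int p ^ k dvd int p * x (Suc k)" using d[of "Suc k"] True by simp
    then have "int p ^ k dvd x (Suc k)" using p by (simp add: prime_gt_0_nat)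
    then have "x (Suc k) mod int p ^ k = 0" by simp
    then have "x k = 0" using x by (simp add: Zp_mem_iff)
    then show ?thesis by simp
  next
    case False
    then have "coprime (int p ^ k) (int q)"
      using p q by (simp add: primes_coprime)
    then show ?thesis using d[of k] coprime_dvd_mult_right_iff by blast
  qed
  then show "x k = \<one>\<^bsub>Zp_group p\<^esub> k"
    using Zp_mod[OF x, of k] by (simp add: Zp_one)
qed

lemma Zp_divisible:
  assumes p: "prime p" and q: "prime (q::nat)" "q \<noteq> p" and x: "x \<in> carrier (Zp_group p)"
  shows "\<exists>y\<in>carrier (Zp_group p). y [^]\<^bsub>Zp_group p\<^esub> q = x"
proof -
  have cop: "coprime (int q) (int p ^ k)" for k
    using p q by (simp add: primes_coprime)
  then have "\<exists>c. (int q * c) mod int p ^ k = 1 mod int p ^ k" for k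
    using cong_solve_coprime_int[of "int q" "int p ^ k"] by (auto simp: cong_def)
  then obtain c where c: "\<And>k. (int q * c k) mod int p ^ k = 1 mod int p ^ k" by metis
  define y where "y k = c k * x k" for k
  have qy: "(int q * y k) mod int p ^ k = x k" for k
  proof -
    have "(int q * y k) mod int p ^ k = ((int q * c k) mod int p ^ k * x k) mod int p ^ k"
      by (simp add: y_def mod_simps mult.assoc)
    also have "\<dots> = x k" by (simp add: c mod_simps Zp_mod[OF x])
    finally show ?thesis .
  qed
  \<comment> \<open>The inverses \<open>c k\<close> of \<open>q\<close> were chosen separately at
    each level; the products become compatible because \<open>q\<close> can be cancelled modulo
    powers of \<open>p\<close>.\<close>
  have "y (Suc k) mod int p ^ k = y k mod int p ^ k" for k
  proof -
    have "(int q * y (Suc k)) mod int p ^ k = (int q * y (Suc k)) mod int p ^ Suc k mod int p ^ k"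
      by (simp add: mod_mod_cancel)
    also have "\<dots> = x (Suc k) mod int p ^ k" by (simp only: qy)
    also have "\<dots> = (int q * y k) mod int p ^ k" using x qy by (simp add: Zp_mem_iff)
    finally have "[int q * y (Suc k) = int q * y k] (mod int p ^ k)" by (simp add: cong_def)
    then have "[y (Suc k) = y k] (mod int p ^ k)" using cong_mult_lcancel[OF cop] by blast
    then show ?thesis by (simp add: cong_def)
  qed
  then have "(\<lambda>k. y k mod int p ^ k) \<in> carrier (Zp_group p)"
    using p by (intro Zp_memI) (auto simp: prime_gt_0_nat)
  moreover have "(\<lambda>k. y k mod int p ^ k) [^]\<^bsub>Zp_group p\<^esub> q = x"
    by (rule ext) (simp add: Zp_pow mod_simps qy)
  ultimately show ?thesis by blast
qed

lemma Zp_not_divisible: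
  assumes p: "prime p"
  shows "\<exists>x\<in>carrier (Zp_group p). \<forall>y\<in>carrier (Zp_group p). y [^]\<^bsub>Zp_group p\<^esub> p \<noteq> x"
proof
  \<comment> \<open>This is the unit 1 of the \<open>p\<close>-adic integers; the reduction makes
    its coordinate at 0 equal to 0. At coordinate 1 every \<open>p\<close>-th power
    vanishes.\<close>
  let ?x = "\<lambda>k. 1 mod int p ^ k"
  show "?x \<in> carrier (Zp_group p)"
    using p by (intro Zp_memI) (auto simp: prime_gt_0_nat)
  show "\<forall>y\<in>carrier (Zp_group p). y [^]\<^bsub>Zp_group p\<^esub> p \<noteq> ?x"
  proof
    fix y
    have "(y [^]\<^bsub>Zp_group p\<^esub> p) 1 \<noteq> ?x 1"
      using p prime_gt_1_nat[of p] by (simp add: Zp_pow)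
    then show "y [^]\<^bsub>Zp_group p\<^esub> p \<noteq> ?x" by metis
  qed
qed

lemma ZP_pow: "x [^]\<^bsub>ZP_group P\<^esub> (n::nat) = (\<lambda>p\<in>P. x p [^]\<^bsub>Zp_group p\<^esub> n)"
  by (induction n) (simp_all add: ZP_group_def cong: restrict_cong)

lemma ZP_group_is_group: "\<forall>p\<in>P. prime p \<Longrightarrow> group (ZP_group P)"
  unfolding ZP_group_def by (simp add: Zp_group_is_group prime_gt_0_nat)

lemma ZP_torsion_free:
  assumes "\<forall>p\<in>P. prime p" and q: "prime (q::nat)" and x: "x \<in> carrier (ZP_group P)"
    and 1: "x [^]\<^bsub>ZP_group P\<^esub> q = \<one>\<^bsub>ZP_group P\<^esub>"
  shows "x = \<one>\<^bsub>ZP_group P\<^esub>"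
proof -
  have "x p = \<one>\<^bsub>Zp_group p\<^esub>" if p: "p \<in> P" for p
  proof (rule Zp_torsion_free[OF _ q])
    show "prime p" using assms(1) p by blast
    show "x p \<in> carrier (Zp_group p)" using x p by (auto simp: ZP_group_def)
    show "x p [^]\<^bsub>Zp_group p\<^esub> q = \<one>\<^bsub>Zp_group p\<^esub>"
      using fun_cong[OF 1, of p] p by (simp add: ZP_pow) (simp add: ZP_group_def)
  qed
  then show ?thesis
    using x by (auto simp: ZP_group_def PiE_def extensional_def fun_eq_iff restrict_def)
qed

lemma ZP_divisible:
  assumes "\<forall>p\<in>P. prime p" and q: "prime (q::nat)" "q \<notin> P" and x: "x \<in> carrier (ZP_group P)"
  shows "\<exists>y\<in>carrier (ZP_group P). y [^]\<^bsub>ZP_group P\<^esub> q = x"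
proof -
  have "\<exists>y\<in>carrier (Zp_group p). y [^]\<^bsub>Zp_group p\<^esub> q = x p" if p: "p \<in> P" for p
    using assms p x by (intro Zp_divisible) (auto simp: ZP_group_def)
  then obtain y where y: "\<And>p. p \<in> P \<Longrightarrow> y p \<in> carrier (Zp_group p) \<and> y p [^]\<^bsub>Zp_group p\<^esub> q = x p"
    by metis
  have yc: "(\<lambda>p\<in>P. y p) \<in> carrier (ZP_group P)" using y by (auto simp: ZP_group_def)
  moreover have "(\<lambda>p\<in>P. y p) [^]\<^bsub>ZP_group P\<^esub> q = x"
    unfolding ZP_pow using y x
    by (auto simp: ZP_group_def PiE_def extensional_def fun_eq_iff restrict_def)
  ultimately show ?thesis by blast
qed

lemma ZP_not_divisible:
  assumes "\<forall>p\<in>P. prime p" and p: "p \<in> P"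
  shows "\<exists>x\<in>carrier (ZP_group P). \<forall>y\<in>carrier (ZP_group P). y [^]\<^bsub>ZP_group P\<^esub> p \<noteq> x"
proof -
  obtain x where x: "x \<in> carrier (Zp_group p)"
      "\<And>y. y \<in> carrier (Zp_group p) \<Longrightarrow> y [^]\<^bsub>Zp_group p\<^esub> p \<noteq> x"
    using Zp_not_divisible assms by blast
  let ?x = "\<lambda>r\<in>P. if r = p then x else \<one>\<^bsub>Zp_group r\<^esub>"
  have one: "\<one>\<^bsub>Zp_group r\<^esub> \<in> carrier (Zp_group r)" if "r \<in> P" for r
    using Zp_group_is_group[of r] assms(1) that group.is_monoid monoid.one_closed prime_gt_0_nat
    by metis
  have "?x \<in> carrier (ZP_group P)" using x one by (auto simp: ZP_group_def)
  moreover have "y [^]\<^bsub>ZP_group P\<^esub> p \<noteq> ?x" if y: "y \<in> carrier (ZP_group P)" for y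
  proof
    assume "y [^]\<^bsub>ZP_group P\<^esub> p = ?x"
    then have "(y [^]\<^bsub>ZP_group P\<^esub> p) p = ?x p" by simp
    then have "y p [^]\<^bsub>Zp_group p\<^esub> p = x" using p by (simp add: ZP_pow)
    moreover have "y p \<in> carrier (Zp_group p)" using y p by (auto simp: ZP_group_def)
    ultimately show False using x by blast
  qed
  ultimately show ?thesis by blast
qed

lemma Hausdorff_ZP_topology: "Hausdorff_space (ZP_topology P)"
  unfolding ZP_topology_def Zp_topology_def
  by (auto simp: Hausdorff_space_product_topology intro!: Hausdorff_space_subtopology)

text \<open>The traits of the \<open>P\<close>-adic integers that the proof works with: no torsion,
  and divisibility by a prime exactly when it lies outside \<open>P\<close>. With them the rest can
  be argued inside \<open>\<Omega>\<close>, without coordinates.\<close>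

locale procyclic = top_group \<Omega> T\<Omega> for \<Omega> :: "'o monoid" (structure) and T\<Omega> +
  fixes \<omega> :: 'o and P :: "nat set"
  assumes commutative: "\<lbrakk>x \<in> carrier \<Omega>; y \<in> carrier \<Omega>\<rbrakk> \<Longrightarrow> x \<otimes> y = y \<otimes> x"
    and compact: "compact_space T\<Omega>" and Hausdorff: "Hausdorff_space T\<Omega>"
    and omega_closed [simp]: "\<omega> \<in> carrier \<Omega>"
    and generator: "closed_generated \<Omega> T\<Omega> \<omega> = carrier \<Omega>"
    and prime_torsion_free:
      "\<lbrakk>prime (q::nat); x \<in> carrier \<Omega>; x [^] q = \<one>\<rbrakk> \<Longrightarrow> x = \<one>"
    and divisible: "\<lbrakk>prime (q::nat); q \<notin> P; x \<in> carrier \<Omega>\<rbrakk> \<Longrightarrow> \<exists>y\<in>carrier \<Omega>. y [^] q = x"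
    and not_divisible: "p \<in> P \<Longrightarrow> \<exists>x\<in>carrier \<Omega>. \<forall>y\<in>carrier \<Omega>. y [^] p \<noteq> x"

lemma ZP_procyclic:
  fixes \<Omega> :: "'o monoid"
  assumes P: "\<forall>p\<in>P. prime p" and top: "topological_group \<Omega> T\<Omega>"
    and iso: "top_group_iso \<Omega> T\<Omega> (ZP_group P) (ZP_topology P) f"
    and comp: "compact_space T\<Omega>"
    and "\<omega> \<in> carrier \<Omega>" "closed_generated \<Omega> T\<Omega> \<omega> = carrier \<Omega>"
  shows "procyclic \<Omega> T\<Omega> \<omega> P"
proof -
  interpret top_group \<Omega> T\<Omega> using top by (simp add: topological_group_iff)
  interpret Z: group "ZP_group P" using P by (rule ZP_group_is_group)
  have f: "f \<in> iso \<Omega> (ZP_group P)" and homeo: "homeomorphic_map T\<Omega> (ZP_topology P) f"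
    using iso by (auto simp: top_group_iso_def)
  interpret group_hom \<Omega> "ZP_group P" f
    using f by unfold_locales (auto simp: iso_def)
  have inj: "inj_on f (carrier \<Omega>)" and surj: "f ` carrier \<Omega> = carrier (ZP_group P)"
    using f by (auto simp: iso_def bij_betw_def)
  show ?thesis
  proof
    fix x y assume xy: "x \<in> carrier \<Omega>" "y \<in> carrier \<Omega>"
    have "f (x \<otimes>\<^bsub>\<Omega>\<^esub> y) = f (y \<otimes>\<^bsub>\<Omega>\<^esub> x)"
      using xy by (simp add: ZP_group_def restrict_def fun_eq_iff Zp_group_def add.commute)
    then show "x \<otimes>\<^bsub>\<Omega>\<^esub> y = y \<otimes>\<^bsub>\<Omega>\<^esub> x" using inj xy by (meson inj_onD m_closed)
  next
    show "Hausdorff_space T\<Omega>"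
      using Hausdorff_ZP_topology homeomorphic_Hausdorff_space[OF homeomorphic_map_imp_homeomorphic_space[OF homeo]]
      by simp
  next
    fix q :: nat and x assume q: "prime q" and x: "x \<in> carrier \<Omega>" "x [^]\<^bsub>\<Omega>\<^esub> q = \<one>\<^bsub>\<Omega>\<^esub>"
    have "f x [^]\<^bsub>ZP_group P\<^esub> q = \<one>\<^bsub>ZP_group P\<^esub>" using x hom_nat_pow[of x q] by simp
    then have "f x = \<one>\<^bsub>ZP_group P\<^esub>" by (rule ZP_torsion_free[OF P q hom_closed[OF x(1)]])
    then show "x = \<one>\<^bsub>\<Omega>\<^esub>" using inj_onD[OF inj, of x "\<one>\<^bsub>\<Omega>\<^esub>"] x by simp
  next
    fix q :: nat and x assume q: "prime q" "q \<notin> P" and x: "x \<in> carrier \<Omega>"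
    obtain z where "z \<in> carrier (ZP_group P)" and z: "z [^]\<^bsub>ZP_group P\<^esub> q = f x"
      using ZP_divisible[OF P q hom_closed[OF x]] by blast
    then obtain y where y: "y \<in> carrier \<Omega>" "z = f y" using surj by blast
    then have "f (y [^]\<^bsub>\<Omega>\<^esub> q) = f x" using z hom_nat_pow[of y q] by simp
    then show "\<exists>y\<in>carrier \<Omega>. y [^]\<^bsub>\<Omega>\<^esub> q = x" using inj x y by (meson inj_onD nat_pow_closed)
  next
    fix p assume "p \<in> P"
    then obtain z where z: "z \<in> carrier (ZP_group P)"
        "\<forall>y\<in>carrier (ZP_group P). y [^]\<^bsub>ZP_group P\<^esub> p \<noteq> z"
      using ZP_not_divisible[OF P] by blast
    then obtain x where x: "x \<in> carrier \<Omega>" "z = f x" using surj by blast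
    have "y [^]\<^bsub>\<Omega>\<^esub> p \<noteq> x" if "y \<in> carrier \<Omega>" for y
      using z(2)[rule_format, of "f y"] x(2) that hom_nat_pow[of y p] by auto
    then show "\<exists>x\<in>carrier \<Omega>. \<forall>y\<in>carrier \<Omega>. y [^]\<^bsub>\<Omega>\<^esub> p \<noteq> x" using x(1) by (intro bexI[of _ x] ballI)
  qed (fact comp assms(5) assms(6))+
qed

section \<open>Arithmetic of \<open>P\<close>-numbers and \<open>P\<close>-parts\<close>

definition P_number :: "nat set \<Rightarrow> nat \<Rightarrow> bool"
  where "P_number P n \<longleftrightarrow> n > 0 \<and> (\<forall>q. prime q \<and> q dvd n \<longrightarrow> q \<in> P)"

definition P_part :: "nat set \<Rightarrow> nat \<Rightarrow> nat"
  where "P_part P n = (\<Prod>p\<in>prime_factors n \<inter> P. p ^ multiplicity p n)"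

lemma P_number_1 [simp]: "P_number P 1" "P_number P (Suc 0)"
  by (auto simp: P_number_def)

lemma P_number_mult [simp]: "P_number P (m * n) \<longleftrightarrow> P_number P m \<and> P_number P n"
  by (auto simp: P_number_def prime_dvd_mult_iff)

lemma P_number_pos: "P_number P n \<Longrightarrow> n > 0"
  by (simp add: P_number_def)

lemma P_part_mult: "n > 0 \<Longrightarrow> P_part_compl P n * P_part P n = n"
  unfolding P_part_def P_part_compl_def
  by (subst mult.commute, subst prod.Int_Diff[symmetric])
    (auto simp: prime_factorization_nat[symmetric])

lemma P_number_P_part: "P_number P (P_part P n)"
proof -
  have "q \<in> P" if "prime q" "q dvd P_part P n" for q
  proof -
    obtain p where p: "p \<in> prime_factors n \<inter> P" "q dvd p ^ multiplicity p n"
      using \<open>q dvd P_part P n\<close> \<open>prime q\<close> unfolding P_part_def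
      by (auto simp: prime_dvd_prod_iff)
    then have "q = p" using \<open>prime q\<close> by (meson IntE in_prime_factors_imp_prime prime_dvd_power primes_dvd_imp_eq)
    then show ?thesis using p by simp
  qed
  then show ?thesis
    unfolding P_number_def by (auto simp: P_part_def intro!: prod_pos prime_gt_0_nat)
qed

lemma prime_dvd_P_part_compl:
  assumes "prime q" "q dvd P_part_compl P n" shows "q \<notin> P"
proof -
  obtain p where p: "p \<in> prime_factors n - P" "q dvd p ^ multiplicity p n"
    using assms unfolding P_part_compl_def by (auto simp: prime_dvd_prod_iff)
  then have "q = p" using \<open>prime q\<close> by (meson DiffE in_prime_factors_imp_prime prime_dvd_power primes_dvd_imp_eq)
  then show ?thesis using p by simp
qed

section \<open>The closed subgroups \<open>n\<Omega>\<close> of \<open>\<Omega>\<close>\<close>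

context procyclic
begin

sublocale comm_group \<Omega>
  by unfold_locales (rule commutative)

text \<open>In additive notation this is \<open>n\<Omega>\<close>.\<close>

definition pw :: "nat \<Rightarrow> 'o set"
  where "pw n = (\<lambda>x. x [^] n) ` carrier \<Omega>"

lemma pw_closed: "x \<in> pw n \<Longrightarrow> x \<in> carrier \<Omega>"
  by (auto simp: pw_def)

lemma pow_in_pw: "x \<in> carrier \<Omega> \<Longrightarrow> x [^] n \<in> pw n"
  by (simp add: pw_def)

lemma pow_mult_in_pw: "x \<in> carrier \<Omega> \<Longrightarrow> x [^] (a * n) \<in> pw n"
  using pow_in_pw[of "x [^] a" n] by (simp add: nat_pow_pow)

lemma subgroup_pw: "subgroup (pw n) \<Omega>"
proof
  show "pw n \<subseteq> carrier \<Omega>" by (auto simp: pw_def)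
  show "\<one> \<in> pw n" using pow_in_pw[of \<one> n] by simp
  show "x \<otimes> y \<in> pw n" if "x \<in> pw n" "y \<in> pw n" for x y
  proof -
    obtain a b where "a \<in> carrier \<Omega>" "x = a [^] n" "b \<in> carrier \<Omega>" "y = b [^] n"
      using \<open>x \<in> pw n\<close> \<open>y \<in> pw n\<close> by (auto simp: pw_def)
    then show ?thesis using pow_in_pw[of "a \<otimes> b" n] by (simp add: nat_pow_distrib)
  qed
  show "inv x \<in> pw n" if x: "x \<in> pw n" for x
  proof -
    obtain z where "z \<in> carrier \<Omega>" "x = z [^] n" using x by (auto simp: pw_def)
    then show ?thesis using pow_in_pw[of "inv z" n] by (simp add: nat_pow_inv)
  qed
qed

lemma pw_mult_subset: "pw (m * n) \<subseteq> pw n"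
  by (auto simp: pw_def) (metis image_eqI nat_pow_closed nat_pow_pow)

lemma pw_dvd_subset: "n dvd m \<Longrightarrow> pw m \<subseteq> pw n"
  using pw_mult_subset by (auto simp: dvd_def mult.commute)

lemma closedin_pw: "closedin T\<Omega> (pw n)"
proof -
  have "compactin T\<Omega> (pw n)"
    unfolding pw_def using compact continuous_map_pow[of T\<Omega> "\<lambda>x. x" n] topspace_T
    by (intro image_compactin[of T\<Omega>]) (auto simp: compact_space_def)
  then show ?thesis using Hausdorff compactin_imp_closedin by blast
qed

text \<open>The elements whose \<open>n\<close>-th power lies in \<open>D\<close> form a closed
  subgroup containing the topological generator.\<close>

lemma pw_minimal:
  assumes D: "subgroup D \<Omega>" "closedin T\<Omega> D" and "\<omega> [^] n \<in> D"
  shows "pw n \<subseteq> D"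
proof -
  let ?S = "{x \<in> topspace T\<Omega>. x [^] n \<in> D}"
  have "subgroup ?S \<Omega>"
    using D(1) by unfold_locales
      (auto simp: topspace_T nat_pow_distrib nat_pow_inv subgroup.m_closed subgroup.m_inv_closed subgroup.one_closed)
  moreover have "closedin T\<Omega> ?S"
    using continuous_map_pow[of T\<Omega> "\<lambda>x. x" n] D(2) by (intro closedin_continuous_map_preimage) auto
  ultimately have "closed_generated \<Omega> T\<Omega> \<omega> \<subseteq> ?S"
    using assms(3) by (intro closed_generated_minimal) (auto simp: topspace_T)
  then show ?thesis using generator by (auto simp: pw_def)
qed

lemma pw_1: "pw 1 = carrier \<Omega>"
  by (auto simp: pw_def)

text \<open>The union of the \<open>n\<close> closed cosets represented by powers of
  \<open>\<omega>\<close> is closed and contains the dense subgroup generated by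
  \<open>\<omega>\<close>, by division with remainder of the exponent.\<close>

lemma pw_coset_decomp:
  assumes "n > 0" "x \<in> carrier \<Omega>"
  shows "\<exists>a<n. inv (\<omega> [^] a) \<otimes> x \<in> pw n"
proof -
  let ?S = "\<Union>a<n. {x \<in> carrier \<Omega>. inv (\<omega> [^] a) \<otimes> x \<in> pw n}"
  have "closedin T\<Omega> ?S"
    by (intro closedin_Union) (auto intro: closedin_translate_preimage closedin_pw)
  moreover have "generate \<Omega> {\<omega>} \<subseteq> ?S"
  proof
    fix x assume "x \<in> generate \<Omega> {\<omega>}"
    then obtain k :: int where x: "x = \<omega> [^] k" using generate_pow[of \<omega>] by auto
    have "inv (\<omega> [^] nat (k mod int n)) \<otimes> x = \<omega> [^] (- (k mod int n) + k)"
      using assms(1) unfolding x int_pow_mult[OF omega_closed]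
      by (simp add: int_pow_neg flip: int_pow_int)
    also have "- (k mod int n) + k = (k div int n) * int n"
      using div_mult_mod_eq[of k "int n"] by linarith
    also have "\<omega> [^] \<dots> = (\<omega> [^] (k div int n)) [^] n"
      by (simp add: int_pow_pow flip: int_pow_int)
    finally have "inv (\<omega> [^] nat (k mod int n)) \<otimes> x \<in> pw n"
      using pow_in_pw[of "\<omega> [^] (k div int n)" n] by simp
    moreover have "nat (k mod int n) < n" using assms(1) by (simp add: nat_less_iff)
    ultimately show "x \<in> ?S" using x by (intro UN_I[of "nat (k mod int n)"]) simp_all
  qed
  ultimately have "closed_generated \<Omega> T\<Omega> \<omega> \<subseteq> ?S"
    unfolding closed_generated_def by (intro closure_of_minimal)
  then show ?thesis using generator assms(2) by blast
qed

text \<open>The complement is the union of those among the finitely many closed cosets whose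
  representative lies outside \<open>pw n\<close>.\<close>

lemma openin_pw:
  assumes "n > 0" shows "openin T\<Omega> (pw n)"
proof -
  let ?A = "{a. a < n \<and> \<omega> [^] a \<notin> pw n}"
  let ?S = "\<Union>a\<in>?A. {x \<in> carrier \<Omega>. inv (\<omega> [^] a) \<otimes> x \<in> pw n}"
  interpret pw: subgroup "pw n" \<Omega> by (rule subgroup_pw)
  have "closedin T\<Omega> ?S"
    by (intro closedin_Union) (auto intro: closedin_translate_preimage closedin_pw)
  moreover have "pw n = topspace T\<Omega> - ?S"
  proof (intro equalityI subsetI)
    fix x assume x: "x \<in> pw n"
    have "\<omega> [^] a \<in> pw n" if a: "inv (\<omega> [^] a) \<otimes> x \<in> pw n" for a :: nat
    proof -
      have "x \<otimes> inv (inv (\<omega> [^] a) \<otimes> x) \<in> pw n" using x a by blast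
      moreover have "x \<otimes> inv (inv (\<omega> [^] a) \<otimes> x) = \<omega> [^] a"
        using pw_closed[OF x] by (simp add: inv_mult_group)
      ultimately show ?thesis by simp
    qed
    then show "x \<in> topspace T\<Omega> - ?S" using x pw_closed topspace_T by auto
  next
    fix x assume x: "x \<in> topspace T\<Omega> - ?S"
    then obtain a where a: "a < n" "inv (\<omega> [^] a) \<otimes> x \<in> pw n"
      using pw_coset_decomp[OF assms, of x] topspace_T by auto
    then have "\<omega> [^] a \<in> pw n" using x topspace_T by auto
    then have "\<omega> [^] a \<otimes> (inv (\<omega> [^] a) \<otimes> x) \<in> pw n" using a by blast
    then show "x \<in> pw n" using x topspace_T by simp
  qed
  ultimately show ?thesis using openin_diff[OF openin_topspace, of T\<Omega> ?S] by (simp only:)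
qed

lemma torsion_free:
  assumes "(n::nat) > 0" "x \<in> carrier \<Omega>" "x [^] n = \<one>" shows "x = \<one>"
  using assms(1,3)
proof (induction n rule: less_induct)
  case (less n)
  show ?case
  proof (cases "n = 1")
    case True
    then show ?thesis using less assms(2) by simp
  next
    case False
    then obtain q where q: "prime q" "q dvd n" using prime_factor_nat by blast
    then obtain m where m: "n = m * q" by (metis dvd_div_mult_self)
    have "x [^] m = \<one>"
      using prime_torsion_free[OF q(1), of "x [^] m"] less.prems assms(2) m by (simp add: nat_pow_pow)
    moreover have "m < n" "m > 0" using m less.prems q(1) prime_gt_1_nat[of q] by auto
    ultimately show ?thesis using less.IH by blast
  qed
qed

lemma pow_cancel:
  assumes "(n::nat) > 0" "x \<in> carrier \<Omega>" "y \<in> carrier \<Omega>" "x [^] n = y [^] n" shows "x = y"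
proof -
  have "(x \<otimes> inv y) [^] n = \<one>"
    using assms by (simp add: nat_pow_distrib nat_pow_inv)
  then have "x \<otimes> inv y = \<one>" using torsion_free[OF assms(1)] assms by simp
  then show ?thesis using assms by (simp add: inv_solve_right')
qed

text \<open>Otherwise every element of \<open>\<Omega>\<close> would be a \<open>p\<close>-th power,
  since \<open>pw p\<close> is a closed subgroup.\<close>

lemma omega_notin_pw_prime:
  assumes "p \<in> P" shows "\<omega> \<notin> pw p"
proof
  assume "\<omega> \<in> pw p"
  then have "pw 1 \<subseteq> pw p" using subgroup_pw closedin_pw by (intro pw_minimal) auto
  then show False using not_divisible[OF assms] pw_1 by (auto simp: pw_def)
qed

text \<open>Split a prime \<open>p\<close> off \<open>n = m * p\<close>. By induction
  \<open>m\<close> divides \<open>a\<close>, and absence of torsion cancels \<open>m\<close>, which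
  leaves a power \<open>\<omega> [^] b\<close> in \<open>pw p\<close>. If \<open>p\<close> did not
  divide \<open>b\<close>, Bezout would put \<open>\<omega>\<close> itself into
  \<open>pw p\<close>.\<close>

lemma pw_dvd:
  assumes "P_number P n" "\<omega> [^] a \<in> pw n" shows "n dvd a"
  using assms
proof (induction n rule: less_induct)
  case (less n)
  show ?case
  proof (cases "n = 1")
    case False
    then obtain p where p: "prime p" "p dvd n" using prime_factor_nat by blast
    then obtain m where m: "n = m * p" by (metis dvd_div_mult_self)
    have pos: "n > 0" using less.prems P_number_pos by blast
    then have "m < n" "m > 0" using p(1) m prime_gt_1_nat[of p] by auto
    have pP: "p \<in> P" using p less.prems by (auto simp: P_number_def)
    have "\<omega> [^] a \<in> pw m" using less.prems m pw_dvd_subset[of m n] by auto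
    then have "m dvd a" using less.IH[of m] \<open>m < n\<close> less.prems m by simp
    then obtain b where b: "a = m * b" by (auto simp: dvd_def)
    obtain y where y: "y \<in> carrier \<Omega>" "\<omega> [^] a = y [^] n" using less.prems by (auto simp: pw_def)
    have "(\<omega> [^] b) [^] m = (y [^] p) [^] m"
      using y b m by (simp add: nat_pow_pow mult.commute)
    then have b_y: "\<omega> [^] b = y [^] p" using pow_cancel[OF \<open>m > 0\<close>] y by simp
    have "p dvd b"
    proof (rule ccontr)
      assume "\<not> p dvd b"
      then have "gcd b p = 1" "b \<noteq> 0" using p prime_imp_coprime[of p b] by (auto simp: coprime_iff_gcd_eq_1 gcd.commute intro: Nat.gr0I)
      then obtain u w where uw: "b * u = p * w + 1" using bezout_nat[of b p] by auto
      interpret pw: subgroup "pw p" \<Omega> by (rule subgroup_pw)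
      have "\<omega> [^] (b * u) = (y [^] u) [^] p"
        using b_y y by (simp add: nat_pow_pow mult.commute flip: nat_pow_pow[of \<omega> b u])
      then have 1: "\<omega> [^] (b * u) \<in> pw p" using y pow_in_pw by simp
      have 2: "\<omega> [^] (p * w) \<in> pw p" using pow_mult_in_pw[of \<omega> w p] by (simp add: mult.commute)
      have "inv (\<omega> [^] (p * w)) \<otimes> \<omega> [^] (b * u) = \<omega>"
        unfolding uw by (simp add: nat_pow_mult[symmetric])
      then have "\<omega> \<in> pw p" using pw.m_closed[OF pw.m_inv_closed[OF 2] 1] by simp
      then show False using omega_notin_pw_prime[OF pP] by blast
    qed
    then show ?thesis using b m by simp
  qed simp
qed

lemma pw_compl_mult:
  assumes "m > 0" "\<And>q. prime q \<Longrightarrow> q dvd m \<Longrightarrow> q \<notin> P"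
  shows "pw (m * n) = pw n"
  using assms
proof (induction m rule: less_induct)
  case (less m)
  show ?case
  proof (cases "m = 1")
    case False
    then obtain q where q: "prime q" "q dvd m" using prime_factor_nat by blast
    then obtain k where k: "m = k * q" by (metis dvd_div_mult_self)
    have "pw (m * n) = pw (k * n)"
    proof
      show "pw (m * n) \<subseteq> pw (k * n)" using k by (intro pw_dvd_subset) auto
      show "pw (k * n) \<subseteq> pw (m * n)"
      proof
        fix z assume "z \<in> pw (k * n)"
        then obtain x where x: "x \<in> carrier \<Omega>" "z = x [^] (k * n)" by (auto simp: pw_def)
        obtain y where "y \<in> carrier \<Omega>" "y [^] q = x" using divisible[OF q(1) _ x(1)] less.prems q by blast
        then show "z \<in> pw (m * n)" using pow_in_pw[of y "m * n"] x k by (auto simp: nat_pow_pow mult_ac)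
      qed
    qed
    also have "\<dots> = pw n" using less k q prime_gt_1_nat[of q] by (intro less.IH) auto
    finally show ?thesis .
  qed simp
qed

text \<open>The prime-to-\<open>P\<close> factor is absorbed by divisibility. This is where
  \<open>P(n)\<close> and \<open>P'(n)\<close> part ways: the image under \<open>d\<close> of a
  Frobenius group determines only \<open>P(n)\<close>.\<close>

lemma pw_P_part:
  assumes "n > 0" shows "pw n = pw (P_part P n)" "pw (n * k) = pw (P_part P n * k)"
proof -
  have *: "pw (n * k) = pw (P_part P n * k)" for k
  proof -
    have "P_part_compl P n > 0" using P_part_mult[OF assms, of P] assms by (metis Nat.gr0I mult_0 less_irrefl)
    then have "pw (P_part_compl P n * (P_part P n * k)) = pw (P_part P n * k)"
      by (intro pw_compl_mult prime_dvd_P_part_compl)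
    then show ?thesis using P_part_mult[OF assms, of P] by (simp add: mult.assoc[symmetric])
  qed
  show "pw (n * k) = pw (P_part P n * k)" by (rule *)
  show "pw n = pw (P_part P n)" using *[of 1] by simp
qed

text \<open>Lagrange puts \<open>pw f\<close> into \<open>D\<close>. Hence the powers of
  \<open>\<omega>\<close> with exponent below \<open>f\<close> represent all \<open>f\<close> cosets
  of \<open>D\<close>, so they represent each of them once, and none but the trivial power lies in
  \<open>D\<close>.\<close>

lemma finite_index_subgroup_eq_pw:
  assumes D: "subgroup D \<Omega>" and fin: "finite_index \<Omega> (carrier \<Omega>) D"
  defines "f \<equiv> index \<Omega> (carrier \<Omega>) D"
  shows "D = pw f" "P_number P f"
proof -
  interpret D: normal D \<Omega> using D by (rule subgroup_imp_normal)
  interpret Q: group "\<Omega> Mod D" by (rule D.factorgroup_is_group)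
  have f: "f = card (rcosets D)" and finr: "finite (rcosets D)"
    using fin by (simp_all add: f_def index_def finite_index_def cosets_in_def)
  have "D \<in> rcosets D" using D.subgroup_in_rcosets[OF is_group] .
  then have fpos: "f > 0" using f finr by (auto simp: card_gt_0_iff)
  have pow: "x [^] f \<in> D" if x: "x \<in> carrier \<Omega>" for x
  proof -
    have "D #> x \<in> carrier (\<Omega> Mod D)" using x by (simp add: carrier_FactGroup)
    then have "(D #> x) [^]\<^bsub>\<Omega> Mod D\<^esub> order (\<Omega> Mod D) = D"
      using Q.pow_order_eq_1 by simp
    moreover have "order (\<Omega> Mod D) = f" by (simp add: order_def FactGroup_def f)
    ultimately have "D #> (x [^] f) = D" using D.FactGroup_pow[OF x] by simp
    then show ?thesis using x coset_join1 D by (metis D.subset nat_pow_closed rcos_self)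
  qed
  then have sub: "pw f \<subseteq> D" by (auto simp: pw_def)
  let ?c = "\<lambda>a::nat. D #> \<omega> [^] a"
  have "?c ` {..<f} = rcosets D"
  proof
    show "?c ` {..<f} \<subseteq> rcosets D" by (auto intro!: rcosetsI D.subset)
    show "rcosets D \<subseteq> ?c ` {..<f}"
    proof
      fix X assume "X \<in> rcosets D"
      then obtain x where x: "x \<in> carrier \<Omega>" "X = D #> x" by (auto simp: RCOSETS_def)
      then obtain a where a: "a < f" "inv (\<omega> [^] a) \<otimes> x \<in> pw f" using pw_coset_decomp[OF fpos] by blast
      then have "x \<otimes> inv (\<omega> [^] a) \<in> D" using sub x by (auto simp: m_comm)
      then have "x \<in> ?c a" using x D.rcos_module_rev[OF is_group, of "\<omega> [^] a" x] by simp
      then have "X = ?c a" using x repr_independence[of x D "\<omega> [^] a"] D by simp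
      then show "X \<in> ?c ` {..<f}" using a by blast
    qed
  qed
  then have "card (?c ` {..<f}) = card {..<f}" using f by simp
  then have inj: "inj_on ?c {..<f}" by (intro eq_card_imp_inj_on) auto
  have small: "a = 0" if "a < f" "\<omega> [^] a \<in> D" for a
  proof -
    have "?c a = ?c 0" using that D coset_join2[of "\<omega> [^] a" D] by (simp add: D.subset)
    then show ?thesis using inj_onD[OF inj, of a 0] that fpos by blast
  qed
  show Deq: "D = pw f"
  proof
    show "D \<subseteq> pw f"
    proof
      fix x assume x: "x \<in> D"
      then have xc: "x \<in> carrier \<Omega>" using D.mem_carrier by blast
      obtain a where a: "a < f" "inv (\<omega> [^] a) \<otimes> x \<in> pw f" using pw_coset_decomp[OF fpos xc] by blast
      then have "x \<otimes> inv (inv (\<omega> [^] a) \<otimes> x) \<in> D" using sub x by blast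
      then have "\<omega> [^] a \<in> D" using xc by (simp add: inv_mult_group)
      then have "a = 0" using small a by blast
      then show "x \<in> pw f" using a xc by simp
    qed
  qed (rule sub)
  show "P_number P f"
    unfolding P_number_def
  proof (intro conjI allI impI fpos; elim conjE)
    fix q assume q: "prime q" "q dvd f"
    show "q \<in> P"
    proof (rule ccontr)
      assume "q \<notin> P"
      \<comment> \<open>A prime outside \<open>P\<close> could be dropped from the exponent, so that
        the smaller power \<open>\<omega> [^] g\<close> would lie in \<open>D\<close>.\<close>
      obtain g where g: "f = q * g" using q(2) by (auto simp: dvd_def)
      have "pw f = pw g" unfolding g
        using q(1) \<open>q \<notin> P\<close> by (intro pw_compl_mult) (use primes_dvd_imp_eq prime_gt_0_nat in blast)+
      then have "\<omega> [^] g \<in> D" using Deq pow_in_pw[of \<omega> g] by simp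
      moreover have "g < f" "g > 0" using g fpos q(1) prime_gt_1_nat[of q] by auto
      ultimately show False using small by blast
    qed
  qed
qed

end

section \<open>Indices in pro-\<open>P\<close> groups\<close>

text \<open>Two elements of \<open>K\<close> with the same image differ by an element of
  \<open>U\<close>, so distinct cosets keep distinct images. It serves both for reduction modulo an
  open normal subgroup and for \<open>d\<close>.\<close>

lemma (in group_hom) card_rcosets_image:
  assumes K: "subgroup K G" and U: "subgroup U (G\<lparr>carrier := K\<rparr>)"
    and ker: "kernel G H h \<inter> K \<subseteq> U"
  shows "card (rcosets\<^bsub>H\<lparr>carrier := h ` K\<rparr>\<^esub> (h ` U)) = card (rcosets\<^bsub>G\<lparr>carrier := K\<rparr>\<^esub> U)"
proof -
  have KG: "K \<subseteq> carrier G" using K subgroup.subset by blast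
  have UK: "U \<subseteq> K" using U subgroup.subset by fastforce
  have UG: "subgroup U G" using U K G.incl_subgroup by blast
  have im: "h ` (U #>\<^bsub>G\<^esub> x) = h ` U #>\<^bsub>H\<^esub> h x" if "x \<in> K" for x
  proof -
    have "h (u \<otimes>\<^bsub>G\<^esub> x) = h u \<otimes>\<^bsub>H\<^esub> h x" if "u \<in> U" for u
      using \<open>x \<in> K\<close> that UK KG by (intro hom_mult) auto
    then show ?thesis by (simp add: r_coset_def image_UN)
  qed
  have 1: "rcosets\<^bsub>G\<lparr>carrier := K\<rparr>\<^esub> U = (\<lambda>x. U #>\<^bsub>G\<^esub> x) ` K"
    by (auto simp: RCOSETS_def)
  have 2: "rcosets\<^bsub>H\<lparr>carrier := h ` K\<rparr>\<^esub> (h ` U) = (\<lambda>X. h ` X) ` (rcosets\<^bsub>G\<lparr>carrier := K\<rparr>\<^esub> U)"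
    unfolding 1 image_image by (auto simp: RCOSETS_def im)
  have "inj_on (\<lambda>X. h ` X) (rcosets\<^bsub>G\<lparr>carrier := K\<rparr>\<^esub> U)"
  proof (rule inj_onI)
    fix X Y assume "X \<in> rcosets\<^bsub>G\<lparr>carrier := K\<rparr>\<^esub> U" "Y \<in> rcosets\<^bsub>G\<lparr>carrier := K\<rparr>\<^esub> U"
      and eq: "h ` X = h ` Y"
    then obtain x y where x: "x \<in> K" "X = U #>\<^bsub>G\<^esub> x" and y: "y \<in> K" "Y = U #>\<^bsub>G\<^esub> y"
      unfolding 1 by blast
    have "x \<in> X" using x UG KG G.rcos_self by blast
    then have "h x \<in> h ` Y" using eq by blast
    then obtain u where u: "u \<in> U" "h x = h (u \<otimes>\<^bsub>G\<^esub> y)"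
      unfolding y by (auto simp: r_coset_def)
    have G: "x \<in> carrier G" "y \<in> carrier G" "u \<in> carrier G" and uK: "u \<in> K"
      using x y u UK KG by auto
    let ?k = "x \<otimes>\<^bsub>G\<^esub> inv\<^bsub>G\<^esub> (u \<otimes>\<^bsub>G\<^esub> y)"
    have "?k \<in> kernel G H h" using u G by (simp add: kernel_def)
    moreover have "?k \<in> K" using x y uK K by (simp add: subgroup.m_closed subgroup.m_inv_closed)
    ultimately have "?k \<otimes>\<^bsub>G\<^esub> u \<in> U" using ker u UG by (auto intro: subgroup.m_closed)
    moreover have "?k \<otimes>\<^bsub>G\<^esub> u \<otimes>\<^bsub>G\<^esub> y = x" using G by (simp add: G.m_assoc)
    ultimately have "x \<in> Y" unfolding y
      using G.rcosI[OF _ subgroup.subset[OF UG] G(2), of "?k \<otimes>\<^bsub>G\<^esub> u"] by simp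
    then show "X = Y" unfolding x y using G.repr_independence[of x U y] G UG by simp
  qed
  then show ?thesis unfolding 2 by (rule card_image)
qed

text \<open>Choose an open normal \<open>N\<close> of \<open>G\<close> whose intersection with
  \<open>K\<close> lies in \<open>U\<close>. Then the index can be computed in
  \<open>G Mod N\<close>, where Lagrange makes it a divisor of the order.\<close>

lemma pro_P_index:
  assumes pro: "pro_P_group P G T" and K: "subgroup K G"
    and U: "subgroup U (G\<lparr>carrier := K\<rparr>)" and op: "openin (subtopology T K) U"
    and fin: "finite_index G K U"
  shows "P_number P (index G K U)"
proof -
  have prof: "profinite_group G T"
    and ord: "\<And>N p. N \<lhd> G \<Longrightarrow> openin T N \<Longrightarrow> prime p \<Longrightarrow> p dvd order (G Mod N) \<Longrightarrow> p \<in> P"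
    using pro by (auto simp: pro_P_group_def)
  interpret top_group G T
    using prof by (simp add: profinite_group_def topological_group_iff)
  interpret K: group "G\<lparr>carrier := K\<rparr>" using K subgroup_imp_group by blast
  obtain V where V: "openin T V" "U = V \<inter> K" using op by (auto simp: openin_subtopology)
  have "\<one>\<^bsub>G\<^esub> \<in> U" using subgroup.one_closed[OF U] by simp
  then obtain N where N: "N \<lhd> G" "openin T N" "N \<subseteq> V"
    using profinite_normal_basis[OF prof V(1)] V(2) by blast
  interpret N: normal N G by (rule N(1))
  interpret Q: group "G Mod N" by (rule N.factorgroup_is_group)
  interpret h: group_hom G "G Mod N" "\<lambda>x. N #>\<^bsub>G\<^esub> x"
    using N.r_coset_hom_Mod by unfold_locales
  have ker: "kernel G (G Mod N) (\<lambda>x. N #>\<^bsub>G\<^esub> x) \<inter> K \<subseteq> U"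
  proof
    fix x assume "x \<in> kernel G (G Mod N) (\<lambda>x. N #>\<^bsub>G\<^esub> x) \<inter> K"
    then have "x \<in> carrier G" "N #>\<^bsub>G\<^esub> x = N" "x \<in> K" by (auto simp: kernel_def)
    then have "x \<in> N" using coset_join1[of N x] N.subgroup_axioms N.subset by blast
    then show "x \<in> U" using N(3) V(2) \<open>x \<in> K\<close> by blast
  qed
  let ?i = "\<lambda>x. N #>\<^bsub>G\<^esub> x"
  have sK: "subgroup (?i ` K) (G Mod N)" using h.subgroup_img_is_subgroup[OF K] .
  interpret IK: group "(G Mod N)\<lparr>carrier := ?i ` K\<rparr>" using Q.subgroup_imp_group[OF sK] .
  have "subgroup U G" using U K incl_subgroup by blast
  then have "subgroup (?i ` U) (G Mod N)" by (rule h.subgroup_img_is_subgroup)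
  then have sU: "subgroup (?i ` U) ((G Mod N)\<lparr>carrier := ?i ` K\<rparr>)"
    using sK U subgroup.subset[OF U] by (intro Q.subgroup_incl) auto
  have "index G K U * card (?i ` U) = card (?i ` K)"
    using IK.lagrange[OF sU] h.card_rcosets_image[OF K U ker]
    by (simp add: index_def cosets_in_def order_def)
  then have "index G K U dvd order (G Mod N)"
    using Q.lagrange[OF sK] by (metis dvd_mult dvd_triv_left)
  moreover have "index G K U > 0"
    using fin subgroup.subgroup_in_rcosets[OF U K.is_group]
    by (auto simp: index_def finite_index_def cosets_in_def card_gt_0_iff)
  ultimately show ?thesis
    unfolding P_number_def using ord[OF N(1,2)] dvd_trans by blast
qed

lemma (in top_group) pow_index_mem:
  assumes K: "subgroup K G" and U: "U \<lhd> G\<lparr>carrier := K\<rparr>" and x: "x \<in> K"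
  shows "x [^] index G K U \<in> U"
proof -
  interpret U: normal U "G\<lparr>carrier := K\<rparr>" by (rule U)
  interpret Q: group "G\<lparr>carrier := K\<rparr> Mod U" by (rule U.factorgroup_is_group)
  let ?n = "index G K U"
  have xc: "x \<in> carrier (G\<lparr>carrier := K\<rparr>)" using x by simp
  have n: "?n = order (G\<lparr>carrier := K\<rparr> Mod U)"
    by (simp add: index_def cosets_in_def order_def FactGroup_def)
  have "U #>\<^bsub>G\<lparr>carrier := K\<rparr>\<^esub> x \<in> carrier (G\<lparr>carrier := K\<rparr> Mod U)"
    using x by (simp add: carrier_FactGroup)
  then have "(U #>\<^bsub>G\<lparr>carrier := K\<rparr>\<^esub> x) [^]\<^bsub>G\<lparr>carrier := K\<rparr> Mod U\<^esub> ?n = U"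
    using Q.pow_order_eq_1 n by simp
  then have "U #>\<^bsub>G\<lparr>carrier := K\<rparr>\<^esub> (x [^]\<^bsub>G\<lparr>carrier := K\<rparr>\<^esub> ?n) = U"
    using U.FactGroup_pow[OF xc] by simp
  then have "x [^]\<^bsub>G\<lparr>carrier := K\<rparr>\<^esub> ?n \<in> U"
    using U.rcos_self[OF U.nat_pow_closed[OF xc, of ?n] U.subgroup_axioms] by simp
  then show ?thesis by (simp add: nat_pow_consistent[symmetric])
qed

section \<open>Frobenius groups\<close>

text \<open>The groups \<open>W j\<close> are the unramified extensions
  of \<open>U\<close> and the groups \<open>Z j\<close> the unramified extensions of \<open>H\<close>; they replace the maximal
  unramified extensions of the classical proof.\<close>

locale ramified_extension =
  Om: procyclic \<Omega> T\<Omega> \<omega> P + top_group G T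
  for \<Omega> :: "'o monoid" and T\<Omega> \<omega> P and G :: "'g monoid" (structure) and T +
  fixes d :: "'g \<Rightarrow> 'o" and H U :: "'g set"
  assumes d_hom: "d \<in> hom G \<Omega>" and d_cont: "continuous_map T T\<Omega> d"
    and compact_G: "compact_space T"
    and H: "subgroup H G" "closedin T H"
    and fin_dH: "finite_index \<Omega> (carrier \<Omega>) (d ` H)"
    and U_normal: "U \<lhd> G\<lparr>carrier := H\<rparr>" and U_closed: "closedin T U"
    and U_open: "openin (subtopology T H) U"
    and P_index_U: "P_number P (index G H U)"
begin

definition f where "f = index \<Omega> (carrier \<Omega>) (d ` H)"
definition m where "m = index G H U"
text \<open>As the image of \<open>H\<close> under \<open>d\<close> is \<open>Om.pw f\<close>, for
  positive \<open>j\<close> this is the unramified subgroup of \<open>H\<close> of index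
  \<open>P(j)\<close>. It contains all inertia of \<open>H\<close>, whereas \<open>W j\<close> keeps
  only that of \<open>U\<close>.\<close>

definition Z where "Z j = {x \<in> H. d x \<in> Om.pw (j * f)}"
definition W where "W j = U \<inter> Z j"

sublocale d: group_hom G \<Omega> d
  using d_hom by unfold_locales

lemma H_closed: "x \<in> H \<Longrightarrow> x \<in> carrier G"
  using H(1) subgroup.mem_carrier by fast

lemma U_subset: "U \<subseteq> H"
  using normal_imp_subgroup[OF U_normal] subgroup.subset by fastforce

lemma subgroup_U: "subgroup U G"
  using normal_imp_subgroup[OF U_normal] H(1) incl_subgroup by blast

lemma U_conj:
  assumes "h \<in> H" "x \<in> U" shows "h \<otimes> x \<otimes> inv h \<in> U" "inv h \<otimes> x \<otimes> h \<in> U"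
  using normal.inv_op_closed2[OF U_normal, of h x] normal.inv_op_closed1[OF U_normal, of h x] assms
  by (simp_all add: m_inv_consistent[OF H(1)])

lemma d_image_H: "d ` H = Om.pw f" and P_number_f: "P_number P f"
  using Om.finite_index_subgroup_eq_pw[OF d.subgroup_img_is_subgroup[OF H(1)] fin_dH]
  by (simp_all add: f_def)

lemma f_pos: "f > 0" using P_number_f P_number_pos by blast

lemma P_number_m: "P_number P m" using P_index_U by (simp add: m_def)

lemma m_pos: "m > 0" using P_number_m P_number_pos by blast

lemma pow_m_in_U: "x \<in> H \<Longrightarrow> m dvd j \<Longrightarrow> x [^] j \<in> U"
proof -
  assume x: "x \<in> H" and "m dvd j"
  then obtain k where k: "j = m * k" by blast
  have "x [^] m \<in> U" using pow_index_mem[OF H(1) U_normal x] by (simp add: m_def)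
  then have "(x [^] m) [^] k \<in> U" using subgroup_U by (induction k) (auto simp: subgroup.one_closed subgroup.m_closed)
  then show ?thesis using x k H_closed by (simp add: nat_pow_pow)
qed

lemma subgroup_Z: "subgroup (Z j) G"
proof -
  interpret H: subgroup H G by (rule H(1))
  interpret pw: subgroup "Om.pw (j * f)" \<Omega> by (rule Om.subgroup_pw)
  show ?thesis by unfold_locales (auto simp: Z_def)
qed

lemma subgroup_W: "subgroup (W j) G"
  unfolding W_def by (intro subgroups_Inter_pair subgroup_U subgroup_Z)

lemma Z_subset: "Z j \<subseteq> H" by (auto simp: Z_def)
lemma W_subset: "W j \<subseteq> U" "W j \<subseteq> Z j" "W j \<subseteq> H" using U_subset by (auto simp: W_def)

lemma d_conj: "h \<in> carrier G \<Longrightarrow> x \<in> carrier G \<Longrightarrow> d (h \<otimes> x \<otimes> inv h) = d x"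
  using Om.m_comm by (simp add: Om.m_assoc Om.m_comm)

lemma H_conj: "h \<in> H \<Longrightarrow> x \<in> H \<Longrightarrow> h \<otimes> x \<otimes> inv h \<in> H"
  using H(1) by (simp add: subgroup.m_closed subgroup.m_inv_closed)

lemma Z_conj: "h \<in> H \<Longrightarrow> x \<in> Z j \<Longrightarrow> h \<otimes> x \<otimes> inv h \<in> Z j"
  unfolding Z_def using d_conj H_conj H_closed by simp

lemma W_conj: "h \<in> H \<Longrightarrow> x \<in> W j \<Longrightarrow> h \<otimes> x \<otimes> inv h \<in> W j"
  unfolding W_def using Z_conj U_conj by simp

lemma open_Z: "j > 0 \<Longrightarrow> openin (subtopology T H) (Z j)"
proof -
  assume "j > 0"
  then have "openin T {x \<in> topspace T. d x \<in> Om.pw (j * f)}"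
    using f_pos by (intro openin_continuous_map_preimage[OF d_cont] Om.openin_pw) simp
  then have "openin (subtopology T H) ({x \<in> topspace T. d x \<in> Om.pw (j * f)} \<inter> H)"
    by (auto simp: openin_subtopology)
  also have "{x \<in> topspace T. d x \<in> Om.pw (j * f)} \<inter> H = Z j"
    using H_closed by (auto simp: Z_def topspace_T)
  finally show ?thesis .
qed

lemma open_W: "j > 0 \<Longrightarrow> openin (subtopology T H) (W j)"
  unfolding W_def by (intro openin_Int U_open open_Z)

lemma Z_mono: "i dvd j \<Longrightarrow> Z j \<subseteq> Z i"
  unfolding Z_def using Om.pw_dvd_subset[of "i * f" "j * f"] by auto

lemma W_mono: "i dvd j \<Longrightarrow> W j \<subseteq> W i"
  unfolding W_def using Z_mono by blast

lemma inertia_eq: "A \<subseteq> H \<Longrightarrow> inertia G \<Omega> d A = {x \<in> A. d x = \<one>\<^bsub>\<Omega>\<^esub>}"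
  using H_closed by (auto simp: inertia_def kernel_def)

lemma one_in_pw: "\<one>\<^bsub>\<Omega>\<^esub> \<in> Om.pw n"
  using subgroup.one_closed[OF Om.subgroup_pw] .

text \<open>Lift an \<open>f\<close>-th power in \<open>\<Omega>\<close> to \<open>H\<close>.
  Divisibility by the index \<open>m\<close> forces the \<open>j\<close>-th power of the lift into
  \<open>U\<close>.\<close>

lemma d_image_W:
  assumes "m dvd j" shows "d ` W j = Om.pw (j * f)"
proof
  show "d ` W j \<subseteq> Om.pw (j * f)" by (auto simp: W_def Z_def)
  show "Om.pw (j * f) \<subseteq> d ` W j"
  proof
    fix y assume y: "y \<in> Om.pw (j * f)"
    then obtain z where z: "z \<in> carrier \<Omega>" "y = z [^]\<^bsub>\<Omega>\<^esub> (j * f)" by (auto simp: Om.pw_def)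
    obtain h where h: "h \<in> H" "d h = z [^]\<^bsub>\<Omega>\<^esub> f"
      using d_image_H Om.pow_in_pw[OF z(1), of f] by (metis imageE)
    have "d (h [^] j) = y" using h z H_closed by (simp add: d.hom_nat_pow Om.nat_pow_pow mult.commute)
    moreover have "h [^] j \<in> U" using pow_m_in_U[OF h(1) assms] .
    ultimately show "y \<in> d ` W j" using y U_subset by (intro image_eqI[of _ _ "h [^] j"]) (auto simp: W_def Z_def)
  qed
qed

lemma d_image_Z: "d ` Z j = Om.pw (j * f)"
proof
  show "d ` Z j \<subseteq> Om.pw (j * f)" by (auto simp: Z_def)
  have "Om.pw (j * f) \<subseteq> d ` H" unfolding d_image_H by (rule Om.pw_mult_subset)
  then show "Om.pw (j * f) \<subseteq> d ` Z j" by (auto simp: Z_def)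
qed

text \<open>The traits shared by the Frobenius group of an element with normalised value
  \<open>n\<close> times \<open>\<omega>\<close> and by \<open>W j\<close> with
  \<open>n = j\<close>, so that one Mackey computation covers both. The residue degree over
  \<open>H\<close> is \<open>P(n)\<close>, not \<open>n\<close>.\<close>

definition frobenius_subgroup :: "'g set \<Rightarrow> nat \<Rightarrow> bool"
  where "frobenius_subgroup S n \<longleftrightarrow> n > 0 \<and> subgroup S G \<and> S \<subseteq> H \<and> openin (subtopology T H) S \<and>
    (\<forall>x\<in>H. d x = \<one>\<^bsub>\<Omega>\<^esub> \<longrightarrow> (x \<in> S \<longleftrightarrow> x \<in> U)) \<and> d ` S = Om.pw (n * f)"

lemma frobenius_subgroup_W: "m dvd j \<Longrightarrow> j > 0 \<Longrightarrow> frobenius_subgroup (W j) j"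
  unfolding frobenius_subgroup_def using d_image_W subgroup_W open_W W_subset one_in_pw
  by (auto simp: W_def Z_def)

section \<open>The Frobenius group of a fixed element \<open>h\<close>\<close>

context
  fixes h n
  assumes h: "h \<in> H" and n: "n > 0" and dh: "d h = \<omega> [^]\<^bsub>\<Omega>\<^esub> (n * f)"
begin

private abbreviation "c \<equiv> closed_generated G T h"
private abbreviation "S \<equiv> frobenius_group G T \<Omega> d U h"

lemma closed_generated_subset: "c \<subseteq> H"
  using H h by (rule closed_generated_minimal)

lemma d_image_closed_generated:
  assumes "x \<in> H" "d x = \<omega> [^]\<^bsub>\<Omega>\<^esub> k"
  shows "d ` closed_generated G T x = Om.pw k"
proof
  have x: "x \<in> carrier G" using assms H_closed by blast
  have "subgroup {y \<in> topspace T. d y \<in> Om.pw k} G"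
  proof -
    interpret pw: subgroup "Om.pw k" \<Omega> by (rule Om.subgroup_pw)
    show ?thesis by unfold_locales (auto simp: topspace_T)
  qed
  moreover have "closedin T {y \<in> topspace T. d y \<in> Om.pw k}"
    by (intro closedin_continuous_map_preimage[OF d_cont] Om.closedin_pw)
  ultimately have "closed_generated G T x \<subseteq> {y \<in> topspace T. d y \<in> Om.pw k}"
    using x assms Om.pow_in_pw[of \<omega> k] by (intro closed_generated_minimal) (auto simp: topspace_T)
  then show "d ` closed_generated G T x \<subseteq> Om.pw k" by blast
  show "Om.pw k \<subseteq> d ` closed_generated G T x"
  proof (rule Om.pw_minimal)
    show "subgroup (d ` closed_generated G T x) \<Omega>"
      using d.subgroup_img_is_subgroup[OF subgroup_closed_generated[OF x]] .
    have "compactin T (closed_generated G T x)"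
      by (rule closedin_compact_space[OF compact_G closedin_closed_generated])
    then have "compactin T\<Omega> (d ` closed_generated G T x)" using d_cont by (rule image_compactin)
    then show "closedin T\<Omega> (d ` closed_generated G T x)"
      using Om.Hausdorff compactin_imp_closedin by blast
    show "\<omega> [^]\<^bsub>\<Omega>\<^esub> k \<in> d ` closed_generated G T x"
      using mem_closed_generated[OF x] assms by (metis imageI)
  qed
qed

lemma frobenius_group_mem_iff:
  "x \<in> S \<longleftrightarrow> (\<exists>y\<in>c. \<exists>u\<in>U. d u = \<one>\<^bsub>\<Omega>\<^esub> \<and> x = y \<otimes> u)"
  unfolding frobenius_group_def inertia_eq[OF U_subset] set_mult_def by auto

text \<open>The closed group of \<open>h\<close> lies in \<open>H\<close>, which normalises
  \<open>U\<close>, and the kernel of \<open>d\<close> is normal; so it normalises the inertia group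
  of \<open>U\<close>.\<close>

lemma frobenius_group_subgroup: "subgroup S G"
proof -
  interpret c: subgroup c G using subgroup_closed_generated h H_closed by blast
  interpret U: subgroup U G by (rule subgroup_U)
  show ?thesis
  proof
    show "S \<subseteq> carrier G" using frobenius_group_mem_iff by auto
    show "\<one> \<in> S" using frobenius_group_mem_iff[of \<one>] c.one_closed U.one_closed d.hom_one
      by (metis l_one one_closed)
  next
    fix x x' assume "x \<in> S" "x' \<in> S"
    then obtain y u y' u' where y: "y \<in> c" "u \<in> U" "d u = \<one>\<^bsub>\<Omega>\<^esub>" "x = y \<otimes> u"
      and y': "y' \<in> c" "u' \<in> U" "d u' = \<one>\<^bsub>\<Omega>\<^esub>" "x' = y' \<otimes> u'"
      unfolding frobenius_group_mem_iff by blast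
    have "inv y' \<otimes> u \<otimes> y' \<in> U" using U_conj(2)[of y' u] y' y closed_generated_subset by auto
    moreover have "d (inv y' \<otimes> u \<otimes> y') = \<one>\<^bsub>\<Omega>\<^esub>" using y y' by simp
    moreover have "x \<otimes> x' = (y \<otimes> y') \<otimes> ((inv y' \<otimes> u \<otimes> y') \<otimes> u')"
      using y y' by (simp add: m_assoc)
    ultimately show "x \<otimes> x' \<in> S"
      unfolding frobenius_group_mem_iff using y y'
      by (intro bexI[of _ "y \<otimes> y'"] bexI[of _ "(inv y' \<otimes> u \<otimes> y') \<otimes> u'"]) auto
  next
    fix x assume "x \<in> S"
    then obtain y u where y: "y \<in> c" "u \<in> U" "d u = \<one>\<^bsub>\<Omega>\<^esub>" "x = y \<otimes> u"
      unfolding frobenius_group_mem_iff by blast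
    have "y \<otimes> inv u \<otimes> inv y \<in> U" using U_conj(1)[of y "inv u"] y closed_generated_subset by auto
    moreover have "d (y \<otimes> inv u \<otimes> inv y) = \<one>\<^bsub>\<Omega>\<^esub>" using y by simp
    moreover have "inv x = inv y \<otimes> (y \<otimes> inv u \<otimes> inv y)"
      using y by (simp add: m_assoc inv_mult_group)
    ultimately show "inv x \<in> S"
      unfolding frobenius_group_mem_iff using y
      by (intro bexI[of _ "inv y"] bexI[of _ "y \<otimes> inv u \<otimes> inv y"]) auto
  qed
qed

lemma mem_frobenius_group: "h \<in> S"
  unfolding frobenius_group_mem_iff
  using mem_closed_generated[OF H_closed[OF h]] H_closed[OF h] subgroup.one_closed[OF subgroup_U]
  by (metis d.hom_one r_one)

lemma frobenius_group_subset: "S \<subseteq> H"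
proof
  fix x assume "x \<in> S"
  then obtain y u where "y \<in> c" "u \<in> U" "x = y \<otimes> u"
    unfolding frobenius_group_mem_iff by blast
  then show "x \<in> H" using subgroup.m_closed[OF H(1), of y u] closed_generated_subset U_subset by auto
qed

text \<open>Passing to \<open>h [^] m\<close> enforces membership in \<open>U\<close> while the
  image under \<open>d\<close> stays known. This supplies elements of \<open>U\<close> inside the
  Frobenius group with prescribed image.\<close>

lemma closed_generated_pow:
  "closed_generated G T (h [^] m) \<subseteq> c \<inter> U" "d ` closed_generated G T (h [^] m) = Om.pw (m * n * f)"
proof -
  have hG: "h \<in> carrier G" using h H_closed by blast
  interpret c: subgroup c G by (rule subgroup_closed_generated[OF hG])
  have "h [^] k \<in> c" for k :: nat
    using mem_closed_generated[OF hG] by (induction k) auto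
  then show "closed_generated G T (h [^] m) \<subseteq> c \<inter> U"
    using pow_m_in_U[OF h, of m]
    by (intro closed_generated_minimal subgroups_Inter_pair c.subgroup_axioms subgroup_U closedin_Int
      closedin_closed_generated U_closed) auto
  have "h [^] m \<in> H" using pow_m_in_U[OF h, of m] U_subset by auto
  moreover have "d (h [^] m) = \<omega> [^]\<^bsub>\<Omega>\<^esub> (m * n * f)"
    unfolding d.hom_nat_pow[OF hG] dh by (simp add: Om.nat_pow_pow mult_ac)
  ultimately show "d ` closed_generated G T (h [^] m) = Om.pw (m * n * f)"
    by (rule d_image_closed_generated)
qed

text \<open>An element of \<open>W j\<close> has the same image under \<open>d\<close> as some
  element of the closed group of \<open>h [^] m\<close>, and both lie in \<open>U\<close>; so they
  differ by inertia of \<open>U\<close>. Taking \<open>P(n)\<close> in place of \<open>n\<close>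
  permits levels \<open>j\<close> that are \<open>P\<close>-numbers.\<close>

lemma W_subset_frobenius_group:
  assumes "m * P_part P n dvd j" shows "W j \<subseteq> S"
proof
  fix x assume x: "x \<in> W j"
  then have xU: "x \<in> U" and "d x \<in> Om.pw (j * f)" by (auto simp: W_def Z_def)
  then have "d x \<in> Om.pw (P_part P n * (m * f))"
    using Om.pw_dvd_subset[of "P_part P n * (m * f)" "j * f"] assms by (auto simp: mult_ac)
  then have "d x \<in> Om.pw (m * n * f)"
    using Om.pw_P_part(2)[OF n, of "m * f"] by (simp add: mult_ac)
  then obtain z where z: "z \<in> closed_generated G T (h [^] m)" "d x = d z"
    using closed_generated_pow(2) by (metis imageE)
  then have zc: "z \<in> c" "z \<in> U" using closed_generated_pow(1) by auto
  have xz: "x \<in> carrier G" "z \<in> carrier G" using xU zc U_subset H_closed by auto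
  have "inv z \<otimes> x \<in> U" using zc xU subgroup_U by (simp add: subgroup.m_closed subgroup.m_inv_closed)
  moreover have "d (inv z \<otimes> x) = \<one>\<^bsub>\<Omega>\<^esub>" using xz z by simp
  moreover have "x = z \<otimes> (inv z \<otimes> x)" using xz by simp
  ultimately show "x \<in> S" unfolding frobenius_group_mem_iff using zc by blast
qed

text \<open>The closed group of \<open>h\<close> is covered by the translates, by
  \<open>h [^] a\<close> with \<open>a < m\<close>, of the closed group of \<open>h [^] m\<close>.
  If a translate meets the kernel of \<open>d\<close>, then cancelling \<open>n * f\<close> shows
  that \<open>m\<close> divides \<open>a\<close>. So only \<open>a = 0\<close> survives, and that
  translate lies in \<open>U\<close>.\<close>

lemma closed_generated_inertia:
  assumes y: "y \<in> c" "d y = \<one>\<^bsub>\<Omega>\<^esub>" shows "y \<in> U"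
proof -
  have hG: "h \<in> carrier G" using h H_closed by blast
  let ?K = "closed_generated G T (h [^] m)"
  let ?S = "\<Union>a<m. {x \<in> carrier G. inv (h [^] a) \<otimes> x \<in> ?K}"
  interpret K: subgroup ?K G using subgroup_closed_generated hG by simp
  have "closedin T ?S"
    using hG by (intro closedin_Union) (auto intro: closedin_translate_preimage closedin_closed_generated)
  moreover have "generate G {h} \<subseteq> ?S"
  proof
    fix x assume "x \<in> generate G {h}"
    then obtain k :: int where x: "x = h [^] k" using generate_pow[OF hG] by auto
    have "inv (h [^] nat (k mod int m)) \<otimes> x = h [^] (- (k mod int m) + k)"
      using m_pos hG unfolding x int_pow_mult[OF hG]
      by (simp add: int_pow_neg flip: int_pow_int)
    also have "- (k mod int m) + k = int m * (k div int m)"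
      by (simp add: minus_mod_eq_mult_div)
    also have "h [^] \<dots> = (h [^] m) [^] (k div int m)"
      using hG by (simp add: int_pow_pow flip: int_pow_int)
    finally have "inv (h [^] nat (k mod int m)) \<otimes> x = (h [^] m) [^] (k div int m)" .
    moreover have "(h [^] m) [^] (k div int m) \<in> ?K"
      using mem_closed_generated[of "h [^] m"] hG K.subgroup_axioms subgroup_int_pow_closed by blast
    moreover have "nat (k mod int m) < m" using m_pos by (simp add: nat_less_iff)
    ultimately show "x \<in> ?S" using x hG by (intro UN_I[of "nat (k mod int m)"]) simp_all
  qed
  ultimately have "c \<subseteq> ?S"
    unfolding closed_generated_def[of G T h] by (intro closure_of_minimal)
  then obtain a where a: "a < m" "y \<in> carrier G" "inv (h [^] a) \<otimes> y \<in> ?K" using y by auto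
  have "d (inv (h [^] a) \<otimes> y) = inv\<^bsub>\<Omega>\<^esub> (\<omega> [^]\<^bsub>\<Omega>\<^esub> (n * f * a))"
    using a hG y dh by (simp add: d.hom_nat_pow Om.nat_pow_pow)
  then have "inv\<^bsub>\<Omega>\<^esub> (\<omega> [^]\<^bsub>\<Omega>\<^esub> (n * f * a)) \<in> Om.pw (m * n * f)"
    using a(3) closed_generated_pow(2) by (metis imageI)
  then have "\<omega> [^]\<^bsub>\<Omega>\<^esub> (n * f * a) \<in> Om.pw (m * n * f)"
    using subgroup.m_inv_closed[OF Om.subgroup_pw] by fastforce
  then obtain z where z: "z \<in> carrier \<Omega>" "\<omega> [^]\<^bsub>\<Omega>\<^esub> (n * f * a) = z [^]\<^bsub>\<Omega>\<^esub> (m * n * f)"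
    by (auto simp: Om.pw_def)
  then have "(\<omega> [^]\<^bsub>\<Omega>\<^esub> a) [^]\<^bsub>\<Omega>\<^esub> (n * f) = (z [^]\<^bsub>\<Omega>\<^esub> m) [^]\<^bsub>\<Omega>\<^esub> (n * f)"
    by (simp add: Om.nat_pow_pow mult_ac)
  then have "\<omega> [^]\<^bsub>\<Omega>\<^esub> a = z [^]\<^bsub>\<Omega>\<^esub> m"
    using Om.pow_cancel[of "n * f" "\<omega> [^]\<^bsub>\<Omega>\<^esub> a" "z [^]\<^bsub>\<Omega>\<^esub> m"] z n f_pos by simp
  then have "m dvd a" using Om.pw_dvd[OF P_number_m] Om.pow_in_pw[OF z(1)] by metis
  then have "a = 0" using a(1) by (auto dest: dvd_imp_le)
  then have "y \<in> ?K" using a by simp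
  then show ?thesis using closed_generated_pow(1) by blast
qed

lemma frobenius_subgroup_frobenius_group: "frobenius_subgroup S n"
  unfolding frobenius_subgroup_def
proof (intro conjI ballI impI n frobenius_group_subgroup frobenius_group_subset)
  show "openin (subtopology T H) S"
  proof (rule openin_subgroup_of_superset[OF H(1) frobenius_group_subgroup frobenius_group_subset])
    show "openin (subtopology T H) (W (m * P_part P n))"
      using m_pos P_number_pos[OF P_number_P_part] by (simp add: open_W)
    show "\<one> \<in> W (m * P_part P n)" using subgroup.one_closed[OF subgroup_W] .
    show "W (m * P_part P n) \<subseteq> S" using W_subset_frobenius_group by simp
  qed
  show "x \<in> S \<longleftrightarrow> x \<in> U" if x: "x \<in> H" "d x = \<one>\<^bsub>\<Omega>\<^esub>" for x
  proof
    assume "x \<in> S"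
    then obtain y u where y: "y \<in> c" "u \<in> U" "d u = \<one>\<^bsub>\<Omega>\<^esub>" "x = y \<otimes> u"
      unfolding frobenius_group_mem_iff by blast
    have "y \<in> carrier G" "u \<in> carrier G" using y closed_generated_subset U_subset H_closed by auto
    then have "d y = \<one>\<^bsub>\<Omega>\<^esub>" using y x by simp
    then show "x \<in> U" using closed_generated_inertia y subgroup_U by (simp add: subgroup.m_closed)
  next
    assume "x \<in> U"
    then show "x \<in> S" unfolding frobenius_group_mem_iff
      using x subgroup.one_closed[OF subgroup_closed_generated[OF H_closed[OF h]]] H_closed
      by (metis l_one)
  qed
  have 1: "d ` c = Om.pw (n * f)" using h dh by (rule d_image_closed_generated)
  show "d ` S = Om.pw (n * f)"
  proof
    show "d ` S \<subseteq> Om.pw (n * f)"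
    proof
      fix z assume "z \<in> d ` S"
      then obtain y u where "y \<in> c" "u \<in> U" "d u = \<one>\<^bsub>\<Omega>\<^esub>" "z = d (y \<otimes> u)"
        unfolding image_iff Bex_def frobenius_group_mem_iff by blast
      moreover from this have "y \<in> carrier G" "u \<in> carrier G"
        using closed_generated_subset U_subset H_closed by auto
      ultimately show "z \<in> Om.pw (n * f)" using 1 by auto
    qed
    have "c \<subseteq> S"
    proof
      fix y assume y: "y \<in> c"
      then have "y \<in> carrier G" using closed_generated_subset H_closed by blast
      then show "y \<in> S" unfolding frobenius_group_mem_iff
        using y subgroup.one_closed[OF subgroup_U] by (metis d.hom_one r_one)
    qed
    then have "d ` c \<subseteq> d ` S" by (rule image_mono)
    then show "Om.pw (n * f) \<subseteq> d ` S" by (simp only: 1)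
  qed
qed

end

end

section \<open>Mackey functors on the open subgroups of \<open>H\<close>\<close>

lemma ric_functor_AbD:
  assumes "ric_functor_Ab G act D F" "x \<in> Base D"
  shows "comm_group (Obj F x)"
    and "y \<in> Res D x \<Longrightarrow> res_map F y x \<in> hom (Obj F x) (Obj F y)"
    and "y \<in> Ind D x \<Longrightarrow> ind_map F x y \<in> hom (Obj F y) (Obj F x)"
    and "g \<in> carrier G \<Longrightarrow> con_map F g x \<in> hom (Obj F x) (Obj F (act g x))"
    and "a \<in> carrier (Obj F x) \<Longrightarrow> con_map F \<one>\<^bsub>G\<^esub> x a = a"
    and "\<lbrakk>y \<in> Res D x; z \<in> Res D y; a \<in> carrier (Obj F x)\<rbrakk> \<Longrightarrow>
       res_map F z y (res_map F y x a) = res_map F z x a"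
    and "\<lbrakk>y \<in> Ind D x; z \<in> Ind D y; a \<in> carrier (Obj F z)\<rbrakk> \<Longrightarrow>
       ind_map F x y (ind_map F y z a) = ind_map F x z a"
    and "\<lbrakk>g \<in> carrier G; g' \<in> carrier G; a \<in> carrier (Obj F x)\<rbrakk> \<Longrightarrow>
       con_map F g' (act g x) (con_map F g x a) = con_map F (g' \<otimes>\<^bsub>G\<^esub> g) x a"
    and "\<lbrakk>y \<in> Res D x; g \<in> carrier G; a \<in> carrier (Obj F x)\<rbrakk> \<Longrightarrow>
       con_map F g y (res_map F y x a) = res_map F (act g y) (act g x) (con_map F g x a)"
    and "\<lbrakk>y \<in> Ind D x; g \<in> carrier G; a \<in> carrier (Obj F y)\<rbrakk> \<Longrightarrow>
       con_map F g x (ind_map F x y a) = ind_map F (act g x) (act g y) (con_map F g y a)"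
    and "a \<in> carrier (Obj F x) \<Longrightarrow> res_map F x x a = a"
  using assms by (simp_all add: ric_functor_Ab_def)

lemma ric_morphismD:
  assumes "ric_morphism G act D F F' \<phi>" "x \<in> Base D"
  shows "\<phi> x \<in> hom (Obj F x) (Obj F' x)"
    and "y \<in> Res D x \<Longrightarrow> a \<in> carrier (Obj F x) \<Longrightarrow> \<phi> y (res_map F y x a) = res_map F' y x (\<phi> x a)"
    and "y \<in> Ind D x \<Longrightarrow> a \<in> carrier (Obj F y) \<Longrightarrow> \<phi> x (ind_map F x y a) = ind_map F' x y (\<phi> y a)"
    and "g \<in> carrier G \<Longrightarrow> a \<in> carrier (Obj F x) \<Longrightarrow> \<phi> (act g x) (con_map F g x a) = con_map F' g x (\<phi> x a)"
  using assms by (simp_all add: ric_morphism_def)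

text \<open>In order: unramified restriction is injective on units, Frobenius-fixed units descend,
  Hilbert 90 holds for units, and unramified norms are onto on units.\<close>

lemma FN_exactD:
  assumes "FN_exact \<Omega> C v U V \<phi>"
  shows "\<lbrakk>a \<in> units_val \<Omega> C v U; res_map C V U a = \<one>\<^bsub>Obj C V\<^esub>\<rbrakk> \<Longrightarrow> a = \<one>\<^bsub>Obj C U\<^esub>"
    and "\<lbrakk>x \<in> units_val \<Omega> C v V;
        con_map C \<phi> V x \<otimes>\<^bsub>Obj C V\<^esub> inv\<^bsub>Obj C V\<^esub> x = \<one>\<^bsub>Obj C V\<^esub>\<rbrakk> \<Longrightarrow>
      x \<in> res_map C V U ` units_val \<Omega> C v U"
    and "\<lbrakk>x \<in> units_val \<Omega> C v V; ind_map C U V x = \<one>\<^bsub>Obj C U\<^esub>\<rbrakk> \<Longrightarrow>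
      x \<in> (\<lambda>x. con_map C \<phi> V x \<otimes>\<^bsub>Obj C V\<^esub> inv\<^bsub>Obj C V\<^esub> x) ` units_val \<Omega> C v V"
    and "units_val \<Omega> C v U \<subseteq> ind_map C U V ` units_val \<Omega> C v V"
proof -
  have "{x \<in> units_val \<Omega> C v U. res_map C V U x = \<one>\<^bsub>Obj C V\<^esub>} = {\<one>\<^bsub>Obj C U\<^esub>}"
    and "{x \<in> units_val \<Omega> C v V. con_map C \<phi> V x \<otimes>\<^bsub>Obj C V\<^esub> inv\<^bsub>Obj C V\<^esub> x = \<one>\<^bsub>Obj C V\<^esub>} =
      res_map C V U ` units_val \<Omega> C v U"
    and "{x \<in> units_val \<Omega> C v V. ind_map C U V x = \<one>\<^bsub>Obj C U\<^esub>} =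
      (\<lambda>x. con_map C \<phi> V x \<otimes>\<^bsub>Obj C V\<^esub> inv\<^bsub>Obj C V\<^esub> x) ` units_val \<Omega> C v V"
    and "units_val \<Omega> C v U = ind_map C U V ` units_val \<Omega> C v V"
    using assms[unfolded FN_exact_def Let_def exact_seq_cons_iff exact_seq_end_iff kernel_def, simplified]
    by blast+
  then show "\<lbrakk>a \<in> units_val \<Omega> C v U; res_map C V U a = \<one>\<^bsub>Obj C V\<^esub>\<rbrakk> \<Longrightarrow> a = \<one>\<^bsub>Obj C U\<^esub>"
    and "\<lbrakk>x \<in> units_val \<Omega> C v V;
        con_map C \<phi> V x \<otimes>\<^bsub>Obj C V\<^esub> inv\<^bsub>Obj C V\<^esub> x = \<one>\<^bsub>Obj C V\<^esub>\<rbrakk> \<Longrightarrow>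
      x \<in> res_map C V U ` units_val \<Omega> C v U"
    and "\<lbrakk>x \<in> units_val \<Omega> C v V; ind_map C U V x = \<one>\<^bsub>Obj C U\<^esub>\<rbrakk> \<Longrightarrow>
      x \<in> (\<lambda>x. con_map C \<phi> V x \<otimes>\<^bsub>Obj C V\<^esub> inv\<^bsub>Obj C V\<^esub> x) ` units_val \<Omega> C v V"
    and "units_val \<Omega> C v U \<subseteq> ind_map C U V ` units_val \<Omega> C v V"
    by blast+
qed

lemma (in top_group) conj_set_eq:
  "conj_set G g K = (\<lambda>x. g \<otimes> x \<otimes> inv g) ` K"
  by (auto simp: conj_set_def l_coset_def r_coset_def)

lemma (in top_group) conj_set_normal:
  assumes "K \<subseteq> carrier G" "subgroup L G" "\<And>g x. g \<in> L \<Longrightarrow> x \<in> K \<Longrightarrow> g \<otimes> x \<otimes> inv g \<in> K" "g \<in> L"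
  shows "conj_set G g K = K"
proof
  have g: "g \<in> carrier G" "inv g \<in> L"
    using assms subgroup.mem_carrier subgroup.m_inv_closed by fast+
  show "conj_set G g K \<subseteq> K" unfolding conj_set_eq using assms by blast
  show "K \<subseteq> conj_set G g K"
  proof
    fix x assume x: "x \<in> K"
    have "inv g \<otimes> x \<otimes> inv (inv g) \<in> K" using assms g x by blast
    moreover have "x = g \<otimes> (inv g \<otimes> x \<otimes> inv (inv g)) \<otimes> inv g"
      using g x assms(1) by (auto simp: m_assoc)
    ultimately show "x \<in> conj_set G g K" unfolding conj_set_eq by (intro image_eqI)
  qed
qed

lemma (in comm_group) quotient_mult:
  "\<lbrakk>x \<in> carrier G; y \<in> carrier G; z \<in> carrier G\<rbrakk> \<Longrightarrow> (x \<otimes> inv z) \<otimes> (y \<otimes> inv x) = y \<otimes> inv z"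
  by (simp add: m_lcomm m_comm[of "inv z"] m_assoc)

text \<open>The element \<open>\<phi>\<close> is a fixed lift of the Frobenius of \<open>H\<close>.
  One lift for all layers lets its powers serve as double coset representatives and as Frobenius
  lifts of the groups \<open>W j\<close>.\<close>

locale FN_extension =
  ramified_extension \<Omega> T\<Omega> \<omega> P G T d H U
  for \<Omega> :: "'o monoid" and T\<Omega> \<omega> P and G :: "'g monoid" (structure) and T d H U +
  fixes M :: "'g set ric" and C :: "('g set, 'g, 'a) ric_functor" and v :: "'g set \<Rightarrow> 'a \<Rightarrow> 'o"
    and \<phi> :: 'g
  assumes Mackey: "cohomological_Mackey_functor G M C"
    and arithmetic: "arithmetic_system G T M"
    and valuation: "v \<in> Val G \<Omega> \<omega> d M C"
    and H_Base: "H \<in> Base M"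
    and exact: "\<lbrakk>open_subgroup_of G T S H; V \<in> E_ur G T \<Omega> d S; \<psi> \<in> frobenius_elt G \<Omega> \<omega> d S V\<rbrakk>
      \<Longrightarrow> FN_exact \<Omega> C v S V \<psi>"
    and d_surj: "d ` carrier G = carrier \<Omega>"
    and phi: "\<phi> \<in> H" "d \<phi> = \<omega> [^]\<^bsub>\<Omega>\<^esub> f"
begin

abbreviation A :: "'g set \<Rightarrow> 'a monoid" where "A K \<equiv> Obj C K"
abbreviation units :: "'g set \<Rightarrow> 'a set" where "units K \<equiv> units_val \<Omega> C v K"
abbreviation con :: "'g \<Rightarrow> 'g set \<Rightarrow> 'a \<Rightarrow> 'a" where "con \<equiv> con_map C"
abbreviation ind :: "'g set \<Rightarrow> 'g set \<Rightarrow> 'a \<Rightarrow> 'a" where "ind \<equiv> ind_map C"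
abbreviation res :: "'g set \<Rightarrow> 'g set \<Rightarrow> 'a \<Rightarrow> 'a" where "res \<equiv> res_map C"

definition osub :: "'g set \<Rightarrow> bool"
  where "osub K \<longleftrightarrow> subgroup K G \<and> K \<subseteq> H \<and> openin (subtopology T H) K"

text \<open>Invariance under all of \<open>H\<close> makes each \<open>con g K\<close> with
  \<open>g\<close> in \<open>H\<close> an endomorphism of \<open>A K\<close>, so that expressions in
  group elements can act on one group.\<close>

definition hnormal :: "'g set \<Rightarrow> bool"
  where "hnormal K \<longleftrightarrow> osub K \<and> (\<forall>g\<in>H. conj_set G g K = K)"

lemma osub_subset: "osub K \<Longrightarrow> K \<subseteq> H" and osub_subgroup: "osub K \<Longrightarrow> subgroup K G"
  by (auto simp: osub_def)

lemma osub_H: "osub H"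
  unfolding osub_def using H H_closed openin_topspace[of "subtopology T H"] by (auto simp: topspace_T inf_absorb2 subset_iff)

lemma hnormal_osub: "hnormal K \<Longrightarrow> osub K"
  by (simp add: hnormal_def)

lemma hnormalI:
  assumes "osub K" "\<And>g x. g \<in> H \<Longrightarrow> x \<in> K \<Longrightarrow> g \<otimes> x \<otimes> inv g \<in> K"
  shows "hnormal K"
  unfolding hnormal_def
  using assms conj_set_normal[OF subgroup.subset[OF osub_subgroup] H(1)] by blast

lemma hnormal_Z: "j > 0 \<Longrightarrow> hnormal (Z j)"
  by (intro hnormalI Z_conj) (auto simp: osub_def subgroup_Z Z_subset open_Z[unfolded])

lemma hnormal_W: "j > 0 \<Longrightarrow> hnormal (W j)"
  by (intro hnormalI W_conj) (auto simp: osub_def subgroup_W W_subset open_W)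

lemma osub_U: "osub U"
  unfolding osub_def using subgroup_U U_subset U_open by blast

lemma frobenius_subgroup_osub: "frobenius_subgroup S n \<Longrightarrow> osub S"
  by (auto simp: osub_def frobenius_subgroup_def)

lemma open_subgroup_of_osub:
  assumes "osub K" "osub L" "K \<subseteq> L" shows "open_subgroup_of G T K L"
proof -
  obtain V where "openin T V" "K = V \<inter> H" using assms by (auto simp: osub_def openin_subtopology)
  then have "openin (subtopology T L) K"
    using assms by (auto simp: openin_subtopology osub_def)
  then show ?thesis
    unfolding open_subgroup_of_def using assms by (auto simp: osub_def intro: subgroup_incl)
qed

lemma ric: "ric_functor_Ab G (conj_set G) M C"
  using Mackey by (simp add: cohomological_Mackey_functor_def)

lemma Res_Ind_Base:
  assumes "L \<in> Base M" shows "Res M L \<subseteq> Base M" "Ind M L \<subseteq> Base M"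
  using assms Mackey
  by (simp_all add: cohomological_Mackey_functor_def Mackey_system_def subgroup_system_def
      ric_domain_def ric_family_def)

lemma osub_Base: "osub K \<Longrightarrow> K \<in> Base M"
  using arithmetic H_Base open_subgroup_of_osub[OF _ osub_H osub_subset, of K] Res_Ind_Base(1)[OF H_Base]
  by (auto simp: arithmetic_system_def)

lemma osub_Res_Ind:
  assumes "osub K" "osub L" "K \<subseteq> L" shows "K \<in> Res M L" "K \<in> Ind M L"
  using arithmetic osub_Base[OF assms(2)] open_subgroup_of_osub[OF assms]
  by (auto simp: arithmetic_system_def)

lemma comm_group_A: "osub K \<Longrightarrow> comm_group (A K)"
  using ric_functor_AbD(1)[OF ric osub_Base] .

lemma group_A: "osub K \<Longrightarrow> group (A K)"
  using comm_group_A comm_group.axioms(2) by blast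

lemma group_hom_res:
  "osub K \<Longrightarrow> osub L \<Longrightarrow> K \<subseteq> L \<Longrightarrow> group_hom (A L) (A K) (res K L)"
  unfolding group_hom_def group_hom_axioms_def
  using group_A ric_functor_AbD(2)[OF ric osub_Base osub_Res_Ind(1)] by blast

lemma group_hom_ind:
  "osub K \<Longrightarrow> osub L \<Longrightarrow> K \<subseteq> L \<Longrightarrow> group_hom (A K) (A L) (ind L K)"
  unfolding group_hom_def group_hom_axioms_def
  using group_A ric_functor_AbD(3)[OF ric osub_Base osub_Res_Ind(2)] by blast

lemma hnormal_conj: "hnormal K \<Longrightarrow> g \<in> H \<Longrightarrow> conj_set G g K = K"
  by (simp add: hnormal_def)

lemma group_hom_con:
  assumes "hnormal K" "g \<in> H" shows "group_hom (A K) (A K) (con g K)"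
  unfolding group_hom_def group_hom_axioms_def
  using assms hnormal_osub[OF assms(1)] group_A hnormal_conj
    ric_functor_AbD(4)[OF ric osub_Base, of K g] H_closed by auto

lemma hom_closed_A:
  assumes "osub K" "osub L" "K \<subseteq> L"
  shows "a \<in> carrier (A L) \<Longrightarrow> res K L a \<in> carrier (A K)"
    and "b \<in> carrier (A K) \<Longrightarrow> ind L K b \<in> carrier (A L)"
  using group_hom.hom_closed[OF group_hom_res[OF assms]] group_hom.hom_closed[OF group_hom_ind[OF assms]]
  by auto

lemma con_closed: "hnormal K \<Longrightarrow> g \<in> H \<Longrightarrow> a \<in> carrier (A K) \<Longrightarrow> con g K a \<in> carrier (A K)"
  using group_hom.hom_closed[OF group_hom_con] by blast

lemma res_res:
  "\<lbrakk>osub K; osub L; osub N; K \<subseteq> L; L \<subseteq> N; a \<in> carrier (A N)\<rbrakk> \<Longrightarrow> res K L (res L N a) = res K N a"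
  using ric_functor_AbD(6)[OF ric osub_Base osub_Res_Ind(1) osub_Res_Ind(1)] by blast

lemma ind_ind:
  "\<lbrakk>osub K; osub L; osub N; K \<subseteq> L; L \<subseteq> N; a \<in> carrier (A K)\<rbrakk> \<Longrightarrow> ind N L (ind L K a) = ind N K a"
  using ric_functor_AbD(7)[OF ric osub_Base osub_Res_Ind(2) osub_Res_Ind(2)] by blast

lemma con_con:
  assumes "hnormal K" "g \<in> H" "g' \<in> H" "a \<in> carrier (A K)"
  shows "con g' K (con g K a) = con (g' \<otimes> g) K a"
  using ric_functor_AbD(8)[OF ric osub_Base[OF hnormal_osub[OF assms(1)]], of g g' a]
    hnormal_conj assms H_closed by simp

lemma con_one: "osub K \<Longrightarrow> a \<in> carrier (A K) \<Longrightarrow> con \<one> K a = a"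
  using ric_functor_AbD(5)[OF ric osub_Base] by blast

lemma con_trivial: "osub K \<Longrightarrow> g \<in> K \<Longrightarrow> a \<in> carrier (A K) \<Longrightarrow> con g K a = a"
  using Mackey osub_Base by (simp add: cohomological_Mackey_functor_def)

lemma con_ind:
  assumes "hnormal K" "hnormal L" "K \<subseteq> L" "g \<in> H" "a \<in> carrier (A K)"
  shows "con g L (ind L K a) = ind L K (con g K a)"
  using ric_functor_AbD(10)[OF ric osub_Base[OF hnormal_osub[OF assms(2)]]
      osub_Res_Ind(2)[OF hnormal_osub[OF assms(1)] hnormal_osub[OF assms(2)]], of g a]
    assms hnormal_conj H_closed by simp

text \<open>Conjugation by \<open>s\<close> preserves \<open>S\<close> and acts trivially on
  \<open>A S\<close>, hence also on whatever is restricted from there. Thus \<open>h\<close> fixes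
  the restriction of a prime element of its own Frobenius group.\<close>

lemma con_res_normalizer:
  assumes "osub S" "hnormal K" "K \<subseteq> S" "s \<in> S" "a \<in> carrier (A S)"
  shows "con s K (res K S a) = res K S a"
proof -
  have s: "s \<in> H" using osub_subset assms by blast
  have "conj_set G s S = S"
    using assms osub_subgroup[OF assms(1)]
    by (intro conj_set_normal[of S S] subgroup.subset) (auto simp: subgroup.m_closed subgroup.m_inv_closed)
  then show ?thesis
    using ric_functor_AbD(9)[OF ric osub_Base[OF assms(1)]
        osub_Res_Ind(1)[OF hnormal_osub[OF assms(2)] assms(1,3)], of s a]
      con_trivial[OF assms(1,4,5)] hnormal_conj[OF assms(2) s] H_closed[OF s] assms by simp
qed

lemma ind_res:
  assumes "osub K" "osub L" "K \<subseteq> L" "a \<in> carrier (A L)"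
  shows "ind L K (res K L a) = a [^]\<^bsub>A L\<^esub> index G L K"
  using Mackey osub_Base[OF assms(2)] osub_Res_Ind[OF assms(1-3)] assms(4)
  by (simp add: cohomological_Mackey_functor_def)

lemma val_morphism: "ric_morphism G (conj_set G) M C (Omega_functor G \<Omega> d) v"
  using valuation by (simp add: Val_def)

lemma group_hom_v: "osub K \<Longrightarrow> group_hom (A K) \<Omega> (v K)"
  unfolding group_hom_def group_hom_axioms_def
  using group_A ric_morphismD(1)[OF val_morphism osub_Base] Om.is_group by (simp add: Omega_functor_def)

lemma v_res:
  "\<lbrakk>osub K; osub L; K \<subseteq> L; a \<in> carrier (A L)\<rbrakk> \<Longrightarrow> v K (res K L a) = v L a [^]\<^bsub>\<Omega>\<^esub> e_index G \<Omega> d L K"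
  using ric_morphismD(2)[OF val_morphism osub_Base osub_Res_Ind(1)] by (simp add: Omega_functor_def)

lemma v_ind:
  "\<lbrakk>osub K; osub L; K \<subseteq> L; a \<in> carrier (A K)\<rbrakk> \<Longrightarrow> v L (ind L K a) = v K a [^]\<^bsub>\<Omega>\<^esub> f_index \<Omega> d L K"
  using ric_morphismD(3)[OF val_morphism osub_Base osub_Res_Ind(2)] by (simp add: Omega_functor_def)

lemma v_con:
  "\<lbrakk>hnormal K; g \<in> H; a \<in> carrier (A K)\<rbrakk> \<Longrightarrow> v K (con g K a) = v K a"
  using ric_morphismD(4)[OF val_morphism osub_Base[OF hnormal_osub], of K g a] hnormal_conj H_closed
  by (simp add: Omega_functor_def)

lemma units_iff: "a \<in> units K \<longleftrightarrow> a \<in> carrier (A K) \<and> v K a = \<one>\<^bsub>\<Omega>\<^esub>"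
  by (auto simp: units_val_def kernel_def)

lemma subgroup_units: "osub K \<Longrightarrow> subgroup (units K) (A K)"
  unfolding units_val_def using group_hom.subgroup_kernel[OF group_hom_v] .

lemma units_ind: "\<lbrakk>osub K; osub L; K \<subseteq> L; a \<in> units K\<rbrakk> \<Longrightarrow> ind L K a \<in> units L"
  using v_ind hom_closed_A by (simp add: units_iff)

lemma phi_pow: "\<phi> [^] (i::nat) \<in> H" "d (\<phi> [^] (i::nat)) = \<omega> [^]\<^bsub>\<Omega>\<^esub> (i * f)"
proof -
  interpret H: subgroup H G by (rule H(1))
  show "\<phi> [^] i \<in> H" using phi(1) by (induction i) auto
  show "d (\<phi> [^] i) = \<omega> [^]\<^bsub>\<Omega>\<^esub> (i * f)"
    using phi H_closed d.hom_nat_pow[of \<phi> i] by (simp add: Om.nat_pow_pow mult.commute)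
qed

subsection \<open>The operators \<open>\<phi> - 1\<close> and \<open>1 + \<phi> + \<dots> + \<phi>\<^sup>n\<^sup>-\<^sup>1\<close>\<close>

definition delta :: "'g \<Rightarrow> 'g set \<Rightarrow> 'a \<Rightarrow> 'a"
  where "delta g K a = con g K a \<otimes>\<^bsub>A K\<^esub> inv\<^bsub>A K\<^esub> a"

primrec tr :: "'g set \<Rightarrow> nat \<Rightarrow> 'a \<Rightarrow> 'a"
  where "tr K 0 a = \<one>\<^bsub>A K\<^esub>"
  | "tr K (Suc n) a = tr K n a \<otimes>\<^bsub>A K\<^esub> con (\<phi> [^] n) K a"

lemma group_hom_delta:
  assumes "hnormal K" "g \<in> H" shows "group_hom (A K) (A K) (delta g K)"
proof -
  interpret A: comm_group "A K" using comm_group_A hnormal_osub assms by blast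
  interpret con: group_hom "A K" "A K" "con g K" using assms by (rule group_hom_con)
  show ?thesis
    by unfold_locales (auto simp: hom_def delta_def A.inv_mult A.m_ac)
qed

lemma delta_closed: "hnormal K \<Longrightarrow> g \<in> H \<Longrightarrow> a \<in> carrier (A K) \<Longrightarrow> delta g K a \<in> carrier (A K)"
  using group_hom.hom_closed[OF group_hom_delta] by blast

lemma delta_units: 
  assumes "hnormal K" "g \<in> H" "a \<in> carrier (A K)" shows "delta g K a \<in> units K"
proof -
  interpret v: group_hom "A K" \<Omega> "v K" using group_hom_v hnormal_osub assms by blast
  show ?thesis using assms con_closed v_con by (simp add: units_iff delta_def)
qed

lemma group_hom_tr:
  assumes "hnormal K" shows "group_hom (A K) (A K) (tr K n)"
proof -
  interpret A: comm_group "A K" using comm_group_A hnormal_osub assms by blast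
  have cl: "tr K n a \<in> carrier (A K)" if "a \<in> carrier (A K)" for a n
    using that con_closed[OF assms phi_pow(1)] by (induction n) auto
  have "tr K n (a \<otimes>\<^bsub>A K\<^esub> b) = tr K n a \<otimes>\<^bsub>A K\<^esub> tr K n b"
    if "a \<in> carrier (A K)" "b \<in> carrier (A K)" for a b
  proof (induction n)
    case (Suc n)
    interpret con: group_hom "A K" "A K" "con (\<phi> [^] n) K" using assms phi_pow(1) by (rule group_hom_con)
    show ?case using Suc that cl by (simp add: A.m_ac)
  qed simp
  then show ?thesis by unfold_locales (auto simp: hom_def cl)
qed

lemma tr_closed: "hnormal K \<Longrightarrow> a \<in> carrier (A K) \<Longrightarrow> tr K n a \<in> carrier (A K)"
  using group_hom.hom_closed[OF group_hom_tr] by blast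

lemma tr_finprod:
  assumes "hnormal K" "a \<in> carrier (A K)"
  shows "tr K n a = (\<Otimes>\<^bsub>A K\<^esub>i\<in>{..<n}. con (\<phi> [^] i) K a)"
proof (induction n)
  interpret A: comm_group "A K" using comm_group_A hnormal_osub assms by blast
  { case 0 show ?case by simp }
  case (Suc n)
  have "con (\<phi> [^] i) K a \<in> carrier (A K)" for i :: nat
    using assms phi_pow(1) con_closed by blast
  then show ?case using Suc by (simp add: lessThan_Suc A.m_comm)
qed

lemma tr_ind:
  assumes "hnormal K" "hnormal L" "K \<subseteq> L" "a \<in> carrier (A K)"
  shows "tr L n (ind L K a) = ind L K (tr K n a)"
proof -
  interpret ind: group_hom "A K" "A L" "ind L K" using assms hnormal_osub group_hom_ind by blast
  show ?thesis
  proof (induction n)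
    case (Suc n)
    then show ?case
      using assms con_ind[OF assms(1-3) phi_pow(1) assms(4)] tr_closed con_closed[OF _ phi_pow(1)] by simp
  qed simp
qed

lemma tr_add:
  assumes "hnormal K" "a \<in> carrier (A K)"
  shows "tr K (n + k) a = tr K n a \<otimes>\<^bsub>A K\<^esub> con (\<phi> [^] n) K (tr K k a)"
proof (induction k)
  interpret A: comm_group "A K" using comm_group_A hnormal_osub assms by blast
  interpret con: group_hom "A K" "A K" "con (\<phi> [^] n) K" using assms(1) phi_pow(1) by (rule group_hom_con)
  { case 0 show ?case using tr_closed[OF assms] by simp }
  case (Suc k)
  have "con (\<phi> [^] (n + k)) K a = con (\<phi> [^] n) K (con (\<phi> [^] k) K a)"
    using con_con[OF assms(1) phi_pow(1) phi_pow(1) assms(2)] phi H_closed by (simp add: nat_pow_mult)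
  then show ?case
    using Suc tr_closed[OF assms] con_closed[OF assms(1) phi_pow(1)] assms by (simp add: A.m_assoc)
qed

text \<open>The long trace consists of \<open>k\<close> blocks of length \<open>l\<close>, each the
  image of the first under a power of \<open>\<phi> [^] l\<close>, which fixes it.\<close>

lemma tr_mult_fixed:
  assumes "hnormal K" "a \<in> carrier (A K)" "con (\<phi> [^] l) K a = a"
  shows "tr K (k * l) a = tr K l a [^]\<^bsub>A K\<^esub> k"
proof (induction k)
  interpret A: comm_group "A K" using comm_group_A hnormal_osub assms by blast
  interpret con: group_hom "A K" "A K" "con (\<phi> [^] l) K" using assms(1) phi_pow(1) by (rule group_hom_con)
  { case 0 show ?case by simp }
  case (Suc k)
  have com: "con (\<phi> [^] l) K (con (\<phi> [^] i) K a) = con (\<phi> [^] i) K a" for i :: nat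
  proof -
    have "con (\<phi> [^] l) K (con (\<phi> [^] i) K a) = con (\<phi> [^] i) K (con (\<phi> [^] l) K a)"
      using con_con[OF assms(1) phi_pow(1) phi_pow(1) assms(2)] phi H_closed
      by (simp add: nat_pow_mult add.commute)
    then show ?thesis using assms(3) by simp
  qed
  have fixed: "con (\<phi> [^] l) K (tr K i a) = tr K i a" for i
    using com tr_closed[OF assms(1,2)] con_closed[OF assms(1) phi_pow(1) assms(2)] by (induction i) simp_all
  have "tr K (Suc k * l) a = tr K l a \<otimes>\<^bsub>A K\<^esub> con (\<phi> [^] l) K (tr K (k * l) a)"
    using tr_add[OF assms(1,2)] by simp
  also have "\<dots> = tr K l a \<otimes>\<^bsub>A K\<^esub> tr K (k * l) a" by (simp only: fixed)
  also have "\<dots> = tr K l a [^]\<^bsub>A K\<^esub> Suc k"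
    unfolding Suc using tr_closed[OF assms(1,2)] by (simp add: A.m_comm)
  finally show ?case .
qed

text \<open>Telescoping: \<open>\<phi> - 1\<close> times the trace of length \<open>n\<close> is the
  \<open>n\<close>-th power of \<open>\<phi>\<close> minus 1.\<close>

lemma delta_tr:
  assumes "hnormal K" "a \<in> carrier (A K)"
  shows "delta \<phi> K (tr K n a) = delta (\<phi> [^] n) K a"
proof (induction n)
  interpret A: comm_group "A K" using comm_group_A hnormal_osub assms by blast
  interpret delta: group_hom "A K" "A K" "delta \<phi> K" using assms(1) phi(1) by (rule group_hom_delta)
  { case 0 show ?case using assms con_one[OF hnormal_osub] by (simp add: delta_def[of "\<one>"]) }
  case (Suc n)
  have cl: "con (\<phi> [^] i) K a \<in> carrier (A K)" for i :: nat
    using assms phi_pow(1) con_closed by blast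
  have "con \<phi> K (con (\<phi> [^] n) K a) = con (\<phi> [^] Suc n) K a"
    using con_con[OF assms(1) phi_pow(1) phi(1) assms(2)] phi H_closed nat_pow_mult[of \<phi> 1 n] by simp
  then have "delta \<phi> K (con (\<phi> [^] n) K a) = con (\<phi> [^] Suc n) K a \<otimes>\<^bsub>A K\<^esub> inv\<^bsub>A K\<^esub> con (\<phi> [^] n) K a"
    by (simp only: delta_def)
  then have "delta \<phi> K (tr K (Suc n) a) = (con (\<phi> [^] n) K a \<otimes>\<^bsub>A K\<^esub> inv\<^bsub>A K\<^esub> a) \<otimes>\<^bsub>A K\<^esub>
      (con (\<phi> [^] Suc n) K a \<otimes>\<^bsub>A K\<^esub> inv\<^bsub>A K\<^esub> con (\<phi> [^] n) K a)"
    using Suc tr_closed[OF assms] cl by (simp add: delta_def[of "\<phi> [^] n"])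
  also have "\<dots> = delta (\<phi> [^] Suc n) K a"
    unfolding delta_def using cl assms(2) by (intro A.quotient_mult) blast+
  finally show ?case .
qed

end

section \<open>Indices in \<open>\<Omega>\<close> for \<open>P\<close>-numbers\<close>

lemma P_part_compl_P_number:
  assumes "P_number P n" shows "P_part_compl P n = 1"
proof (rule ccontr)
  assume "P_part_compl P n \<noteq> 1"
  then obtain q where q: "prime q" "q dvd P_part_compl P n" using prime_factor_nat by blast
  then have "q dvd n" using P_part_mult[OF P_number_pos[OF assms], of P] by (metis dvd_mult2)
  then have "q \<in> P" using assms q by (auto simp: P_number_def)
  then show False using prime_dvd_P_part_compl[OF q] by blast
qed

lemma (in top_group) index_self:
  assumes "subgroup K G" shows "index G K K = 1"
proof -
  have "rcosets\<^bsub>G\<lparr>carrier := K\<rparr>\<^esub> K = (\<lambda>x. K #> x) ` K" by (auto simp: RCOSETS_def)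
  also have "\<dots> = {K}"
  proof -
    have "K #> x = K" if "x \<in> K" for x
      using coset_join2[of x K] assms that subgroup.mem_carrier by fast
    moreover have "\<one> \<in> K" using assms subgroup.one_closed by blast
    ultimately show ?thesis by auto
  qed
  finally show ?thesis by (simp add: index_def cosets_in_def)
qed

text \<open>The powers of \<open>\<omega>\<close> with exponent below \<open>n\<close> represent all
  cosets. They are inequivalent by \<open>pw_dvd\<close>, for which \<open>n\<close> must be a
  \<open>P\<close>-number.\<close>

lemma (in procyclic) card_rcosets_pw:
  assumes "P_number P n" shows "card (rcosets (pw n)) = n"
proof -
  interpret pw: subgroup "pw n" \<Omega> by (rule subgroup_pw)
  let ?c = "\<lambda>a::nat. pw n #> \<omega> [^] a"
  have n: "n > 0" using assms P_number_pos by blast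
  have "?c ` {..<n} = rcosets (pw n)"
  proof
    show "?c ` {..<n} \<subseteq> rcosets (pw n)" by (auto intro!: rcosetsI pw.subset)
    show "rcosets (pw n) \<subseteq> ?c ` {..<n}"
    proof
      fix X assume "X \<in> rcosets (pw n)"
      then obtain x where x: "x \<in> carrier \<Omega>" "X = pw n #> x" by (auto simp: RCOSETS_def)
      then obtain a where a: "a < n" "inv (\<omega> [^] a) \<otimes> x \<in> pw n" using pw_coset_decomp[OF n] by blast
      then have "x \<otimes> inv (\<omega> [^] a) \<in> pw n" using x by (auto simp: m_comm)
      then have "x \<in> ?c a" using x pw.rcos_module_rev[OF is_group, of "\<omega> [^] a" x] by simp
      then have "X = ?c a" using x repr_independence[of x "pw n" "\<omega> [^] a"] subgroup_pw by simp
      then show "X \<in> ?c ` {..<n}" using a by blast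
    qed
  qed
  moreover have "inj_on ?c {..<n}"
  proof (rule linorder_inj_onI')
    fix a b assume ab: "a \<in> {..<n}" "b \<in> {..<n}" "a < b"
    show "?c a \<noteq> ?c b"
    proof
      assume "?c a = ?c b"
      then have "\<omega> [^] b \<in> ?c a" using rcos_self[OF _ subgroup_pw, of "\<omega> [^] b"] by simp
      then have "\<omega> [^] b \<otimes> inv (\<omega> [^] a) \<in> pw n"
        using pw.rcos_module_imp[OF is_group, of "\<omega> [^] a" "\<omega> [^] b"] by simp
      also have "\<omega> [^] b \<otimes> inv (\<omega> [^] a) = \<omega> [^] (b - a)"
      proof -
        have "\<omega> [^] b = \<omega> [^] (b - a) \<otimes> \<omega> [^] a" using ab by (simp add: nat_pow_mult)
        then show ?thesis by (simp add: m_assoc)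
      qed
      finally have "n dvd b - a" by (rule pw_dvd[OF assms])
      then show False using ab by (auto dest: dvd_imp_le)
    qed
  qed
  ultimately show ?thesis by (metis card_image card_lessThan)
qed

lemma (in procyclic) index_pw: "P_number P n \<Longrightarrow> index \<Omega> (carrier \<Omega>) (pw n) = n"
  using card_rcosets_pw by (simp add: index_def cosets_in_def)

text \<open>In the absence of torsion, the \<open>k\<close>-th power map is injective and carries
  the pair \<open>carrier \<Omega>\<close>, \<open>pw n\<close> to \<open>pw k\<close>,
  \<open>pw (n * k)\<close>.\<close>

lemma (in procyclic) index_pw_pw:
  assumes "k > 0" "P_number P n" shows "index \<Omega> (pw k) (pw (n * k)) = n"
proof -
  interpret pow: group_hom \<Omega> \<Omega> "\<lambda>x. x [^] k"
    by unfold_locales (auto simp: hom_def nat_pow_distrib)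
  have "kernel \<Omega> \<Omega> (\<lambda>x. x [^] k) \<inter> carrier \<Omega> \<subseteq> pw n"
    using torsion_free[OF assms(1)] subgroup.one_closed[OF subgroup_pw] by (auto simp: kernel_def)
  moreover have "(\<lambda>x. x [^] k) ` pw n = pw (n * k)"
    by (auto simp: pw_def image_iff nat_pow_pow)
  ultimately show ?thesis
    using pow.card_rcosets_image[of "carrier \<Omega>" "pw n"] subgroup_self subgroup_pw card_rcosets_pw[OF assms(2)]
    by (simp add: index_def cosets_in_def pw_def[of k, symmetric])
qed

section \<open>Exact sequences along unramified layers\<close>

context FN_extension
begin

lemma inertial_H: "x \<in> H \<Longrightarrow> d x = \<one>\<^bsub>\<Omega>\<^esub> \<Longrightarrow> x \<in> Z j"
  unfolding Z_def using one_in_pw by simp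

lemma E_ur_I:
  assumes K: "osub K" and V: "hnormal V" and "V \<subseteq> K"
    and inert: "\<And>x. x \<in> K \<Longrightarrow> d x = \<one>\<^bsub>\<Omega>\<^esub> \<Longrightarrow> x \<in> V"
  shows "V \<in> E_ur G T \<Omega> d K"
proof -
  interpret K: group "G\<lparr>carrier := K\<rparr>" using subgroup_imp_group[OF osub_subgroup[OF K]] .
  have op: "open_subgroup_of G T V K" using open_subgroup_of_osub[OF hnormal_osub[OF V] K] assms by blast
  have "V \<lhd> G\<lparr>carrier := K\<rparr>"
  proof (rule K.normal_invI)
    show "subgroup V (G\<lparr>carrier := K\<rparr>)" using op by (simp add: open_subgroup_of_def)
    fix g x assume g: "g \<in> carrier (G\<lparr>carrier := K\<rparr>)" and x: "x \<in> V"
    have "g \<in> H" using g osub_subset[OF K] by auto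
    then have "g \<otimes> x \<otimes> inv g \<in> conj_set G g V" using x unfolding conj_set_eq by blast
    then show "g \<otimes>\<^bsub>G\<lparr>carrier := K\<rparr>\<^esub> x \<otimes>\<^bsub>G\<lparr>carrier := K\<rparr>\<^esub> inv\<^bsub>G\<lparr>carrier := K\<rparr>\<^esub> g \<in> V"
      using hnormal_conj[OF V \<open>g \<in> H\<close>] g m_inv_consistent[OF osub_subgroup[OF K]] by simp
  qed
  then show ?thesis
    unfolding E_ur_def using op inert inertia_eq[OF osub_subset[OF K]] by auto
qed

lemma frobenius_elt_mem:
  assumes K: "osub K" "d ` K = Om.pw (k * f)" "P_number P k"
    and V: "subgroup V G" and inert: "\<And>x. x \<in> K \<Longrightarrow> d x = \<one>\<^bsub>\<Omega>\<^esub> \<Longrightarrow> x \<in> V"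
    and s: "s \<in> K" "d s = \<omega> [^]\<^bsub>\<Omega>\<^esub> (k * f)"
  shows "s \<in> frobenius_elt G \<Omega> \<omega> d K V"
proof -
  interpret K: subgroup K G using osub_subgroup[OF K(1)] .
  have kf: "P_number P (k * f)" using K P_number_f by simp
  then have kf0: "k * f > 0" using P_number_pos by blast
  \<comment> \<open>Since \<open>k * f\<close> is a \<open>P\<close>-number it is the index itself;
    for a general positive exponent the index would only be its \<open>P\<close>-part.\<close>
  have fi: "f_index \<Omega> d (carrier G) K = k * f"
    using Om.index_pw[OF kf] by (simp add: f_index_def d_surj K)
  have dn: "d_norm G \<Omega> d K x = \<omega> \<longleftrightarrow> d x = \<omega> [^]\<^bsub>\<Omega>\<^esub> (k * f)" if x: "x \<in> K" for x
  proof -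
    have "d x \<in> Om.pw (k * f)" using x K by blast
    then obtain y where y: "y \<in> carrier \<Omega>" "y [^]\<^bsub>\<Omega>\<^esub> (k * f) = d x" by (auto simp: Om.pw_def)
    have "d_norm G \<Omega> d K x = y"
      unfolding d_norm_def fi using y Om.pow_cancel[OF kf0] by (intro the_equality) auto
    then show ?thesis using y Om.pow_cancel[OF kf0 y(1) Om.omega_closed] by auto
  qed
  have "frobenius_elt G \<Omega> \<omega> d K V = V #> s"
    unfolding frobenius_elt_def
  proof (rule the_equality)
    show "\<exists>h\<in>K. d_norm G \<Omega> d K h = \<omega> \<and> V #> s = V #> h" using s dn by blast
    fix c assume "\<exists>h\<in>K. d_norm G \<Omega> d K h = \<omega> \<and> c = V #> h"
    then obtain h where h: "h \<in> K" "d h = d s" "c = V #> h" using dn s by auto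
    \<comment> \<open>Two Frobenius lifts differ by inertia of \<open>K\<close>, which
      \<open>V\<close> contains, so the coset is well defined.\<close>
    have "s \<otimes> inv h \<in> V" using h s by (intro inert) auto
    then have "s \<in> V #> h" using subgroup.rcos_module_rev[OF V is_group] h s by simp
    then show "c = V #> s" using repr_independence[of s V h] V h s by simp
  qed
  then show ?thesis using rcos_self[of s V] V s by simp
qed

lemma exact_unramified:
  assumes "osub K" "d ` K = Om.pw (k * f)" "P_number P k" "hnormal V" "V \<subseteq> K"
    and "\<And>x. x \<in> K \<Longrightarrow> d x = \<one>\<^bsub>\<Omega>\<^esub> \<Longrightarrow> x \<in> V"
    and "s \<in> K" "d s = \<omega> [^]\<^bsub>\<Omega>\<^esub> (k * f)"
  shows "FN_exact \<Omega> C v K V s"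
  using assms osub_subgroup[OF hnormal_osub[OF assms(4)]]
  by (intro exact open_subgroup_of_osub osub_H osub_subset E_ur_I frobenius_elt_mem)

lemma exact_H_Z: "j > 0 \<Longrightarrow> FN_exact \<Omega> C v H (Z j) \<phi>"
  using d_image_H phi by (intro exact_unramified[of H 1] osub_H hnormal_Z Z_subset inertial_H) auto

text \<open>As \<open>m\<close> divides \<open>j\<close>, the power \<open>\<phi> [^] j\<close> lies
  in \<open>U\<close> and is a Frobenius lift for \<open>W j\<close>. This is the layer to which
  Hilbert 90 is applied.\<close>

lemma exact_W_W:
  assumes "m dvd j" "P_number P j" "k > 0"
  shows "FN_exact \<Omega> C v (W j) (W (j * k)) (\<phi> [^] j)"
proof (rule exact_unramified[of _ j])
  have j: "j > 0" using assms P_number_pos by blast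
  show "hnormal (W (j * k))" "osub (W j)" using j assms hnormal_W hnormal_osub by auto
  show "d ` W j = Om.pw (j * f)" using d_image_W[OF assms(1)] .
  show "\<phi> [^] j \<in> W j" "d (\<phi> [^] j) = \<omega> [^]\<^bsub>\<Omega>\<^esub> (j * f)"
    using phi_pow pow_m_in_U[OF phi(1) assms(1)] Om.pow_in_pw[of \<omega> "j * f"] by (auto simp: W_def Z_def)
  show "x \<in> W (j * k)" if "x \<in> W j" "d x = \<one>\<^bsub>\<Omega>\<^esub>" for x
    using that one_in_pw by (simp add: W_def Z_def)
qed (use assms W_mono in auto)

text \<open>The Frobenius lift of \<open>S\<close> has the value belonging to \<open>P(n)\<close>,
  not to \<open>n\<close>. It is therefore obtained from the image of \<open>S\<close> under
  \<open>d\<close> and need not be the element to which \<open>S\<close> is attached.\<close>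

lemma exact_S_W:
  assumes S: "frobenius_subgroup S n" and j: "j > 0" "W j \<subseteq> S"
  shows "\<exists>s. FN_exact \<Omega> C v S (W j) s"
proof -
  let ?l = "P_part P n"
  have n: "n > 0" and dS: "d ` S = Om.pw (n * f)" and SH: "S \<subseteq> H"
    and inert: "\<And>x. x \<in> H \<Longrightarrow> d x = \<one>\<^bsub>\<Omega>\<^esub> \<Longrightarrow> x \<in> S \<longleftrightarrow> x \<in> U"
    using S by (auto simp: frobenius_subgroup_def)
  have dS': "d ` S = Om.pw (?l * f)" using dS Om.pw_P_part(2)[OF n] by simp
  then obtain s where "s \<in> S" "d s = \<omega> [^]\<^bsub>\<Omega>\<^esub> (?l * f)"
    using Om.pow_in_pw[of \<omega> "?l * f"] by (metis imageE Om.omega_closed)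
  moreover have "x \<in> W j" if "x \<in> S" "d x = \<one>\<^bsub>\<Omega>\<^esub>" for x
    using that SH inert inertial_H by (auto simp: W_def)
  ultimately show ?thesis
    using exact_unramified[OF frobenius_subgroup_osub[OF S] dS' P_number_P_part hnormal_W[OF j(1)] j(2)]
    by blast
qed

lemma e_index_one:
  assumes "osub K" "osub L" "K \<subseteq> L" and "\<And>x. x \<in> L \<Longrightarrow> d x = \<one>\<^bsub>\<Omega>\<^esub> \<Longrightarrow> x \<in> K"
  shows "e_index G \<Omega> d L K = 1"
proof -
  have "inertia G \<Omega> d L = inertia G \<Omega> d K" using assms by (auto simp: inertia_def kernel_def)
  moreover have "subgroup (inertia G \<Omega> d K) G"
    unfolding inertia_def by (intro subgroups_Inter_pair osub_subgroup assms(1) d.subgroup_kernel)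
  ultimately show ?thesis using index_self by (simp add: e_index_def)
qed

text \<open>Exactness gives injectivity on units only. But \<open>Z j\<close> contains the inertia
  of \<open>H\<close>, so restriction preserves valuations and its kernel consists of units.\<close>

lemma inj_res_H_Z:
  assumes j: "j > 0" and a: "a \<in> carrier (A H)" "b \<in> carrier (A H)" and eq: "res (Z j) H a = res (Z j) H b"
  shows "a = b"
proof -
  have osZ: "osub (Z j)" using hnormal_Z[OF j] hnormal_osub by blast
  interpret AH: comm_group "A H" using comm_group_A[OF osub_H] .
  interpret res: group_hom "A H" "A (Z j)" "res (Z j) H" using group_hom_res[OF osZ osub_H Z_subset] .
  interpret vZ: group_hom "A (Z j)" \<Omega> "v (Z j)" using group_hom_v[OF osZ] .
  interpret vH: group_hom "A H" \<Omega> "v H" using group_hom_v[OF osub_H] .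
  let ?c = "a \<otimes>\<^bsub>A H\<^esub> inv\<^bsub>A H\<^esub> b"
  have c: "?c \<in> carrier (A H)" using a by simp
  have rc: "res (Z j) H ?c = \<one>\<^bsub>A (Z j)\<^esub>" using a eq by simp
  have "v (Z j) (res (Z j) H ?c) = v H ?c [^]\<^bsub>\<Omega>\<^esub> (1::nat)"
    unfolding v_res[OF osZ osub_H Z_subset c] using e_index_one[OF osZ osub_H Z_subset] inertial_H by simp
  then have "v H ?c = \<one>\<^bsub>\<Omega>\<^esub>" unfolding rc using c by (simp del: vH.hom_mult vH.hom_inv)
  then have "?c \<in> units H" using c units_iff by blast
  then have "?c = \<one>\<^bsub>A H\<^esub>" using FN_exactD(1)[OF exact_H_Z[OF j]] rc by blast
  then show ?thesis using a by (simp add: AH.inv_solve_right')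
qed

lemma index_Z_Z:
  assumes "P_number P k" "j > 0" shows "index G (Z j) (Z (j * k)) = k"
proof -
  have "card (rcosets\<^bsub>\<Omega>\<lparr>carrier := d ` Z j\<rparr>\<^esub> (d ` Z (j * k))) =
      card (rcosets\<^bsub>G\<lparr>carrier := Z j\<rparr>\<^esub> (Z (j * k)))"
  proof (rule d.card_rcosets_image[OF subgroup_Z])
    show "subgroup (Z (j * k)) (G\<lparr>carrier := Z j\<rparr>)"
      by (intro subgroup_incl subgroup_Z Z_mono) simp
    show "kernel G \<Omega> d \<inter> Z j \<subseteq> Z (j * k)"
      using Z_subset inertial_H by (auto simp: kernel_def)
  qed
  moreover have "d ` Z (j * k) = Om.pw (k * (j * f))" by (simp add: d_image_Z mult_ac)
  ultimately show ?thesis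
    using Om.index_pw_pw[OF _ assms(1), of "j * f"] assms(2) f_pos
    by (simp add: index_def cosets_in_def d_image_Z)
qed

section \<open>The Mackey formula for norms restricted to an unramified layer\<close>

lemma double_coset_Z:
  assumes S: "frobenius_subgroup S n" and j: "m dvd j" "W j \<subseteq> S" and g: "g \<in> H"
  shows "double_coset G (Z j) S g = {x \<in> H. inv\<^bsub>\<Omega>\<^esub> d g \<otimes>\<^bsub>\<Omega>\<^esub> d x \<in> Om.pw (n * f)}"
proof -
  have dS: "d ` S = Om.pw (n * f)" and SH: "S \<subseteq> H" and subS: "subgroup S G"
    using S by (auto simp: frobenius_subgroup_def)
  interpret H: subgroup H G by (rule H(1))
  interpret S: subgroup S G by (rule subS)
  interpret pw: subgroup "Om.pw (n * f)" \<Omega> by (rule Om.subgroup_pw)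
  \<comment> \<open>Because of this inclusion the factor from \<open>Z j\<close> does not enlarge
    the double coset beyond the condition on \<open>d\<close>. Conversely, \<open>Z j\<close>
    contains all inertia of \<open>H\<close>, so the condition on \<open>d\<close> suffices.\<close>
  have sub: "Om.pw (j * f) \<subseteq> Om.pw (n * f)"
    using j dS d_image_W[OF j(1)] by (metis image_mono)
  have eq: "double_coset G (Z j) S g = {z \<otimes> g \<otimes> s |z s. z \<in> Z j \<and> s \<in> S}"
    by (auto simp: double_coset_def r_coset_def set_mult_def)
  show ?thesis unfolding eq
  proof (intro equalityI subsetI)
    fix x assume "x \<in> {z \<otimes> g \<otimes> s |z s. z \<in> Z j \<and> s \<in> S}"
    then obtain z s where z: "z \<in> Z j" "s \<in> S" "x = z \<otimes> g \<otimes> s" by blast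
    then have cl: "z \<in> H" "s \<in> H" "d z \<in> Om.pw (n * f)" "d s \<in> Om.pw (n * f)"
      using sub dS SH by (auto simp: Z_def)
    have "inv\<^bsub>\<Omega>\<^esub> d g \<otimes>\<^bsub>\<Omega>\<^esub> d x = d z \<otimes>\<^bsub>\<Omega>\<^esub> d s"
      using z cl g H_closed Om.m_comm[of "d z" "d g"] by (simp add: Om.m_assoc)
    then show "x \<in> {x \<in> H. inv\<^bsub>\<Omega>\<^esub> d g \<otimes>\<^bsub>\<Omega>\<^esub> d x \<in> Om.pw (n * f)}"
      using z cl g by simp
  next
    fix x assume "x \<in> {x \<in> H. inv\<^bsub>\<Omega>\<^esub> d g \<otimes>\<^bsub>\<Omega>\<^esub> d x \<in> Om.pw (n * f)}"
    then have x: "x \<in> H" and "inv\<^bsub>\<Omega>\<^esub> d g \<otimes>\<^bsub>\<Omega>\<^esub> d x \<in> d ` S" using dS by auto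
    then obtain s where s: "s \<in> S" "inv\<^bsub>\<Omega>\<^esub> d g \<otimes>\<^bsub>\<Omega>\<^esub> d x = d s" by blast
    have cl: "x \<in> carrier G" "g \<in> carrier G" "s \<in> carrier G" "s \<in> H" using x g s SH H_closed by auto
    let ?z = "x \<otimes> inv s \<otimes> inv g"
    have "d ?z = \<one>\<^bsub>\<Omega>\<^esub>"
      using cl s(2)[symmetric] by (simp add: Om.inv_mult_group Om.m_assoc)
    then have "?z \<in> Z j" using x g cl by (intro inertial_H) auto
    moreover have "x = ?z \<otimes> g \<otimes> s" using cl by (simp add: m_assoc)
    ultimately show "x \<in> {z \<otimes> g \<otimes> s |z s. z \<in> Z j \<and> s \<in> S}" using s by blast
  qed
qed

text \<open>Their number is \<open>P(n)\<close> because \<open>Om.pw (n * f)\<close> equals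
  \<open>Om.pw (l * f)\<close>. That they are distinct follows from \<open>Om.pw_dvd\<close>, which
  applies as \<open>l * f\<close> is a \<open>P\<close>-number.\<close>

lemma double_coset_reps_Z:
  assumes S: "frobenius_subgroup S n" and j: "m dvd j" "W j \<subseteq> S"
  defines "l \<equiv> P_part P n"
  shows "double_coset_reps G (Z j) H S ((\<lambda>i. \<phi> [^] i) ` {..<l})" "inj_on (\<lambda>i. \<phi> [^] i) {..<l}"
proof -
  have n: "n > 0" using S by (simp add: frobenius_subgroup_def)
  have lP: "P_number P l" by (simp add: l_def P_number_P_part)
  then have l0: "l > 0" by (rule P_number_pos)
  have pw: "Om.pw (n * f) = Om.pw (l * f)" unfolding l_def using Om.pw_P_part(2)[OF n] .
  interpret pw: subgroup "Om.pw (l * f)" \<Omega> by (rule Om.subgroup_pw)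
  let ?dc = "double_coset G (Z j) S"
  have dc: "?dc g = {x \<in> H. inv\<^bsub>\<Omega>\<^esub> d g \<otimes>\<^bsub>\<Omega>\<^esub> d x \<in> Om.pw (l * f)}" if "g \<in> H" for g
    using double_coset_Z[OF S j that] pw by simp
  have inj: "inj_on (\<lambda>i. ?dc (\<phi> [^] i)) {..<l}"
  proof (rule linorder_inj_onI')
    fix a b assume ab: "a \<in> {..<l}" "b \<in> {..<l}" "a < b"
    show "?dc (\<phi> [^] a) \<noteq> ?dc (\<phi> [^] b)"
    proof
      assume "?dc (\<phi> [^] a) = ?dc (\<phi> [^] b)"
      moreover have "\<phi> [^] b \<in> ?dc (\<phi> [^] b)" using phi_pow H_closed by (simp add: dc)
      ultimately have "\<phi> [^] b \<in> ?dc (\<phi> [^] a)" by simp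
      then have "inv\<^bsub>\<Omega>\<^esub> (\<omega> [^]\<^bsub>\<Omega>\<^esub> (a * f)) \<otimes>\<^bsub>\<Omega>\<^esub> \<omega> [^]\<^bsub>\<Omega>\<^esub> (b * f) \<in> Om.pw (l * f)"
        using phi_pow by (simp add: dc)
      also have "\<omega> [^]\<^bsub>\<Omega>\<^esub> (b * f) = \<omega> [^]\<^bsub>\<Omega>\<^esub> (a * f) \<otimes>\<^bsub>\<Omega>\<^esub> \<omega> [^]\<^bsub>\<Omega>\<^esub> ((b - a) * f)"
        using ab by (simp add: Om.nat_pow_mult add_mult_distrib[symmetric])
      finally have "\<omega> [^]\<^bsub>\<Omega>\<^esub> ((b - a) * f) \<in> Om.pw (l * f)" by simp
      then have "l * f dvd (b - a) * f" using lP P_number_f by (intro Om.pw_dvd) simp_all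
      then have "l dvd b - a" using f_pos by simp
      then show False using ab by (auto dest: dvd_imp_le)
    qed
  qed
  show "inj_on (\<lambda>i. \<phi> [^] i) {..<l}" using inj by (auto simp: inj_on_def)
  have surj: "?dc ` ((\<lambda>i. \<phi> [^] i) ` {..<l}) = double_cosets G (Z j) H S"
    unfolding double_cosets_def
  proof
    show "?dc ` (\<lambda>i. \<phi> [^] i) ` {..<l} \<subseteq> ?dc ` H" using phi_pow by blast
    show "?dc ` H \<subseteq> ?dc ` (\<lambda>i. \<phi> [^] i) ` {..<l}"
    proof
      fix X assume "X \<in> ?dc ` H"
      then obtain h where h: "h \<in> H" "X = ?dc h" by blast
      \<comment> \<open>Dividing by \<open>f\<close> moves the question to the cosets of
        \<open>Om.pw l\<close> in \<open>\<Omega>\<close>, where powers of \<open>\<omega>\<close>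
        represent everything; taking \<open>f\<close>-th powers moves it back.\<close>
      then obtain y where y: "y \<in> carrier \<Omega>" "d h = y [^]\<^bsub>\<Omega>\<^esub> f"
        using d_image_H by (auto simp: Om.pw_def)
      obtain a where a: "a < l" "inv\<^bsub>\<Omega>\<^esub> (\<omega> [^]\<^bsub>\<Omega>\<^esub> a) \<otimes>\<^bsub>\<Omega>\<^esub> y \<in> Om.pw l"
        using Om.pw_coset_decomp[OF l0 y(1)] by blast
      then obtain z where z: "z \<in> carrier \<Omega>" "inv\<^bsub>\<Omega>\<^esub> (\<omega> [^]\<^bsub>\<Omega>\<^esub> a) \<otimes>\<^bsub>\<Omega>\<^esub> y = z [^]\<^bsub>\<Omega>\<^esub> l"
        by (auto simp: Om.pw_def)
      have "(inv\<^bsub>\<Omega>\<^esub> (\<omega> [^]\<^bsub>\<Omega>\<^esub> a) \<otimes>\<^bsub>\<Omega>\<^esub> y) [^]\<^bsub>\<Omega>\<^esub> f = inv\<^bsub>\<Omega>\<^esub> d (\<phi> [^] a) \<otimes>\<^bsub>\<Omega>\<^esub> d h"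
        using y by (simp add: phi_pow Om.nat_pow_distrib Om.nat_pow_inv Om.nat_pow_pow)
      then have q: "inv\<^bsub>\<Omega>\<^esub> d (\<phi> [^] a) \<otimes>\<^bsub>\<Omega>\<^esub> d h \<in> Om.pw (l * f)" (is "?q \<in> _")
        using z Om.pow_in_pw[OF z(1), of "l * f"] by (simp add: Om.nat_pow_pow)
      have cl: "d (\<phi> [^] a) \<in> carrier \<Omega>" "d h \<in> carrier \<Omega>" using phi_pow h H_closed by auto
      have "?dc (\<phi> [^] a) = ?dc h"
        unfolding dc[OF phi_pow(1)] dc[OF h(1)]
      proof (intro Collect_cong conj_cong refl)
        fix x assume "x \<in> H"
        then have x: "d x \<in> carrier \<Omega>" using H_closed by simp
        have e: "inv\<^bsub>\<Omega>\<^esub> d (\<phi> [^] a) \<otimes>\<^bsub>\<Omega>\<^esub> d x = ?q \<otimes>\<^bsub>\<Omega>\<^esub> (inv\<^bsub>\<Omega>\<^esub> d h \<otimes>\<^bsub>\<Omega>\<^esub> d x)"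
          using x cl by (simp add: Om.m_assoc)
        have e': "inv\<^bsub>\<Omega>\<^esub> d h \<otimes>\<^bsub>\<Omega>\<^esub> d x = inv\<^bsub>\<Omega>\<^esub> ?q \<otimes>\<^bsub>\<Omega>\<^esub> (inv\<^bsub>\<Omega>\<^esub> d (\<phi> [^] a) \<otimes>\<^bsub>\<Omega>\<^esub> d x)"
          using x cl by (simp add: Om.m_assoc Om.inv_mult_group)
        show "inv\<^bsub>\<Omega>\<^esub> d (\<phi> [^] a) \<otimes>\<^bsub>\<Omega>\<^esub> d x \<in> Om.pw (l * f) \<longleftrightarrow> inv\<^bsub>\<Omega>\<^esub> d h \<otimes>\<^bsub>\<Omega>\<^esub> d x \<in> Om.pw (l * f)"
          using e e' q pw.m_closed pw.m_inv_closed by metis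
      qed
      then show "X \<in> ?dc ` (\<lambda>i. \<phi> [^] i) ` {..<l}" using h a by blast
    qed
  qed
  have "inj_on ?dc ((\<lambda>i. \<phi> [^] i) ` {..<l})" using inj by (auto simp: inj_on_def)
  then show "double_coset_reps G (Z j) H S ((\<lambda>i. \<phi> [^] i) ` {..<l})"
    unfolding double_coset_reps_def bij_betw_def using surj phi_pow(1) by blast
qed

text \<open>The image under \<open>d\<close> of an element of the intersection is already attained
  on \<open>W j\<close>. The two elements differ by inertia of \<open>S\<close>, which is inertia of
  \<open>U\<close>.\<close>

lemma Z_Int_frobenius_subgroup:
  assumes S: "frobenius_subgroup S n" and j: "m dvd j" "W j \<subseteq> S"
  shows "Z j \<inter> S = W j"
proof
  have subS: "subgroup S G" and inert: "\<And>x. x \<in> H \<Longrightarrow> d x = \<one>\<^bsub>\<Omega>\<^esub> \<Longrightarrow> x \<in> S \<longleftrightarrow> x \<in> U"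
    using S by (auto simp: frobenius_subgroup_def)
  show "W j \<subseteq> Z j \<inter> S" using j W_subset by blast
  show "Z j \<inter> S \<subseteq> W j"
  proof
    fix x assume x: "x \<in> Z j \<inter> S"
    then have "d x \<in> d ` W j" using d_image_W[OF j(1)] by (auto simp: Z_def)
    then obtain w where w: "w \<in> W j" "d x = d w" by blast
    then have wU: "w \<in> U" and wS: "w \<in> S" and wH: "w \<in> H" and xH: "x \<in> H"
      using j(2) W_subset(1,3)[of j] x Z_subset[of j] by blast+
    have cl: "x \<in> carrier G" "w \<in> carrier G" using wH xH H_closed by auto
    let ?y = "x \<otimes> inv w"
    have "?y \<in> S" using x wS subS by (simp add: subgroup.m_closed subgroup.m_inv_closed)
    moreover have "?y \<in> H" using xH wH H(1) by (simp add: subgroup.m_closed subgroup.m_inv_closed)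
    moreover have "d ?y = \<one>\<^bsub>\<Omega>\<^esub>" using cl w by simp
    ultimately have "?y \<in> U" using inert by blast
    then have "?y \<otimes> w \<in> U" using wU subgroup_U subgroup.m_closed by fast
    then show "x \<in> W j" using x cl by (simp add: m_assoc W_def)
  qed
qed

text \<open>Since \<open>Z j\<close> and \<open>W j\<close> are normal in \<open>H\<close>, the
  intersections in the Mackey formula are all equal to \<open>W j\<close>. So the factors are the
  conjugates, by powers of \<open>\<phi>\<close>, of a single norm from \<open>W j\<close>.\<close>

lemma res_ind:
  assumes S: "frobenius_subgroup S n" and j: "m dvd j" "j > 0" "W j \<subseteq> S" and a: "a \<in> carrier (A S)"
  shows "res (Z j) H (ind H S a) = tr (Z j) (P_part P n) (ind (Z j) (W j) (res (W j) S a))"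
proof -
  let ?l = "P_part P n" and ?Z = "Z j" and ?W = "W j"
  let ?R = "(\<lambda>i. \<phi> [^] i) ` {..<?l}"
  let ?N = "ind ?Z ?W (res ?W S a)"
  have hZ: "hnormal ?Z" and hW: "hnormal ?W" using j hnormal_Z hnormal_W by auto
  have oS: "osub S" using S frobenius_subgroup_osub by blast
  have oZ: "osub ?Z" and oW: "osub ?W" using hZ hW hnormal_osub by auto
  have b: "res ?W S a \<in> carrier (A ?W)" using hom_closed_A(1)[OF oW oS j(3) a] .
  have N: "?N \<in> carrier (A ?Z)" using hom_closed_A(2)[OF oW oZ W_subset(2) b] .
  interpret AZ: comm_group "A ?Z" using comm_group_A[OF oZ] .
  have summand: "ind ?Z (?Z \<inter> conj_set G h S) (con h (conj_set G (inv h) ?Z \<inter> S)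
      (res (conj_set G (inv h) ?Z \<inter> S) S a)) = con h ?Z ?N" if h: "h \<in> H" for h
  proof -
    have ih: "inv h \<in> H" using h H(1) subgroup.m_inv_closed by fast
    have hG: "h \<in> carrier G" using h H_closed by blast
    have 1: "conj_set G (inv h) ?Z \<inter> S = ?W"
      using hnormal_conj[OF hZ ih] Z_Int_frobenius_subgroup[OF S j(1,3)] by simp
    have inj: "inj_on (\<lambda>x. h \<otimes> x \<otimes> inv h) (carrier G)"
      using hG by (intro inj_onI) simp
    have "?Z \<inter> conj_set G h S = conj_set G h ?Z \<inter> conj_set G h S" using hnormal_conj[OF hZ h] by simp
    also have "\<dots> = conj_set G h (?Z \<inter> S)"
      unfolding conj_set_eq
      by (rule inj_on_image_Int[OF inj, symmetric]) (use oZ oS osub_subset H_closed in blast)+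
    also have "\<dots> = ?W" using hnormal_conj[OF hW h] Z_Int_frobenius_subgroup[OF S j(1,3)] by simp
    finally have 2: "?Z \<inter> conj_set G h S = ?W" .
    show ?thesis unfolding 1 2 using con_ind[OF hW hZ W_subset(2) h b] by simp
  qed
  have "res ?Z H (ind H S a) = (\<Otimes>\<^bsub>A ?Z\<^esub>h\<in>?R. (let K = conj_set G (inv h) ?Z \<inter> S
      in ind ?Z (?Z \<inter> conj_set G h S) (con h K (res K S a))))"
    using Mackey H_Base osub_Res_Ind(1)[OF oZ osub_H Z_subset] osub_Res_Ind(2)[OF oS osub_H osub_subset[OF oS]]
      double_coset_reps_Z(1)[OF S j(1,3)] a
    by (simp add: cohomological_Mackey_functor_def)
  also have "\<dots> = (\<Otimes>\<^bsub>A ?Z\<^esub>h\<in>?R. con h ?Z ?N)"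
    using summand phi_pow(1) con_closed[OF hZ phi_pow(1) N]
    by (intro AZ.finprod_cong') (auto simp: Let_def)
  also have "\<dots> = (\<Otimes>\<^bsub>A ?Z\<^esub>i\<in>{..<?l}. con (\<phi> [^] i) ?Z ?N)"
    using con_closed[OF hZ phi_pow(1) N]
    by (intro AZ.finprod_reindex double_coset_reps_Z(2)[OF S j(1,3)]) auto
  also have "\<dots> = tr ?Z ?l ?N" using tr_finprod[OF hZ N] by simp
  finally show ?thesis .
qed

text \<open>The norm from \<open>W j\<close> is fixed by the \<open>P(n)\<close>-th power of
  \<open>\<phi>\<close>, so the trace of length \<open>n\<close> is the \<open>P'(n)\<close>-th
  power of the one of length \<open>P(n)\<close>.\<close>

lemma res_ind_pow:
  assumes S: "frobenius_subgroup S n" and j: "m dvd j" "j > 0" "W j \<subseteq> S" and a: "a \<in> carrier (A S)"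
  shows "res (Z j) H (ind H S a [^]\<^bsub>A H\<^esub> P_part_compl P n) =
    tr (Z j) n (ind (Z j) (W j) (res (W j) S a))"
proof -
  let ?l = "P_part P n" and ?Z = "Z j" and ?W = "W j"
  let ?N = "ind ?Z ?W (res ?W S a)"
  have hZ: "hnormal ?Z" and hW: "hnormal ?W" using j hnormal_Z hnormal_W by auto
  have oS: "osub S" using S frobenius_subgroup_osub by blast
  have oZ: "osub ?Z" and oW: "osub ?W" using hZ hW hnormal_osub by auto
  have n: "n > 0" and dS: "d ` S = Om.pw (n * f)" and SH: "S \<subseteq> H"
    using S by (auto simp: frobenius_subgroup_def)
  have b: "res ?W S a \<in> carrier (A ?W)" using hom_closed_A(1)[OF oW oS j(3) a] .
  have N: "?N \<in> carrier (A ?Z)" using hom_closed_A(2)[OF oW oZ W_subset(2) b] .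
  interpret res: group_hom "A H" "A ?Z" "res ?Z H" using group_hom_res[OF oZ osub_H Z_subset] .
  interpret H: subgroup H G by (rule H(1))
  \<comment> \<open>Write \<open>\<phi> [^] ?l\<close> as an inertia element times some
    \<open>s\<close> in \<open>S\<close>. The former acts trivially on \<open>A ?Z\<close>, the
    latter on anything coming from a restriction from \<open>S\<close>.\<close>
  have "d (\<phi> [^] ?l) \<in> d ` S"
    using dS Om.pw_P_part(2)[OF n] phi_pow Om.pow_in_pw[of \<omega> "?l * f"] by simp
  then obtain s where s: "s \<in> S" "d (\<phi> [^] ?l) = d s" by blast
  then have sH: "s \<in> H" using SH by blast
  let ?t = "\<phi> [^] ?l \<otimes> inv s"
  have t: "?t \<in> H" "d ?t = \<one>\<^bsub>\<Omega>\<^esub>" using sH s phi_pow(1) H_closed by simp_all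
  have Ns: "con s ?Z ?N = ?N"
    using con_ind[OF hW hZ W_subset(2) sH b] con_res_normalizer[OF oS hW j(3) s(1) a] by simp
  have "con (\<phi> [^] ?l) ?Z ?N = con ?t ?Z (con s ?Z ?N)"
    using con_con[OF hZ sH t(1) N] sH H_closed phi_pow(1) by (simp add: m_assoc)
  also have "\<dots> = ?N" using Ns con_trivial[OF oZ inertial_H[OF t] N] by simp
  finally have "tr ?Z (P_part_compl P n * ?l) ?N = tr ?Z ?l ?N [^]\<^bsub>A ?Z\<^esub> P_part_compl P n"
    by (rule tr_mult_fixed[OF hZ N])
  moreover have "ind H S a \<in> carrier (A H)" using hom_closed_A(2)[OF oS osub_H SH a] .
  ultimately show ?thesis
    using res_ind[OF S j a] P_part_mult[OF n, of P] by (simp add: res.hom_nat_pow)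
qed

section \<open>Inertia acting on units, and Hilbert 90\<close>

lemma res_self: "osub K \<Longrightarrow> a \<in> carrier (A K) \<Longrightarrow> res K K a = a"
  using ric_functor_AbD(11)[OF ric osub_Base] .

text \<open>The augmentation ideal of the inertia group of \<open>H\<close> applied to the units of
  \<open>K\<close>. Its generators are what separates the Frobenius elements from powers of
  \<open>\<phi>\<close>.\<close>

definition augmentation :: "'g set \<Rightarrow> 'a set"
  where "augmentation K =
    generate (A K) {delta \<tau> K w |\<tau> w. \<tau> \<in> H \<and> d \<tau> = \<one>\<^bsub>\<Omega>\<^esub> \<and> w \<in> units K}"

lemma augmentation_units:
  assumes "hnormal K" shows "augmentation K \<subseteq> units K"
proof -
  interpret AK: group "A K" using group_A[OF hnormal_osub[OF assms]] .
  have "{delta \<tau> K w |\<tau> w. \<tau> \<in> H \<and> d \<tau> = \<one>\<^bsub>\<Omega>\<^esub> \<and> w \<in> units K} \<subseteq> units K"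
    using delta_units[OF assms] units_iff by blast
  then show ?thesis
    unfolding augmentation_def
    using subgroup_units[OF hnormal_osub[OF assms]] by (rule AK.generate_subgroup_incl)
qed

lemma subgroup_augmentation:
  assumes "hnormal K" shows "subgroup (augmentation K) (A K)"
proof -
  interpret AK: group "A K" using group_A[OF hnormal_osub[OF assms]] .
  have "{delta \<tau> K w |\<tau> w. \<tau> \<in> H \<and> d \<tau> = \<one>\<^bsub>\<Omega>\<^esub> \<and> w \<in> units K} \<subseteq> carrier (A K)"
    using delta_closed[OF assms] units_iff by blast
  then show ?thesis
    unfolding augmentation_def by (rule AK.generate_is_subgroup)
qed

lemma delta_ind:
  assumes "hnormal K" "hnormal L" "K \<subseteq> L" "g \<in> H" "a \<in> carrier (A K)"
  shows "ind L K (delta g K a) = delta g L (ind L K a)"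
proof -
  interpret ind: group_hom "A K" "A L" "ind L K" using assms hnormal_osub group_hom_ind by blast
  show ?thesis using assms con_ind con_closed by (simp add: delta_def)
qed

text \<open>Norms commute with conjugation, so lifting the unit \<open>w\<close> lifts the whole
  generator, with the same \<open>\<tau>\<close>.\<close>

lemma augmentation_lift:
  assumes KL: "hnormal K" "hnormal L" "K \<subseteq> L" and surj: "units L \<subseteq> ind L K ` units K"
    and x: "x \<in> augmentation L"
  shows "x \<in> ind L K ` augmentation K"
proof -
  interpret ind: group_hom "A K" "A L" "ind L K" using KL hnormal_osub group_hom_ind by blast
  interpret J: subgroup "augmentation K" "A K" using subgroup_augmentation[OF KL(1)] .
  have "subgroup (ind L K ` augmentation K) (A L)"
    using ind.subgroup_img_is_subgroup[OF J.subgroup_axioms] .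
  moreover have "{delta \<tau> L w |\<tau> w. \<tau> \<in> H \<and> d \<tau> = \<one>\<^bsub>\<Omega>\<^esub> \<and> w \<in> units L} \<subseteq> ind L K ` augmentation K"
  proof clarify
    fix \<tau> w assume t: "\<tau> \<in> H" "d \<tau> = \<one>\<^bsub>\<Omega>\<^esub>" and w: "w \<in> units L"
    then obtain w' where w': "w' \<in> units K" "w = ind L K w'" using surj by blast
    then have "delta \<tau> K w' \<in> augmentation K"
      unfolding augmentation_def using t by (blast intro: generate.incl)
    moreover have "delta \<tau> L w = ind L K (delta \<tau> K w')"
      using delta_ind[OF KL t(1)] w' units_iff by simp
    ultimately show "delta \<tau> L w \<in> ind L K ` augmentation K" by blast
  qed
  ultimately show ?thesis
    using x unfolding augmentation_def[of L] by (meson ind.H.generate_subgroup_incl subsetD)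
qed

text \<open>The elements \<open>\<tau>\<close> belong to \<open>Z j\<close> and so act trivially on
  \<open>A (Z j)\<close>.\<close>

lemma ind_augmentation:
  assumes "hnormal K" "hnormal (Z j)" "K \<subseteq> Z j" and x: "x \<in> augmentation K"
  shows "ind (Z j) K x = \<one>\<^bsub>A (Z j)\<^esub>"
proof -
  interpret ind: group_hom "A K" "A (Z j)" "ind (Z j) K" using assms hnormal_osub group_hom_ind by blast
  have "subgroup (kernel (A K) (A (Z j)) (ind (Z j) K)) (A K)" by (rule ind.subgroup_kernel)
  moreover have "{delta \<tau> K w |\<tau> w. \<tau> \<in> H \<and> d \<tau> = \<one>\<^bsub>\<Omega>\<^esub> \<and> w \<in> units K}
      \<subseteq> kernel (A K) (A (Z j)) (ind (Z j) K)"
  proof clarify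
    fix \<tau> w assume t: "\<tau> \<in> H" "d \<tau> = \<one>\<^bsub>\<Omega>\<^esub>" and w: "w \<in> units K"
    then have w': "w \<in> carrier (A K)" by (simp add: units_iff)
    have "delta \<tau> (Z j) (ind (Z j) K w) = \<one>\<^bsub>A (Z j)\<^esub>"
      using con_trivial[OF hnormal_osub[OF assms(2)] inertial_H[OF t]] w' by (simp add: delta_def)
    then show "delta \<tau> K w \<in> kernel (A K) (A (Z j)) (ind (Z j) K)"
      using delta_ind[OF assms(1-3) t(1) w'] delta_closed[OF assms(1) t(1) w'] by (simp add: kernel_def)
  qed
  ultimately have "augmentation K \<subseteq> kernel (A K) (A (Z j)) (ind (Z j) K)"
    unfolding augmentation_def by (rule ind.G.generate_subgroup_incl[rotated])
  then show ?thesis using x by (auto simp: kernel_def)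
qed

lemma con_phi_tr:
  assumes "hnormal K" "a \<in> carrier (A K)"
  shows "con (\<phi> [^] (n::nat)) K (tr K k a) = tr K k (con (\<phi> [^] n) K a)"
proof -
  interpret con: group_hom "A K" "A K" "con (\<phi> [^] n) K" using assms(1) phi_pow(1) by (rule group_hom_con)
  have com: "con (\<phi> [^] n) K (con (\<phi> [^] i) K a) = con (\<phi> [^] i) K (con (\<phi> [^] n) K a)" for i :: nat
    using con_con[OF assms(1) phi_pow(1) phi_pow(1) assms(2)] phi H_closed
    by (simp add: nat_pow_mult add.commute)
  show ?thesis
    using com tr_closed[OF assms] con_closed[OF assms(1) phi_pow(1) assms(2)] by (induction k) simp_all
qed

lemma v_tr:
  assumes "hnormal K" "a \<in> carrier (A K)"
  shows "v K (tr K n a) = v K a [^]\<^bsub>\<Omega>\<^esub> n"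
proof -
  interpret v: group_hom "A K" \<Omega> "v K" using group_hom_v hnormal_osub assms by blast
  show ?thesis
    using v_con[OF assms(1) phi_pow(1) assms(2)] con_closed[OF assms(1) phi_pow(1) assms(2)] tr_closed[OF assms]
    by (induction n) auto
qed

text \<open>The unit \<open>u\<close> is lifted along the unramified extension \<open>W (j * m)\<close> of \<open>W j\<close>, where
  Hilbert 90 holds for \<open>\<phi>\<^sup>j\<close>; the degree \<open>m\<close> of the extension makes the correction term \<open>c\<close> a norm.\<close>

lemma ind_unit_is_norm:
  assumes j: "m dvd j" "P_number P j" and u: "u \<in> units (W j)"
    and delta: "delta \<phi> (W j) u \<in> augmentation (W j)"
  shows "\<exists>w\<in>carrier (A U). ind (Z j) (W j) u = res (Z j) H (ind H U w)"
proof -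
  have j0: "j > 0" using j P_number_pos by blast
  define W' where "W' = W (j * m)"
  define Z' where "Z' = Z (j * m)"
  have hn: "hnormal (W j)" "hnormal (Z j)" "hnormal W'" "hnormal Z'"
    using j0 m_pos hnormal_W hnormal_Z by (auto simp: W'_def Z'_def)
  then have os: "osub (W j)" "osub (Z j)" "osub W'" "osub Z'" using hnormal_osub by auto
  have sub: "W' \<subseteq> W j" "Z' \<subseteq> Z j" "W' \<subseteq> Z'" "W j \<subseteq> Z j" "W' \<subseteq> Z j" "Z j \<subseteq> H" "Z' \<subseteq> H" "W j \<subseteq> U"
      "W j \<subseteq> H"
    unfolding W'_def Z'_def using W_mono[OF dvd_triv_left, of j m] Z_mono[OF dvd_triv_left, of j m]
      W_subset[of j] W_subset[of "j * m"] Z_subset[of j] Z_subset[of "j * m"] by blast+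
  have EW: "FN_exact \<Omega> C v (W j) W' (\<phi> [^] j)"
    unfolding W'_def using j m_pos by (rule exact_W_W)
  have EZ: "FN_exact \<Omega> C v H Z' \<phi>"
    unfolding Z'_def using j0 m_pos by (intro exact_H_Z) simp
  interpret AW': comm_group "A W'" using comm_group_A[OF os(3)] .
  interpret AZ: comm_group "A (Z j)" using comm_group_A[OF os(2)] .
  interpret i1: group_hom "A W'" "A (W j)" "ind (W j) W'" using group_hom_ind[OF os(3,1) sub(1)] .
  interpret i2: group_hom "A W'" "A Z'" "ind Z' W'" using group_hom_ind[OF os(3,4) sub(3)] .
  interpret i3: group_hom "A (W j)" "A (Z j)" "ind (Z j) (W j)" using group_hom_ind[OF os(1,2) sub(4)] .
  interpret del: group_hom "A W'" "A W'" "delta \<phi> W'" using group_hom_delta[OF hn(3) phi(1)] .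
  interpret r: group_hom "A H" "A (Z j)" "res (Z j) H" using group_hom_res[OF os(2) osub_H sub(6)] .
  interpret iU: group_hom "A U" "A H" "ind H U" using group_hom_ind[OF osub_U osub_H U_subset] .
  have surj: "units (W j) \<subseteq> ind (W j) W' ` units W'" using FN_exactD(4)[OF EW] .
  obtain u' where u': "u' \<in> units W'" "u = ind (W j) W' u'" using surj u by blast
  obtain x' where x': "x' \<in> augmentation W'" "delta \<phi> (W j) u = ind (W j) W' x'"
    using augmentation_lift[OF hn(3,1) sub(1) surj delta] by blast
  have u'c: "u' \<in> carrier (A W')" and x'c: "x' \<in> carrier (A W')" and x'u: "x' \<in> units W'"
    using u' x' augmentation_units[OF hn(3)] by (auto simp: units_iff)
  \<comment> \<open>The defect of the lifted relation. Its norm to \<open>W j\<close> is trivial, so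
    Hilbert 90 for \<open>\<phi> [^] j\<close> applies.\<close>
  define t where "t = delta \<phi> W' u' \<otimes>\<^bsub>A W'\<^esub> inv\<^bsub>A W'\<^esub> x'"
  have "t \<in> units W'"
    unfolding t_def using delta_units[OF hn(3) phi(1) u'c] x'u subgroup_units[OF os(3)]
    by (simp add: subgroup.m_closed subgroup.m_inv_closed)
  moreover have "ind (W j) W' t = \<one>\<^bsub>A (W j)\<^esub>"
    unfolding t_def using u'(2) x'(2) u'c x'c del.hom_closed delta_ind[OF hn(3,1) sub(1) phi(1) u'c]
    by simp
  ultimately obtain y where y: "y \<in> units W'" "t = delta (\<phi> [^] j) W' y"
    using FN_exactD(3)[OF EW] unfolding delta_def by blast
  then have yc: "y \<in> carrier (A W')" by (simp add: units_iff)
  \<comment> \<open>By telescoping, the operator for \<open>\<phi> [^] j\<close> is the one for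
    \<open>\<phi>\<close> after a trace of length \<open>j\<close>. So dividing \<open>u'\<close> by
    this trace turns the relation into an exact one upstairs.\<close>
  have ty: "t = delta \<phi> W' (tr W' j y)" using y delta_tr[OF hn(3) yc] by simp
  define q where "q = u' \<otimes>\<^bsub>A W'\<^esub> inv\<^bsub>A W'\<^esub> tr W' j y"
  have trc: "tr W' j y \<in> carrier (A W')" using tr_closed[OF hn(3) yc] .
  have qc: "q \<in> carrier (A W')" unfolding q_def using u'c trc by simp
  have "delta \<phi> W' q = delta \<phi> W' u' \<otimes>\<^bsub>A W'\<^esub> inv\<^bsub>A W'\<^esub> t"
    unfolding q_def ty using u'c trc by simp
  also have "\<dots> = x'"
    unfolding t_def using u'c x'c del.hom_closed by (simp add: AW'.inv_mult_group AW'.m_ac)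
  finally have dq: "delta \<phi> W' q = x'" .
  \<comment> \<open>In \<open>Z'\<close> the augmentation term vanishes, so \<open>p\<close> is
    fixed by \<open>\<phi>\<close> and comes from a unit of \<open>H\<close>.\<close>
  define p where "p = ind Z' W' q"
  have "tr W' j y \<in> units W'"
    using y(1) trc v_tr[OF hn(3) yc] by (simp add: units_iff)
  then have qu: "q \<in> units W'"
    unfolding q_def using u'(1) subgroup_units[OF os(3)]
    by (simp add: subgroup.m_closed subgroup.m_inv_closed)
  then have pu: "p \<in> units Z'" unfolding p_def using units_ind[OF os(3,4) sub(3)] by blast
  have "delta \<phi> Z' p = ind Z' W' x'"
    unfolding p_def dq[symmetric] using delta_ind[OF hn(3,4) sub(3) phi(1) qc] by simp
  also have "\<dots> = \<one>\<^bsub>A Z'\<^esub>"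
    using ind_augmentation[OF hn(3) _ _ x'(1)] hn(4) sub(3) unfolding Z'_def by blast
  finally have "con \<phi> Z' p \<otimes>\<^bsub>A Z'\<^esub> inv\<^bsub>A Z'\<^esub> p = \<one>\<^bsub>A Z'\<^esub>" by (simp add: delta_def)
  then obtain c where c: "c \<in> units H" "p = res Z' H c" using FN_exactD(2)[OF EZ pu] by blast
  then have cc: "c \<in> carrier (A H)" by (simp add: units_iff)
  define y1 where "y1 = ind (W j) W' y"
  have y1c: "y1 \<in> carrier (A (W j))" unfolding y1_def using yc by simp
  have "ind (Z j) Z' p = ind (Z j) (W j) (ind (W j) W' q)"
    unfolding p_def using ind_ind os sub qc by simp
  also have "ind (W j) W' q = u \<otimes>\<^bsub>A (W j)\<^esub> inv\<^bsub>A (W j)\<^esub> tr (W j) j y1"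
    unfolding q_def y1_def u'(2) tr_ind[OF hn(3,1) sub(1) yc] using u'c trc by simp
  finally have 1: "ind (Z j) Z' p = ind (Z j) (W j) u \<otimes>\<^bsub>A (Z j)\<^esub>
      inv\<^bsub>A (Z j)\<^esub> tr (Z j) j (ind (Z j) (W j) y1)"
    using u y1c tr_closed[OF hn(1) y1c] tr_ind[OF hn(1,2) sub(4) y1c] by (simp add: units_iff)
  \<comment> \<open>The layer was given degree \<open>m\<close> for this step: norming down yields
    an \<open>m\<close>-th power, and \<open>m = [H:U]\<close> makes it a norm from
    \<open>U\<close>.\<close>
  have "ind (Z j) Z' p = ind (Z j) Z' (res Z' (Z j) (res (Z j) H c))"
    using c(2) res_res[OF os(4,2) osub_H sub(2,6) cc] by simp
  also have "\<dots> = res (Z j) H c [^]\<^bsub>A (Z j)\<^esub> m"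
    using ind_res[OF os(4,2) sub(2)] index_Z_Z[OF P_number_m j0] r.hom_closed[OF cc] by (simp add: Z'_def)
  also have "\<dots> = res (Z j) H (c [^]\<^bsub>A H\<^esub> m)" using cc by (simp add: r.hom_nat_pow)
  also have "c [^]\<^bsub>A H\<^esub> m = ind H U (res U H c)"
    unfolding m_def using ind_res[OF osub_U osub_H U_subset cc] by simp
  finally have 2: "ind (Z j) Z' p = res (Z j) H (ind H U (res U H c))" .
  \<comment> \<open>For \<open>S = W j\<close> and \<open>n = j\<close> the exponent
    \<open>P'(j)\<close> is 1. So the trace left over from the correction is the restriction of a
    norm from \<open>W j\<close>, which factors through \<open>U\<close>.\<close>
  have fW: "frobenius_subgroup (W j) j" using frobenius_subgroup_W j j0 by blast
  have "tr (Z j) j (ind (Z j) (W j) y1) = res (Z j) H (ind H (W j) y1)"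
    using res_ind_pow[OF fW j(1) j0 _ y1c] P_part_compl_P_number[OF j(2)] res_self[OF os(1) y1c]
      hom_closed_A(2)[OF os(1) osub_H sub(9) y1c] by simp
  also have "ind H (W j) y1 = ind H U (ind U (W j) y1)"
    using ind_ind[OF os(1) osub_U osub_H sub(8) U_subset y1c] by simp
  finally have 3: "tr (Z j) j (ind (Z j) (W j) y1) = res (Z j) H (ind H U (ind U (W j) y1))" .
  let ?a = "res U H c" and ?b = "ind U (W j) y1"
  have ab: "?a \<in> carrier (A U)" "?b \<in> carrier (A U)"
    using hom_closed_A(1)[OF osub_U osub_H U_subset cc] hom_closed_A(2)[OF os(1) osub_U sub(8) y1c] by auto
  have "ind (Z j) (W j) u = ind (Z j) Z' p \<otimes>\<^bsub>A (Z j)\<^esub> tr (Z j) j (ind (Z j) (W j) y1)"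
    unfolding 1 using u y1c tr_closed[OF hn(2)] by (simp add: units_iff AZ.m_assoc)
  also have "\<dots> = res (Z j) H (ind H U (?a \<otimes>\<^bsub>A U\<^esub> ?b))"
    unfolding 2 3 using ab by simp
  finally show ?thesis by (intro bexI[OF _ iU.G.m_closed[OF ab]])
qed

section \<open>Multiplicativity and independence for elements of \<open>A H\<close>\<close>

lemma norm_relation:
  assumes j: "m dvd j" "P_number P j"
    and S1: "frobenius_subgroup S1 n1" "W j \<subseteq> S1" "h1 \<in> S1" "d h1 = \<omega> [^]\<^bsub>\<Omega>\<^esub> (n1 * f)"
    and S2: "frobenius_subgroup S2 n2" "W j \<subseteq> S2" "h2 \<in> S2" "d h2 = \<omega> [^]\<^bsub>\<Omega>\<^esub> (n2 * f)"
    and S3: "frobenius_subgroup S3 (n1 + n2)" "W j \<subseteq> S3" "h1 \<otimes> h2 \<in> S3"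
    and p1: "prime_element C v \<omega> S1 \<pi>1" and p2: "prime_element C v \<omega> S2 \<pi>2"
    and p3: "prime_element C v \<omega> S3 \<pi>3"
  shows "\<exists>w\<in>carrier (A U). ind H S1 \<pi>1 [^]\<^bsub>A H\<^esub> P_part_compl P n1 \<otimes>\<^bsub>A H\<^esub>
      ind H S2 \<pi>2 [^]\<^bsub>A H\<^esub> P_part_compl P n2 =
    ind H U w \<otimes>\<^bsub>A H\<^esub> ind H S3 \<pi>3 [^]\<^bsub>A H\<^esub> P_part_compl P (n1 + n2)"
proof -
  have j0: "j > 0" using j P_number_pos by blast
  let ?W = "W j" and ?Z = "Z j"
  let ?n3 = "n1 + n2"
  have hW: "hnormal ?W" and hZ: "hnormal ?Z" using j0 hnormal_W hnormal_Z by auto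
  then have oW: "osub ?W" and oZ: "osub ?Z" using hnormal_osub by auto
  have oS: "osub S1" "osub S2" "osub S3" using S1 S2 S3 frobenius_subgroup_osub by auto
  have WS: "?W \<subseteq> S1" "?W \<subseteq> S2" "?W \<subseteq> S3" using S1 S2 S3 by auto
  note WZ = W_subset(2)[of j] and ZH = Z_subset[of j]
  have pc: "\<pi>1 \<in> carrier (A S1)" "\<pi>2 \<in> carrier (A S2)" "\<pi>3 \<in> carrier (A S3)"
    and vp: "v S1 \<pi>1 = \<omega>" "v S2 \<pi>2 = \<omega>" "v S3 \<pi>3 = \<omega>"
    using p1 p2 p3 by (auto simp: prime_element_def)
  interpret AH: comm_group "A H" using comm_group_A[OF osub_H] .
  interpret AZ: comm_group "A ?Z" using comm_group_A[OF oZ] .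
  interpret AW: comm_group "A ?W" using comm_group_A[OF oW] .
  interpret N: group_hom "A ?W" "A ?Z" "ind ?Z ?W" using group_hom_ind[OF oW oZ WZ] .
  interpret r: group_hom "A H" "A ?Z" "res ?Z H" using group_hom_res[OF oZ osub_H ZH] .
  interpret vW: group_hom "A ?W" \<Omega> "v ?W" using group_hom_v[OF oW] .
  interpret iU: group_hom "A U" "A H" "ind H U" using group_hom_ind[OF osub_U osub_H U_subset] .
  define x1 x2 x3 where "x1 = res ?W S1 \<pi>1" and "x2 = res ?W S2 \<pi>2" and "x3 = res ?W S3 \<pi>3"
  define y1 y2 y3 where "y1 = ind H S1 \<pi>1 [^]\<^bsub>A H\<^esub> P_part_compl P n1"
    and "y2 = ind H S2 \<pi>2 [^]\<^bsub>A H\<^esub> P_part_compl P n2"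
    and "y3 = ind H S3 \<pi>3 [^]\<^bsub>A H\<^esub> P_part_compl P ?n3"
  have yc: "y1 \<in> carrier (A H)" "y2 \<in> carrier (A H)" "y3 \<in> carrier (A H)"
    unfolding y1_def y2_def y3_def using hom_closed_A(2)[OF _ osub_H osub_subset] oS pc by auto
  have xc: "x1 \<in> carrier (A ?W)" "x2 \<in> carrier (A ?W)" "x3 \<in> carrier (A ?W)"
    unfolding x1_def x2_def x3_def using hom_closed_A(1)[OF oW] oS WS pc by auto
  have v_prime: "v ?W (res ?W S a) = \<omega>"
    if S: "frobenius_subgroup S n" "?W \<subseteq> S" and a: "a \<in> carrier (A S)" "v S a = \<omega>" for S n a
  proof -
    have "e_index G \<Omega> d S ?W = 1"
    proof (rule e_index_one[OF oW frobenius_subgroup_osub[OF S(1)] S(2)])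
      fix x assume "x \<in> S" "d x = \<one>\<^bsub>\<Omega>\<^esub>"
      then show "x \<in> ?W" using S(1) inertial_H by (auto simp: frobenius_subgroup_def W_def)
    qed
    then show ?thesis using v_res[OF oW frobenius_subgroup_osub[OF S(1)] S(2) a(1)] a(2) by simp
  qed
  have vx: "v ?W x1 = \<omega>" "v ?W x2 = \<omega>" "v ?W x3 = \<omega>"
    unfolding x1_def x2_def x3_def using v_prime S1 S2 S3 pc vp by blast+
  have ry: "res ?Z H y1 = tr ?Z n1 (ind ?Z ?W x1)" "res ?Z H y2 = tr ?Z n2 (ind ?Z ?W x2)"
      "res ?Z H y3 = tr ?Z ?n3 (ind ?Z ?W x3)"
    unfolding y1_def y2_def y3_def x1_def x2_def x3_def
    using res_ind_pow[OF S1(1) j(1) j0 S1(2) pc(1)] res_ind_pow[OF S2(1) j(1) j0 S2(2) pc(2)]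
      res_ind_pow[OF S3(1) j(1) j0 S3(2) pc(3)] by auto
  have hH: "h1 \<in> H" "h2 \<in> H" using S1 S2 oS osub_subset by auto
  then have hG: "h1 \<in> carrier G" "h2 \<in> carrier G" "\<phi> \<in> carrier G" using H_closed phi by auto
  interpret H: subgroup H G by (rule H(1))
  \<comment> \<open>Both measure how a Frobenius element deviates from a power of
    \<open>\<phi>\<close>. They are arranged so that the product of \<open>\<tau>4\<close> and
    \<open>\<tau>1\<close> is the deviation of \<open>h1 \<otimes> h2\<close>.\<close>
  define \<tau>1 where "\<tau>1 = \<phi> [^] n1 \<otimes> inv h1"
  define \<tau>4 where "\<tau>4 = \<phi> [^] ?n3 \<otimes> inv h2 \<otimes> inv (\<phi> [^] n1)"
  have tH: "\<tau>1 \<in> H" "\<tau>4 \<in> H" unfolding \<tau>1_def \<tau>4_def using hH phi_pow(1) by auto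
  have dt: "d \<tau>1 = \<one>\<^bsub>\<Omega>\<^esub>" "d \<tau>4 = \<one>\<^bsub>\<Omega>\<^esub>"
  proof -
    show "d \<tau>1 = \<one>\<^bsub>\<Omega>\<^esub>" unfolding \<tau>1_def using hG S1(4) phi_pow(2)[of n1] by simp
    have "\<omega> [^]\<^bsub>\<Omega>\<^esub> (?n3 * f) = \<omega> [^]\<^bsub>\<Omega>\<^esub> (n1 * f) \<otimes>\<^bsub>\<Omega>\<^esub> \<omega> [^]\<^bsub>\<Omega>\<^esub> (n2 * f)"
      by (simp add: Om.nat_pow_mult add_mult_distrib)
    then show "d \<tau>4 = \<one>\<^bsub>\<Omega>\<^esub>"
      unfolding \<tau>4_def using hG S2(4) phi_pow(2)[of n1] phi_pow(2)[of ?n3] by (simp add: Om.m_assoc)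
  qed
  \<comment> \<open>Twisting \<open>x2\<close> accounts for the factor \<open>\<phi> [^] n1\<close>
    in \<open>\<tau>4\<close>. The twist is invisible in the end, since \<open>H\<close> acts
    trivially on restrictions from \<open>H\<close>.\<close>
  define x4 where "x4 = con (\<phi> [^] n1) ?W x2"
  have x4c: "x4 \<in> carrier (A ?W)" unfolding x4_def using con_closed[OF hW phi_pow(1) xc(2)] .
  have inv_fix: "con (inv h) ?W (res ?W S a) = res ?W S a"
    if "osub S" "?W \<subseteq> S" "h \<in> S" "a \<in> carrier (A S)" for S h a
    using con_res_normalizer[OF that(1) hW that(2) _ that(4)] that(3) subgroup.m_inv_closed[OF osub_subgroup[OF that(1)]]
    by blast
  have fix1: "con (\<phi> [^] n1) ?W x1 = con \<tau>1 ?W x1"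
    using inv_fix[OF oS(1) WS(1) S1(3) pc(1)] con_con[OF hW _ phi_pow(1) xc(1), of "inv h1" n1] hH
    by (simp add: x1_def[symmetric] \<tau>1_def)
  have fix4: "con (\<phi> [^] n2) ?W x4 = con \<tau>4 ?W x4"
  proof -
    have "con \<tau>4 ?W x4 = con (\<phi> [^] ?n3 \<otimes> inv h2) ?W x2"
      unfolding x4_def using con_con[OF hW phi_pow(1) tH(2) xc(2), of n1] hG
      by (simp add: \<tau>4_def m_assoc)
    also have "\<dots> = con (\<phi> [^] ?n3) ?W x2"
      using inv_fix[OF oS(2) WS(2) S2(3) pc(2)] con_con[OF hW _ phi_pow(1) xc(2), of "inv h2" ?n3] hH
      by (simp add: x2_def[symmetric])
    also have "\<dots> = con (\<phi> [^] n2) ?W x4"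
      unfolding x4_def using con_con[OF hW phi_pow(1) phi_pow(1) xc(2), of n2 n1] hG
      by (simp add: nat_pow_mult add.commute)
    finally show ?thesis by simp
  qed
  have fix3: "con (\<phi> [^] ?n3) ?W x3 = con \<tau>4 ?W (con \<tau>1 ?W x3)"
  proof -
    have "con (\<phi> [^] ?n3) ?W x3 = con (\<phi> [^] ?n3 \<otimes> inv (h1 \<otimes> h2)) ?W x3"
      using inv_fix[OF oS(3) WS(3) S3(3) pc(3)] con_con[OF hW _ phi_pow(1) xc(3), of "inv (h1 \<otimes> h2)" ?n3] hH
      by (simp add: x3_def[symmetric])
    also have "\<phi> [^] ?n3 \<otimes> inv (h1 \<otimes> h2) = \<tau>4 \<otimes> \<tau>1"
      unfolding \<tau>1_def \<tau>4_def using hG by (simp add: inv_mult_group m_assoc)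
    finally show ?thesis using con_con[OF hW tH(1) tH(2) xc(3)] by simp
  qed
  \<comment> \<open>Needed to split the action of a product: \<open>\<tau>4 \<tau>1 - 1\<close> on
    \<open>x3\<close> is \<open>\<tau>1 - 1\<close> on \<open>x3\<close> together with
    \<open>\<tau>4 - 1\<close> on \<open>z\<close>.\<close>
  define z where "z = con \<tau>1 ?W x3"
  have zc: "z \<in> carrier (A ?W)" unfolding z_def using con_closed[OF hW tH(1) xc(3)] .
  have vxz: "v ?W x4 = \<omega>" "v ?W z = \<omega>"
    unfolding x4_def z_def using v_con[OF hW] phi_pow(1) tH xc vx by simp_all
  let ?t = "tr ?W"
  define u where "u = ?t n1 x1 \<otimes>\<^bsub>A ?W\<^esub> ?t n2 x4 \<otimes>\<^bsub>A ?W\<^esub> inv\<^bsub>A ?W\<^esub> ?t ?n3 x3"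
  have tc: "?t n1 x1 \<in> carrier (A ?W)" "?t n2 x4 \<in> carrier (A ?W)" "?t ?n3 x3 \<in> carrier (A ?W)"
    using tr_closed[OF hW] xc x4c by auto
  have uc: "u \<in> carrier (A ?W)" unfolding u_def using tc by simp
  \<comment> \<open>A trace multiplies the valuation by its length, and the lengths satisfy
    \<open>n1 + n2 = ?n3\<close>.\<close>
  have "v ?W u = \<one>\<^bsub>\<Omega>\<^esub>"
    unfolding u_def using tc xc x4c vx vxz v_tr[OF hW] by (simp add: Om.nat_pow_mult)
  then have uu: "u \<in> units ?W" using uc by (simp add: units_iff)
  interpret dp: group_hom "A ?W" "A ?W" "delta \<phi> ?W" using group_hom_delta[OF hW phi(1)] .
  interpret d1: group_hom "A ?W" "A ?W" "delta \<tau>1 ?W" using group_hom_delta[OF hW tH(1)] .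
  interpret d4: group_hom "A ?W" "A ?W" "delta \<tau>4 ?W" using group_hom_delta[OF hW tH(2)] .
  have D1: "delta \<phi> ?W (?t n1 x1) = delta \<tau>1 ?W x1"
    unfolding delta_tr[OF hW xc(1)] by (simp add: delta_def fix1)
  have D4: "delta \<phi> ?W (?t n2 x4) = delta \<tau>4 ?W x4"
    unfolding delta_tr[OF hW x4c] by (simp add: delta_def fix4)
  have D3: "delta \<phi> ?W (?t ?n3 x3) = delta \<tau>1 ?W x3 \<otimes>\<^bsub>A ?W\<^esub> delta \<tau>4 ?W z"
  proof -
    have "delta \<phi> ?W (?t ?n3 x3) = con \<tau>4 ?W z \<otimes>\<^bsub>A ?W\<^esub> inv\<^bsub>A ?W\<^esub> x3"
      unfolding delta_tr[OF hW xc(3)] by (simp add: delta_def fix3 z_def)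
    also have "\<dots> = delta \<tau>1 ?W x3 \<otimes>\<^bsub>A ?W\<^esub> delta \<tau>4 ?W z"
      unfolding delta_def z_def[symmetric] using AW.quotient_mult[OF zc con_closed[OF hW tH(2) zc] xc(3)] by simp
    finally show ?thesis .
  qed
  \<comment> \<open>The restricted primes are not units themselves. Pairing those moved by the same
    inertia element gives quotients of valuation zero, as \<open>augmentation\<close>
    requires.\<close>
  define a1 where "a1 = x1 \<otimes>\<^bsub>A ?W\<^esub> inv\<^bsub>A ?W\<^esub> x3"
  define a4 where "a4 = x4 \<otimes>\<^bsub>A ?W\<^esub> inv\<^bsub>A ?W\<^esub> z"
  have au: "a1 \<in> units ?W" "a4 \<in> units ?W"
    unfolding a1_def a4_def using xc x4c zc vx vxz by (simp_all add: units_iff)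
  have "delta \<phi> ?W u = delta \<tau>1 ?W x1 \<otimes>\<^bsub>A ?W\<^esub> delta \<tau>4 ?W x4 \<otimes>\<^bsub>A ?W\<^esub>
      inv\<^bsub>A ?W\<^esub> (delta \<tau>1 ?W x3 \<otimes>\<^bsub>A ?W\<^esub> delta \<tau>4 ?W z)"
    unfolding u_def D3[symmetric] using tc by (simp add: D1 D4)
  also have "\<dots> = delta \<tau>1 ?W a1 \<otimes>\<^bsub>A ?W\<^esub> delta \<tau>4 ?W a4"
    unfolding a1_def a4_def using xc x4c zc by (simp add: AW.inv_mult AW.m_ac)
  also have "\<dots> \<in> augmentation ?W"
  proof (rule subgroup.m_closed[OF subgroup_augmentation[OF hW]])
    show "delta \<tau>1 ?W a1 \<in> augmentation ?W" "delta \<tau>4 ?W a4 \<in> augmentation ?W"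
      unfolding augmentation_def using tH dt au by (blast intro: generate.incl)+
  qed
  finally have "delta \<phi> ?W u \<in> augmentation ?W" .
  then obtain w where w: "w \<in> carrier (A U)" "ind ?Z ?W u = res ?Z H (ind H U w)"
    using ind_unit_is_norm[OF j uu] by blast
  \<comment> \<open>Here the twist by \<open>\<phi> [^] n1\<close> is removed: the norm of the
    untwisted trace is restricted from \<open>H\<close>.\<close>
  have "ind ?Z ?W (?t n2 x4) = res ?Z H y2"
  proof -
    have "ind ?Z ?W (?t n2 x4) = con (\<phi> [^] n1) ?Z (ind ?Z ?W (?t n2 x2))"
      unfolding x4_def con_phi_tr[OF hW xc(2), symmetric]
      using con_ind[OF hW hZ WZ phi_pow(1) tr_closed[OF hW xc(2)]] by simp
    also have "ind ?Z ?W (?t n2 x2) = res ?Z H y2" using ry tr_ind[OF hW hZ WZ xc(2)] by simp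
    also have "con (\<phi> [^] n1) ?Z (res ?Z H y2) = res ?Z H y2"
      using con_res_normalizer[OF osub_H hZ ZH phi_pow(1) yc(2)] .
    finally show ?thesis .
  qed
  then have "ind ?Z ?W u = res ?Z H (y1 \<otimes>\<^bsub>A H\<^esub> y2 \<otimes>\<^bsub>A H\<^esub> inv\<^bsub>A H\<^esub> y3)"
    unfolding u_def using tc yc ry tr_ind[OF hW hZ WZ] xc by simp
  from trans[OF this[symmetric] w(2)] have "y1 \<otimes>\<^bsub>A H\<^esub> y2 \<otimes>\<^bsub>A H\<^esub> inv\<^bsub>A H\<^esub> y3 = ind H U w"
    by (rule inj_res_H_Z[OF j0 _ iU.hom_closed[OF w(1)], rotated]) (simp add: yc)
  moreover have "y1 \<otimes>\<^bsub>A H\<^esub> y2 = (y1 \<otimes>\<^bsub>A H\<^esub> y2 \<otimes>\<^bsub>A H\<^esub> inv\<^bsub>A H\<^esub> y3) \<otimes>\<^bsub>A H\<^esub> y3"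
    using yc by (simp add: AH.m_assoc)
  ultimately have "y1 \<otimes>\<^bsub>A H\<^esub> y2 = ind H U w \<otimes>\<^bsub>A H\<^esub> y3" by simp
  then show ?thesis using w(1) unfolding y1_def y2_def y3_def by (intro bexI)
qed

text \<open>Two primes of \<open>S\<close> differ by a unit. As \<open>W j\<close> is unramified in
  \<open>S\<close>, this unit is a norm from \<open>W j\<close>, whose norm to \<open>H\<close>
  passes through \<open>U\<close>.\<close>

lemma prime_independence:
  assumes j: "j > 0" and S: "frobenius_subgroup S n" "W j \<subseteq> S"
    and p: "prime_element C v \<omega> S \<pi>" "prime_element C v \<omega> S \<pi>'"
  shows "\<exists>w\<in>carrier (A U). ind H S \<pi> [^]\<^bsub>A H\<^esub> (k::nat) = ind H U w \<otimes>\<^bsub>A H\<^esub> ind H S \<pi>' [^]\<^bsub>A H\<^esub> k"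
proof -
  have oS: "osub S" using S frobenius_subgroup_osub by blast
  have oW: "osub (W j)" using j hnormal_W hnormal_osub by blast
  have SH: "S \<subseteq> H" using osub_subset oS by blast
  interpret AH: comm_group "A H" using comm_group_A[OF osub_H] .
  interpret AS: comm_group "A S" using comm_group_A[OF oS] .
  interpret i: group_hom "A S" "A H" "ind H S" using group_hom_ind[OF oS osub_H SH] .
  interpret vS: group_hom "A S" \<Omega> "v S" using group_hom_v[OF oS] .
  interpret iU: group_hom "A U" "A H" "ind H U" using group_hom_ind[OF osub_U osub_H U_subset] .
  have pc: "\<pi> \<in> carrier (A S)" "\<pi>' \<in> carrier (A S)" "v S \<pi> = \<omega>" "v S \<pi>' = \<omega>"
    using p by (auto simp: prime_element_def)
  define a where "a = \<pi> \<otimes>\<^bsub>A S\<^esub> inv\<^bsub>A S\<^esub> \<pi>'"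
  have au: "a \<in> units S" unfolding a_def using pc by (simp add: units_iff)
  obtain s where s: "FN_exact \<Omega> C v S (W j) s" using exact_S_W[OF S(1) j S(2)] by blast
  obtain b where b: "b \<in> units (W j)" "a = ind S (W j) b" using subsetD[OF FN_exactD(4)[OF s] au] by blast
  then have bc: "b \<in> carrier (A (W j))" by (simp add: units_iff)
  let ?w = "ind U (W j) b"
  have wc: "?w \<in> carrier (A U)" using hom_closed_A(2)[OF oW osub_U W_subset(1) bc] .
  have "ind H S a = ind H U ?w"
    unfolding b(2) using ind_ind[OF oW oS osub_H S(2) SH bc] ind_ind[OF oW osub_U osub_H W_subset(1) U_subset bc]
    by simp
  moreover have "\<pi> = a \<otimes>\<^bsub>A S\<^esub> \<pi>'" unfolding a_def using pc by (simp add: AS.m_assoc)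
  ultimately have "ind H S \<pi> = ind H U ?w \<otimes>\<^bsub>A H\<^esub> ind H S \<pi>'"
    using pc au by (simp add: units_iff)
  then have "ind H S \<pi> [^]\<^bsub>A H\<^esub> k = ind H U (?w [^]\<^bsub>A U\<^esub> k) \<otimes>\<^bsub>A H\<^esub> ind H S \<pi>' [^]\<^bsub>A H\<^esub> k"
    using wc pc by (simp add: AH.nat_pow_distrib iU.hom_nat_pow)
  then show ?thesis by (intro bexI[OF _ iU.G.nat_pow_closed[OF wc]])
qed

section \<open>The map \<open>Upsilon\<close> modulo norms\<close>

abbreviation "N \<equiv> norm_group C H U"
abbreviation "\<Sigma> \<equiv> frobenius_group G T \<Omega> d U"

lemma f_index_H: "f_index \<Omega> d (carrier G) H = f"
  using d_surj by (simp add: f_index_def f_def)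

lemma d_norm_eq:
  assumes "x \<in> carrier \<Omega>" "d h = x [^]\<^bsub>\<Omega>\<^esub> f" shows "d_norm G \<Omega> d H h = x"
  unfolding d_norm_def f_index_H
  using assms Om.pow_cancel[OF f_pos] by (intro the_equality) auto

lemma Frob_iff: "h \<in> Frob G \<Omega> \<omega> d H \<longleftrightarrow> h \<in> H \<and> (\<exists>n>0. d h = \<omega> [^]\<^bsub>\<Omega>\<^esub> (n * f))"
proof (cases "h \<in> H")
  case True
  then obtain x where x: "x \<in> carrier \<Omega>" "d h = x [^]\<^bsub>\<Omega>\<^esub> f"
    using d_image_H by (auto simp: Om.pw_def)
  have "x = \<omega> [^]\<^bsub>\<Omega>\<^esub> n \<longleftrightarrow> d h = \<omega> [^]\<^bsub>\<Omega>\<^esub> (n * f)" for n :: nat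
    using x Om.pow_cancel[OF f_pos x(1), of "\<omega> [^]\<^bsub>\<Omega>\<^esub> n"] by (auto simp: Om.nat_pow_pow)
  then show ?thesis
    using True d_norm_eq[OF x] by (auto simp: Frob_def Omega_pos_def)
qed (simp add: Frob_def)

text \<open>A prime in \<open>P\<close> keeps \<open>\<omega>\<close> nontrivial, hence of infinite
  order, and only then is the exponent unique.\<close>

lemma omega_mult_eq:
  assumes "P \<noteq> {}" "n > 0" "d h = \<omega> [^]\<^bsub>\<Omega>\<^esub> (n * f)"
  shows "omega_mult \<Omega> \<omega> (d_norm G \<Omega> d H h) = n"
proof -
  have "\<omega> \<noteq> \<one>\<^bsub>\<Omega>\<^esub>" using assms(1) Om.omega_notin_pw_prime one_in_pw by blast
  then have neq: "\<omega> [^]\<^bsub>\<Omega>\<^esub> a \<noteq> \<omega> [^]\<^bsub>\<Omega>\<^esub> b" if "a < b" for a b :: nat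
  proof -
    have "\<omega> [^]\<^bsub>\<Omega>\<^esub> b = \<omega> [^]\<^bsub>\<Omega>\<^esub> a \<otimes>\<^bsub>\<Omega>\<^esub> \<omega> [^]\<^bsub>\<Omega>\<^esub> (b - a)"
      using that by (simp add: Om.nat_pow_mult)
    moreover have "\<omega> [^]\<^bsub>\<Omega>\<^esub> (b - a) \<noteq> \<one>\<^bsub>\<Omega>\<^esub>"
      using that Om.torsion_free[of "b - a" \<omega>] \<open>\<omega> \<noteq> \<one>\<^bsub>\<Omega>\<^esub>\<close> by auto
    ultimately have "inv\<^bsub>\<Omega>\<^esub> (\<omega> [^]\<^bsub>\<Omega>\<^esub> a) \<otimes>\<^bsub>\<Omega>\<^esub> \<omega> [^]\<^bsub>\<Omega>\<^esub> b \<noteq> \<one>\<^bsub>\<Omega>\<^esub>" by simp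
    then show ?thesis by auto
  qed
  have "d_norm G \<Omega> d H h = \<omega> [^]\<^bsub>\<Omega>\<^esub> n"
    using assms(3) by (intro d_norm_eq) (auto simp: Om.nat_pow_pow)
  moreover have "k = n" if "\<omega> [^]\<^bsub>\<Omega>\<^esub> n = \<omega> [^]\<^bsub>\<Omega>\<^esub> k" for k
    using that neq[of k n] neq[of n k] by (cases k n rule: linorder_cases) auto
  ultimately show ?thesis
    unfolding omega_mult_def using assms(2) by (intro the_equality) auto
qed

lemma Frob_mult:
  assumes "h \<in> Frob G \<Omega> \<omega> d H" "h' \<in> Frob G \<Omega> \<omega> d H"
  shows "h \<otimes> h' \<in> Frob G \<Omega> \<omega> d H"
proof -
  obtain n n' where n: "h \<in> H" "n > 0" "d h = \<omega> [^]\<^bsub>\<Omega>\<^esub> (n * f)"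
    and n': "h' \<in> H" "n' > 0" "d h' = \<omega> [^]\<^bsub>\<Omega>\<^esub> (n' * f)"
    using assms unfolding Frob_iff by blast
  have "h \<otimes> h' \<in> H" using n n' H(1) subgroup.m_closed by fast
  moreover have "d (h \<otimes> h') = \<omega> [^]\<^bsub>\<Omega>\<^esub> ((n + n') * f)"
    using n n' H_closed by (simp add: Om.nat_pow_mult add_mult_distrib)
  ultimately show ?thesis unfolding Frob_iff using n(2) by (intro conjI exI[of _ "n + n'"]) simp_all
qed

lemma frobenius_subgroup_Frob:
  assumes "h \<in> Frob G \<Omega> \<omega> d H" shows "\<exists>n>0. frobenius_subgroup (\<Sigma> h) n"
  using assms frobenius_subgroup_frobenius_group unfolding Frob_iff by blast

lemma osub_Frob: "h \<in> Frob G \<Omega> \<omega> d H \<Longrightarrow> osub (\<Sigma> h)"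
  using frobenius_subgroup_Frob[of h] frobenius_subgroup_osub[of "\<Sigma> h"] by auto

text \<open>This keeps the claims about all choices of prime elements from being vacuous.\<close>

lemma prime_choice_exists: "\<exists>\<pi>. prime_choice G T \<Omega> \<omega> d C v H U \<pi>"
proof -
  have "\<exists>a. prime_element C v \<omega> (\<Sigma> h) a" if "h \<in> Frob G \<Omega> \<omega> d H" for h
  proof -
    have "\<omega> \<in> v (\<Sigma> h) ` carrier (A (\<Sigma> h))"
      using valuation osub_Base[OF osub_Frob[OF that]] by (simp add: Val_def)
    then show ?thesis unfolding prime_element_def by (metis imageE)
  qed
  then show ?thesis unfolding prime_choice_def by (intro bchoice ballI)
qed

lemma subgroup_N: "subgroup N (A H)"
proof -
  interpret iU: group_hom "A U" "A H" "ind H U" using group_hom_ind[OF osub_U osub_H U_subset] .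
  show ?thesis unfolding norm_group_def by (rule iU.img_is_subgroup)
qed

lemma ind_self: "osub K \<Longrightarrow> a \<in> carrier (A K) \<Longrightarrow> ind K K a = a"
  using ric osub_Base by (simp add: ric_functor_Ab_def)

text \<open>For empty \<open>P\<close> the multiplicity \<open>omega_mult\<close> is a junk value, but then all groups are
  trivial and the norm group is everything.\<close>

lemma norm_group_trivial:
  assumes "P = {}" shows "N = carrier (A H)"
proof -
  have "m = 1" using P_number_m prime_factor_nat[of m] assms by (auto simp: P_number_def)
  have "H \<subseteq> U"
  proof
    fix x assume x: "x \<in> H"
    then show "x \<in> U" using pow_m_in_U[OF x, of 1] \<open>m = 1\<close> H_closed by simp
  qed
  then have "U = H" using U_subset by blast
  then show ?thesis unfolding norm_group_def using ind_self[OF osub_H] by (simp cong: image_cong)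
qed

definition rep :: "('g \<Rightarrow> 'a) \<Rightarrow> 'g \<Rightarrow> 'a"
  where "rep \<pi> h = ind H (\<Sigma> h) (\<pi> h) [^]\<^bsub>A H\<^esub> P_part_compl P (omega_mult \<Omega> \<omega> (d_norm G \<Omega> d H h))"

lemma Upsilon_eq: "Upsilon P G T \<Omega> \<omega> d C H U \<pi> h = N #>\<^bsub>A H\<^esub> rep \<pi> h"
  by (simp add: Upsilon_def rep_def)

lemma rep_closed:
  assumes "prime_choice G T \<Omega> \<omega> d C v H U \<pi>" "h \<in> Frob G \<Omega> \<omega> d H"
  shows "rep \<pi> h \<in> carrier (A H)"
proof -
  interpret AH: comm_group "A H" using comm_group_A[OF osub_H] .
  have "\<pi> h \<in> carrier (A (\<Sigma> h))" using assms by (auto simp: prime_choice_def prime_element_def)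
  then show ?thesis
    unfolding rep_def using hom_closed_A(2)[OF osub_Frob[OF assms(2)] osub_H] osub_subset[OF osub_Frob[OF assms(2)]]
    by simp
qed

text \<open>Independence and multiplicativity both reduce to this comparison of representatives.
  Empty \<open>P\<close> is settled here once and for all, as the norm group is then
  everything.\<close>

lemma N_cosets_eq:
  assumes "P \<noteq> {} \<Longrightarrow> \<exists>w\<in>carrier (A U). a = ind H U w \<otimes>\<^bsub>A H\<^esub> b"
    and "a \<in> carrier (A H)" "b \<in> carrier (A H)"
  shows "N #>\<^bsub>A H\<^esub> a = N #>\<^bsub>A H\<^esub> b"
proof -
  interpret AH: comm_group "A H" using comm_group_A[OF osub_H] .
  interpret N: subgroup N "A H" by (rule subgroup_N)
  have "a \<in> N #>\<^bsub>A H\<^esub> b"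
  proof (cases "P = {}")
    case True
    then have "a \<otimes>\<^bsub>A H\<^esub> inv\<^bsub>A H\<^esub> b \<in> N" using norm_group_trivial assms(2,3) by simp
    then show ?thesis using N.rcos_module_rev[OF AH.is_group assms(3,2)] by blast
  next
    case False
    then obtain w where "w \<in> carrier (A U)" "a = ind H U w \<otimes>\<^bsub>A H\<^esub> b" using assms(1) by blast
    then show ?thesis using AH.rcosI[OF _ N.subset assms(3), of "ind H U w"] by (simp add: norm_group_def)
  qed
  then show ?thesis using AH.repr_independence[OF _ assms(3) subgroup_N] by blast
qed

lemma Upsilon_independent:
  assumes "prime_choice G T \<Omega> \<omega> d C v H U \<pi>" "prime_choice G T \<Omega> \<omega> d C v H U \<pi>'"
    and h: "h \<in> Frob G \<Omega> \<omega> d H"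
  shows "Upsilon P G T \<Omega> \<omega> d C H U \<pi> h = Upsilon P G T \<Omega> \<omega> d C H U \<pi>' h"
  unfolding Upsilon_eq
proof (rule N_cosets_eq)
  obtain n where n: "h \<in> H" "n > 0" "d h = \<omega> [^]\<^bsub>\<Omega>\<^esub> (n * f)" using h unfolding Frob_iff by blast
  have "m * P_part P n > 0" using m_pos P_number_pos[OF P_number_P_part] by simp
  then show "\<exists>w\<in>carrier (A U). rep \<pi> h = ind H U w \<otimes>\<^bsub>A H\<^esub> rep \<pi>' h"
    unfolding rep_def using assms
    by (intro prime_independence[OF _ frobenius_subgroup_frobenius_group[OF n] W_subset_frobenius_group[OF n dvd_refl]])
      (auto simp: prime_choice_def)
qed (use assms rep_closed in blast)+

lemma Upsilon_hom:
  assumes \<pi>: "prime_choice G T \<Omega> \<omega> d C v H U \<pi>"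
  shows "Upsilon P G T \<Omega> \<omega> d C H U \<pi> \<in> hom (G\<lparr>carrier := Frob G \<Omega> \<omega> d H\<rparr>) (norm_quotient C H U)"
proof (rule homI)
  interpret AH: comm_group "A H" using comm_group_A[OF osub_H] .
  interpret N: normal N "A H" using AH.subgroup_imp_normal[OF subgroup_N] .
  let ?F = "Frob G \<Omega> \<omega> d H"
  note closed = rep_closed[OF \<pi>]
  show "Upsilon P G T \<Omega> \<omega> d C H U \<pi> h \<in> carrier (norm_quotient C H U)"
    if "h \<in> carrier (G\<lparr>carrier := ?F\<rparr>)" for h
    using that closed by (simp add: Upsilon_eq norm_quotient_def carrier_FactGroup)
  fix h h' assume "h \<in> carrier (G\<lparr>carrier := ?F\<rparr>)" "h' \<in> carrier (G\<lparr>carrier := ?F\<rparr>)"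
  then have h: "h \<in> ?F" and h': "h' \<in> ?F" by auto
  then have hh': "h \<otimes> h' \<in> ?F" by (rule Frob_mult)
  obtain n n' where n: "h \<in> H" "n > 0" "d h = \<omega> [^]\<^bsub>\<Omega>\<^esub> (n * f)"
    and n': "h' \<in> H" "n' > 0" "d h' = \<omega> [^]\<^bsub>\<Omega>\<^esub> (n' * f)"
    using h h' unfolding Frob_iff by blast
  have nn': "h \<otimes> h' \<in> H" "n + n' > 0" "d (h \<otimes> h') = \<omega> [^]\<^bsub>\<Omega>\<^esub> ((n + n') * f)"
    using hh' n n' H_closed by (simp_all add: Frob_iff Om.nat_pow_mult add_mult_distrib)
  have "N #>\<^bsub>A H\<^esub> (rep \<pi> h \<otimes>\<^bsub>A H\<^esub> rep \<pi> h') = N #>\<^bsub>A H\<^esub> rep \<pi> (h \<otimes> h')"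
  proof (rule N_cosets_eq)
    assume P: "P \<noteq> {}"
    \<comment> \<open>A common level for the three Frobenius groups. Using \<open>P\<close>-parts
      keeps it a \<open>P\<close>-number, and the factor \<open>m\<close> makes the image of
      \<open>W ?j\<close> under \<open>d\<close> as large as that of \<open>Z ?j\<close>.\<close>
    let ?j = "m * (P_part P n * P_part P n' * P_part P (n + n'))"
    have j: "m dvd ?j" "P_number P ?j" using P_number_m P_number_P_part by simp_all
    have Wj: "W ?j \<subseteq> \<Sigma> h" "W ?j \<subseteq> \<Sigma> h'" "W ?j \<subseteq> \<Sigma> (h \<otimes> h')"
      using W_subset_frobenius_group[OF n, of ?j] W_subset_frobenius_group[OF n', of ?j]
        W_subset_frobenius_group[OF nn', of ?j] by simp_all
    show "\<exists>w\<in>carrier (A U). rep \<pi> h \<otimes>\<^bsub>A H\<^esub> rep \<pi> h' = ind H U w \<otimes>\<^bsub>A H\<^esub> rep \<pi> (h \<otimes> h')"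
      unfolding rep_def omega_mult_eq[OF P n(2,3)] omega_mult_eq[OF P n'(2,3)] omega_mult_eq[OF P nn'(2,3)]
      by (rule norm_relation[OF j frobenius_subgroup_frobenius_group[OF n] Wj(1) mem_frobenius_group[OF n] n(3)
            frobenius_subgroup_frobenius_group[OF n'] Wj(2) mem_frobenius_group[OF n'] n'(3)
            frobenius_subgroup_frobenius_group[OF nn'] Wj(3) mem_frobenius_group[OF nn']])
        (use \<pi> h h' hh' in \<open>simp_all add: prime_choice_def\<close>)
  qed (use closed h h' hh' in simp_all)
  then show "Upsilon P G T \<Omega> \<omega> d C H U \<pi> (h \<otimes>\<^bsub>G\<lparr>carrier := ?F\<rparr>\<^esub> h') =
      Upsilon P G T \<Omega> \<omega> d C H U \<pi> h \<otimes>\<^bsub>norm_quotient C H U\<^esub> Upsilon P G T \<Omega> \<omega> d C H U \<pi> h'"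
    using closed[OF h] closed[OF h'] by (simp add: Upsilon_eq norm_quotient_def N.rcos_sum)
qed

end

theorem theorem4p4p16:
  fixes P :: "nat set"
    and G :: "'g monoid" and T :: "'g topology"
    and \<Omega> :: "'o monoid" and T\<Omega> :: "'o topology" and \<omega> :: 'o
    and d :: "'g \<Rightarrow> 'o"
    and E :: "('g set \<times> 'g set) ric" and M :: "'g set ric"
    and C :: "('g set, 'g, 'a) ric_functor" and v :: "'g set \<Rightarrow> 'a \<Rightarrow> 'o"
    and H U :: "'g set"
  assumes "\<forall>p\<in>P. prime p"
    and "pro_P_group P G T"
    and "topological_group \<Omega> T\<Omega>"
    and "\<exists>f. top_group_iso \<Omega> T\<Omega> (ZP_group P) (ZP_topology P) f"
    and "\<omega> \<in> carrier \<Omega>" and "closed_generated \<Omega> T\<Omega> \<omega> = carrier \<Omega>"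
    and "d \<in> hom G \<Omega>" and "d ` carrier G = carrier \<Omega>" and "continuous_map T T\<Omega> d"
    and "spectrum G T E"
    and "FN_datum G T \<Omega> \<omega> d E M C v"
    and "(H, U) \<in> Base E"
    and "openin (subtopology T H) U"
  shows "(\<forall>h\<in>Frob G \<Omega> \<omega> d H. \<forall>h'\<in>Frob G \<Omega> \<omega> d H. h \<otimes>\<^bsub>G\<^esub> h' \<in> Frob G \<Omega> \<omega> d H) \<and>
    (\<forall>h\<in>Frob G \<Omega> \<omega> d H. frobenius_group G T \<Omega> d U h \<in> Ind M H) \<and>
    (\<exists>\<pi>. prime_choice G T \<Omega> \<omega> d C v H U \<pi>) \<and>
    (\<forall>\<pi>. prime_choice G T \<Omega> \<omega> d C v H U \<pi> \<longrightarrow>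
       Upsilon P G T \<Omega> \<omega> d C H U \<pi>
         \<in> hom (G\<lparr>carrier := Frob G \<Omega> \<omega> d H\<rparr>) (norm_quotient C H U)) \<and>
    (\<forall>\<pi> \<pi>'. prime_choice G T \<Omega> \<omega> d C v H U \<pi> \<and> prime_choice G T \<Omega> \<omega> d C v H U \<pi>' \<longrightarrow>
       (\<forall>h\<in>Frob G \<Omega> \<omega> d H.
          Upsilon P G T \<Omega> \<omega> d C H U \<pi> h = Upsilon P G T \<Omega> \<omega> d C H U \<pi>' h))"
proof -
  have prof: "profinite_group G T" using assms(2) by (simp add: pro_P_group_def)
  interpret top_group G T using prof by (simp add: profinite_group_def topological_group_iff)
  interpret O: top_group \<Omega> T\<Omega> using assms(3) by (simp add: topological_group_iff)
  have comp: "compact_space T" using prof by (simp add: profinite_group_def)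
  \<comment> \<open>Compactness passes from \<open>G\<close> to \<open>\<Omega>\<close> because
    \<open>d\<close> is continuous and onto.\<close>
  have "compactin T\<Omega> (d ` topspace T)"
    using comp assms(9) by (intro image_compactin) (auto simp: compact_space_def)
  then have comp': "compact_space T\<Omega>"
    using assms(8) by (simp add: compact_space_def topspace_T O.topspace_T)
  obtain iso where "top_group_iso \<Omega> T\<Omega> (ZP_group P) (ZP_topology P) iso" using assms(4) ..
  then interpret Om: procyclic \<Omega> T\<Omega> \<omega> P by (rule ZP_procyclic[OF assms(1,3) _ comp' assms(5,6)])
  have HB: "H \<in> Base (flat E)" using assms(12) by (force simp: flat_def)
  have cover: "Mackey_cover G E M" and arith: "arithmetic_system G T M"
    and inert: "inertially_finite_system G T \<Omega> d M" and mack: "cohomological_Mackey_functor G M C"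
    and val: "v \<in> Val G \<Omega> \<omega> d M C"
    and ex: "\<forall>H\<in>Base (flat E). \<forall>U. open_subgroup_of G T U H \<longrightarrow>
       (\<forall>V\<in>E_ur G T \<Omega> d U. \<forall>\<phi>\<in>frobenius_elt G \<Omega> \<omega> d U V. FN_exact \<Omega> C v U V \<phi>)"
    using assms(11) by (simp_all add: FN_datum_def)
  have HM: "H \<in> Base M" using cover HB by (auto simp: Mackey_cover_def subsystem_def)
  have cl: "closed_subgroup G T H" "closed_subgroup G T U" "U \<lhd> G\<lparr>carrier := H\<rparr>"
    using assms(10,12) by (auto simp: spectrum_def subgroup_system2_def)
  have Usub: "subgroup U (G\<lparr>carrier := H\<rparr>)" using normal_imp_subgroup[OF cl(3)] .
  have "open_subgroup_of G T U H" using Usub assms(13) by (simp add: open_subgroup_of_def)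
  \<comment> \<open>The cover is arithmetic, so \<open>U\<close> is a restriction subgroup of
    \<open>H\<close>, and inertial finiteness of the cover bounds its index.\<close>
  then have "finite_index G H U"
    using arith inert HM by (auto simp: arithmetic_system_def inertially_finite_system_def)
  then have PU: "P_number P (index G H U)"
    using cl(1) Usub assms(2,13) by (intro pro_P_index) (auto simp: closed_subgroup_def)
  have fin: "finite_index \<Omega> (carrier \<Omega>) (d ` H)"
    using inert HM assms(8) by (auto simp: inertially_finite_system_def inertially_finite_def)
  interpret ramified_extension \<Omega> T\<Omega> \<omega> P G T d H U
    using assms(7,9,13) comp cl fin PU
    by (intro ramified_extension.intro ramified_extension_axioms.intro Om.procyclic_axioms top_group_axioms)
      (simp_all add: closed_subgroup_def)
  have "\<omega> [^]\<^bsub>\<Omega>\<^esub> f \<in> d ` H" unfolding d_image_H by (rule Om.pow_in_pw[OF assms(5)])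
  then obtain \<phi> where phi: "\<phi> \<in> H" "d \<phi> = \<omega> [^]\<^bsub>\<Omega>\<^esub> f" by (rule imageE) simp
  interpret FN_extension \<Omega> T\<Omega> \<omega> P G T d H U M C v \<phi>
    by (intro FN_extension.intro FN_extension_axioms.intro ramified_extension_axioms mack arith val HM
        assms(8) phi ex[rule_format, OF HB])
  show ?thesis
    by (intro conjI ballI allI impI Frob_mult prime_choice_exists Upsilon_hom Upsilon_independent
        osub_Res_Ind(2) osub_Frob osub_H osub_subset; (elim conjE)?; assumption)
qed

end
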